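(* Let $s\ge 0$. Let $r\ge 1$ and let $\mathcal L$ be the Fourier multiplier operator on $\mathbb T^2$ with symbol $b:\mathbb Z^2\to\mathbb R$ satisfying $|b(\mathbf k)|\le C|\mathbf k|^{r-1}$ for all $\mathbf k\in\mathbb Z^2$ with $|\mathbf k|\ge N_0$, for some constants $C>0$, $N_0\ge 0$. Put $\lambda_{\mathbf k}=k_1 b(\mathbf k)$ for $\mathbf k=(k_1,k_2)\in\mathbb Z^2$, so that $\partial_x\mathcal L\psi_{\mathbf k}=i\lambda_{\mathbf k}\psi_{\mathbf k}$ for all $\mathbf k\in\mathbb Z^2$. Assume: (i) for all $(k_1,k_2)\in\mathbb Z^2$, $\lambda_{(-k_1,k_2)}=-\lambda_{(k_1,k_2)}$ and $\lambda_{(k_1,-k_2)}=\lambda_{(k_1,k_2)}$; (ii) for all $(k_1,k_2)\in\mathbb Z^2$ with $k_1\ne 0$, the only solutions $j_2\in\mathbb Z$ of $\lambda_{(k_1,j_2)}=\lambda_{(k_1,k_2)}$ are $j_2=\pm k_2$; (iii) for all $(k_1,k_2)\in\mathbb Z^2$ with $k_2\neq 0$, the unique solution $j_1\in\mathbb Z$ of $\lambda_{(j_1,k_2)}=\lambda_{(k_1,k_2)}$ is $j_1=k_1$. Let $\mathbb I\subset\mathbb Z^2$ be a maximal subset such that $\lambda_{\mathbf k}\ne\lambda_{\mathbf k'}$ for all $\mathbf k,\mathbf k'\in\mathbb I$ with $\mathbf k\ne\mathbf k'$. Suppose that $$\gamma:=\inf_{\mathbf k,\mathbf k'\in\mathbb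 I,\ \mathbf k\ne\mathbf k'}|\lambda_{\mathbf k}-\lambda_{\mathbf k'}|>0,$$ and define $$\gamma':=\sup_{S\subset\mathbb I,\ S\text{ finite}}\ \ \inf_{\mathbf k,\mathbf k'\in\mathbb I\setminus S,\ \mathbf k\ne\mathbf k'}|\lambda_{\mathbf k}-\lambda_{\mathbf k'}|.$$ Then, for any $T>\frac{2\pi}{\gamma'}$ and for each $u_0,u_1\in H^s_p(\mathbb T^2)$ with $\widehat{u_0}(0,0)=\widehat{u_1}(0,0)$, there exists a function $h\in L^2([0,T];H^s_p(\mathbb T^2))$ such that the unique solution $u$ of $$u\in C([0,T];H^s_p(\mathbb T^2)),\qquad \partial_t u=\partial_x\mathcal L u+G(h)(t)\in H^{s-r}_p(\mathbb T^2),\ t\in(0,T),\qquad u(0)=u_0,$$ satisfies $u(T)=u_1$. Furthermore, $$\|h\|_{L^2([0,T];H^s_p(\mathbb T^2))}\le \nu\left(\|u_0\|_{H^s_p(\mathbb T^2)}+\|u_1\|_{H^s_p(\mathbb T^2)}\right)$$ for some positive constant $\nu\equiv\nu(s,g_2,T)$.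
   Context: $\mathbb T=\mathbb R/2\pi\mathbb Z$, $\mathbb T^2=\mathbb R^2/(2\pi\mathbb Z)^2$, $\mathbf k=(k_1,k_2)$, $|\mathbf k|=\sqrt{k_1^2+k_2^2}$. For a distribution $u$ on $\mathbb T^2$, $\widehat u(\mathbf k)=\frac1{(2\pi)^2}\langle u,e^{-i\mathbf k\cdot\mathbf x}\rangle$; for functions on $\mathbb T$, $\widehat g(k)=\frac1{2\pi}\int_0^{2\pi}g(x)e^{-ikx}dx$. $H^s_p(\mathbb T^2)$ is the space of distributions $u$ on $\mathbb T^2$ with $\|u\|^2_{H^s_p(\mathbb T^2)}=(2\pi)^2\sum_{\mathbf k\in\mathbb Z^2}(1+|\mathbf k|)^{2s}|\widehat u(\mathbf k)|^2<\infty$. $\psi_{\mathbf k}(\mathbf x)=\frac1{2\pi}e^{i\mathbf k\cdot\mathbf x}$, $\mathbf x=(x,y)\in\mathbb T^2$. The operator $\mathcal L$ is defined by $\widehat{\mathcal Lu}(\mathbf k)=b(\mathbf k)\widehat u(\mathbf k)$. The functions $g_1,g_2\in C^\infty(\mathbb T)$ are fixed, non-negative, real-valued, with $\int_{\mathbb T}g_1(x)dx=1=\int_{\mathbb T}g_2(y)dy$, and such that $\omega_1=\{x\in\mathbb T: g_1(x)>0\}$ and $\omega_2=\{y\in\mathbb T:g_2(y)>0\}$ are open intervals, with $\operatorname{supp}g_i=\overline{\omega_i}$. The operator $G:H^s_p(\mathbb T^2)\to H^s_p(\mathbb T^2)$, $s\ge0$, is $$G(\phi)(x,y)=g_2(y)\,G_1(\phi)(x,y)+g_1(x)\,G_2(\phi)(x,y),$$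 $$G_1(\phi)(x,y)=\tfrac1{2\pi}\phi(x,y)-\tfrac1{(2\pi)^2}\int_0^{2\pi}\phi(x',y)dx',\qquad G_2(\phi)(x,y)=\tfrac1{2\pi}\phi(x,y)-\tfrac1{(2\pi)^2}\int_0^{2\pi}\phi(x,y')dy'.$$ It is applied to $h$ for each fixed $t$. Solutions of the non-homogeneous problem are understood in the mild sense: $u(t)=U(t)u_0+\int_0^tU(t-t')Gh(t')dt'$, where $U(t)$ is the unitary group given by $\widehat{U(t)\varphi}(\mathbf k)=e^{ik_1b(\mathbf k)t}\widehat\varphi(\mathbf k)$. If $\gamma'=+\infty$, the condition $T>2\pi/\gamma'$ means $T>0$. The constant $\nu$ does not depend on $u_0,u_1$ (the operator $\mathcal L$ being fixed). *)

theory Defs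
  imports "HOL-Analysis.Analysis"
begin

text \<open>
  Functions on the torus are functions on the plane that are \<open>2\<pi>\<close>-periodic in each
  variable. Smoothness: by induction, all mixed derivatives exist and are differentiable,
  hence continuous; the order of differentiation is then irrelevant.
\<close>

definition pdx :: "(real \<times> real \<Rightarrow> complex) \<Rightarrow> real \<times> real \<Rightarrow> complex" where
  "pdx \<phi> p = frechet_derivative \<phi> (at p) (1, 0)"

definition pdy :: "(real \<times> real \<Rightarrow> complex) \<Rightarrow> real \<times> real \<Rightarrow> complex" where
  "pdy \<phi> p = frechet_derivative \<phi> (at p) (0, 1)"

definition test_function :: "(real \<times> real \<Rightarrow> complex) \<Rightarrow> bool" where
  "test_function \<phi> \<longleftrightarrow>
     (\<forall>x y. \<phi> (x + 2 * pi, y) = \<phi> (x, y) \<and> \<phi> (x, y + 2 * pi) = \<phi> (x, y)) \<and>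
     (\<forall>m n p. (pdx ^^ m) ((pdy ^^ n) \<phi>) differentiable (at p))"

definition test_seminorm :: "nat \<Rightarrow> (real \<times> real \<Rightarrow> complex) \<Rightarrow> real" where
  "test_seminorm N \<phi> = (\<Sum>m\<le>N. \<Sum>n\<le>N. SUP p. norm ((pdx ^^ m) ((pdy ^^ n) \<phi>) p))"

text \<open>
  A distribution is a continuous complex-linear functional on the test functions; to make
  equality of functionals the equality of distributions, it is set to \<open>0\<close> off the test functions.
\<close>

definition is_distribution :: "((real \<times> real \<Rightarrow> complex) \<Rightarrow> complex) \<Rightarrow> bool" where
  "is_distribution u \<longleftrightarrow>
     (\<forall>\<phi> \<psi>. test_function \<phi> \<longrightarrow> test_function \<psi> \<longrightarrow> u (\<lambda>p. \<phi> p + \<psi> p) = u \<phi> + u \<psi>) \<and>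
     (\<forall>c \<phi>. test_function \<phi> \<longrightarrow> u (\<lambda>p. c * \<phi> p) = c * u \<phi>) \<and>
     (\<exists>C N. \<forall>\<phi>. test_function \<phi> \<longrightarrow> norm (u \<phi>) \<le> C * test_seminorm N \<phi>) \<and>
     (\<forall>\<phi>. \<not> test_function \<phi> \<longrightarrow> u \<phi> = 0)"

lemma is_distribution_zero: "is_distribution (\<lambda>_. 0)"
  unfolding is_distribution_def by (auto intro: exI[of _ 0])

lemma bdd_above_norm_periodic:
  fixes F :: "real \<times> real \<Rightarrow> complex"
  assumes per: "\<And>x y. F (x + 2 * pi, y) = F (x, y)" "\<And>x y. F (x, y + 2 * pi) = F (x, y)"
    and cont: "continuous_on UNIV F"
  shows "bdd_above (range (\<lambda>p. norm (F p)))"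
proof -
  have shift: "f (x + real_of_int n * (2 * pi)) = f x"
    if f: "\<And>x. f (x + 2 * pi) = f x" for f :: "real \<Rightarrow> complex" and x n
  proof (induction n rule: int_induct[where k = 0])
    case base
    show ?case by simp
  next
    case (step1 i)
    have "f (x + real_of_int (i + 1) * (2 * pi)) = f ((x + real_of_int i * (2 * pi)) + 2 * pi)"
      by (simp add: algebra_simps)
    with step1 f show ?case by simp
  next
    case (step2 i)
    have "f (x + real_of_int i * (2 * pi)) = f ((x + real_of_int (i - 1) * (2 * pi)) + 2 * pi)"
      by (simp add: algebra_simps)
    with step2 f show ?case by simp
  qed
  have red: "\<exists>n. x + real_of_int n * (2 * pi) \<in> {0..2 * pi}" for x :: real
  proof -
    define n where "n = - \<lfloor>x / (2 * pi)\<rfloor>"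
    have "real_of_int \<lfloor>x / (2 * pi)\<rfloor> * (2 * pi) \<le> x"
      using pos_le_divide_eq[of "2 * pi" "real_of_int \<lfloor>x / (2 * pi)\<rfloor>" x] by simp
    moreover have "x < (real_of_int \<lfloor>x / (2 * pi)\<rfloor> + 1) * (2 * pi)"
      using pos_divide_less_eq[of "2 * pi" x "real_of_int \<lfloor>x / (2 * pi)\<rfloor> + 1"] by simp
    ultimately have "x + real_of_int n * (2 * pi) \<in> {0..2 * pi}"
      unfolding n_def by (simp add: algebra_simps)
    then show ?thesis by blast
  qed
  have "compact (F ` ({0..2 * pi} \<times> {0..2 * pi}))"
    by (intro compact_continuous_image compact_Times continuous_on_subset[OF cont]) auto
  then obtain B where B: "\<And>p. p \<in> {0..2 * pi} \<times> {0..2 * pi} \<Longrightarrow> norm (F p) \<le> B"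
    using compact_imp_bounded bounded_iff by (metis image_eqI)
  have "norm (F (x, y)) \<le> B" for x y
  proof -
    obtain m n where mn: "x + real_of_int m * (2 * pi) \<in> {0..2 * pi}"
        "y + real_of_int n * (2 * pi) \<in> {0..2 * pi}"
      using red by meson
    have "F (x, y) = F (x + real_of_int m * (2 * pi), y + real_of_int n * (2 * pi))"
      using shift[of "\<lambda>x. F (x, y + real_of_int n * (2 * pi))" x m]
        shift[of "\<lambda>y. F (x, y)" y n] per by simp
    with B mn show ?thesis by simp
  qed
  then show ?thesis by (auto intro!: bdd_aboveI[of _ B])
qed

lemma pd_periodic:
  assumes per: "\<And>x y. F (x + 2 * pi, y) = F (x, y)" "\<And>x y. F (x, y + 2 * pi) = F (x, y)"
    and diff: "\<And>p. F differentiable (at p)"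
  shows "pdx F (x + 2 * pi, y) = pdx F (x, y)" "pdx F (x, y + 2 * pi) = pdx F (x, y)"
    "pdy F (x + 2 * pi, y) = pdy F (x, y)" "pdy F (x, y + 2 * pi) = pdy F (x, y)"
proof -
  have shift: "frechet_derivative F (at (p + c)) = frechet_derivative F (at p)"
    if c: "\<And>q. F (q + c) = F q" for p c
  proof -
    have "(F has_derivative frechet_derivative F (at (p + c))) (at (p + c))"
      using diff frechet_derivative_works by blast
    moreover have "((\<lambda>q. q + c) has_derivative (\<lambda>h. h)) (at p)"
      by (auto intro!: derivative_eq_intros)
    ultimately have "((\<lambda>q. F (q + c)) has_derivative (\<lambda>h. frechet_derivative F (at (p + c)) h)) (at p)"
      using has_derivative_compose[of "\<lambda>q. q + c" "\<lambda>h. h" p UNIV F] by blast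
    then have "(F has_derivative frechet_derivative F (at (p + c))) (at p)"
      using c by simp
    then show ?thesis
      using frechet_derivative_at by metis
  qed
  have 1: "F (q + (2 * pi, 0)) = F q" "F (q + (0, 2 * pi)) = F q" for q
    using per by (cases q; simp)+
  show "pdx F (x + 2 * pi, y) = pdx F (x, y)" "pdy F (x + 2 * pi, y) = pdy F (x, y)"
    using shift[OF 1(1), of "(x, y)"] by (simp_all add: pdx_def pdy_def)
  show "pdx F (x, y + 2 * pi) = pdx F (x, y)" "pdy F (x, y + 2 * pi) = pdy F (x, y)"
    using shift[OF 1(2), of "(x, y)"] by (simp_all add: pdx_def pdy_def)
qed

lemma test_function_pd_bdd:
  assumes "test_function \<phi>"
  shows "bdd_above (range (\<lambda>p. norm ((pdx ^^ m) ((pdy ^^ n) \<phi>) p)))"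
proof -
  define per :: "(real \<times> real \<Rightarrow> complex) \<Rightarrow> bool" where
    "per F \<longleftrightarrow> (\<forall>x y. F (x + 2 * pi, y) = F (x, y) \<and> F (x, y + 2 * pi) = F (x, y))" for F
  have diff: "(pdx ^^ m) ((pdy ^^ n) \<phi>) differentiable (at p)" for m n p
    using assms unfolding test_function_def by blast
  have y: "per ((pdy ^^ n) \<phi>)" for n
  proof (induction n)
    case 0
    then show ?case using assms by (simp add: per_def test_function_def)
  next
    case (Suc n)
    have "\<And>p. (pdy ^^ n) \<phi> differentiable (at p)" using diff[of 0 n] by simp
    with Suc pd_periodic[of "(pdy ^^ n) \<phi>"] show ?case by (simp add: per_def)
  qed
  have x: "per ((pdx ^^ m) ((pdy ^^ n) \<phi>))" for m n
  proof (induction m)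
    case 0
    then show ?case using y by simp
  next
    case (Suc m)
    with diff[of m n] pd_periodic[of "(pdx ^^ m) ((pdy ^^ n) \<phi>)"] show ?case
      by (simp add: per_def)
  qed
  have "continuous_on UNIV ((pdx ^^ m) ((pdy ^^ n) \<phi>))"
    using diff by (simp add: continuous_at_imp_continuous_on differentiable_imp_continuous_within)
  with x[of m n] show ?thesis
    by (intro bdd_above_norm_periodic) (auto simp: per_def)
qed

lemma test_seminorm_mono:
  assumes "test_function \<phi>" "N \<le> N'"
  shows "0 \<le> test_seminorm N \<phi>" "test_seminorm N \<phi> \<le> test_seminorm N' \<phi>"
proof -
  have nn: "0 \<le> (SUP p. norm ((pdx ^^ m) ((pdy ^^ n) \<phi>) p))" for m n
    by (rule cSUP_upper2[OF test_function_pd_bdd[OF assms(1)], of 0]) auto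
  show "0 \<le> test_seminorm N \<phi>"
    unfolding test_seminorm_def by (intro sum_nonneg nn)
  have "test_seminorm N \<phi> \<le> (\<Sum>m\<le>N. \<Sum>n\<le>N'. SUP p. norm ((pdx ^^ m) ((pdy ^^ n) \<phi>) p))"
    unfolding test_seminorm_def using assms(2) by (intro sum_mono sum_mono2 nn) auto
  also have "\<dots> \<le> test_seminorm N' \<phi>"
    unfolding test_seminorm_def using assms(2) by (intro sum_mono2 sum_nonneg nn) auto
  finally show "test_seminorm N \<phi> \<le> test_seminorm N' \<phi>" .
qed

lemma is_distribution_add:
  assumes "is_distribution u" "is_distribution v"
  shows "is_distribution (\<lambda>\<phi>. u \<phi> + v \<phi>)"
proof -
  obtain C N where CN: "\<And>\<phi>. test_function \<phi> \<Longrightarrow> norm (u \<phi>) \<le> C * test_seminorm N \<phi>"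
    using assms(1) unfolding is_distribution_def by blast
  obtain D M where DM: "\<And>\<phi>. test_function \<phi> \<Longrightarrow> norm (v \<phi>) \<le> D * test_seminorm M \<phi>"
    using assms(2) unfolding is_distribution_def by blast
  have "norm (u \<phi> + v \<phi>) \<le> (\<bar>C\<bar> + \<bar>D\<bar>) * test_seminorm (max N M) \<phi>" if t: "test_function \<phi>" for \<phi>
  proof -
    have "C * test_seminorm N \<phi> \<le> \<bar>C\<bar> * test_seminorm (max N M) \<phi>"
      using test_seminorm_mono[OF t, of N "max N M"] by (intro mult_mono) auto
    moreover have "D * test_seminorm M \<phi> \<le> \<bar>D\<bar> * test_seminorm (max N M) \<phi>"
      using test_seminorm_mono[OF t, of M "max N M"] by (intro mult_mono) auto
    ultimately show ?thesis
      using CN[OF t] DM[OF t] norm_triangle_ineq[of "u \<phi>" "v \<phi>"] by (simp add: distrib_right)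
  qed
  then have bd: "\<exists>C N. \<forall>\<phi>. test_function \<phi> \<longrightarrow> norm (u \<phi> + v \<phi>) \<le> C * test_seminorm N \<phi>"
    by blast
  show ?thesis
    unfolding is_distribution_def
  proof (intro conjI)
    show "\<exists>C N. \<forall>\<phi>. test_function \<phi> \<longrightarrow> norm (u \<phi> + v \<phi>) \<le> C * test_seminorm N \<phi>"
      by (rule bd)
  qed (use assms in \<open>simp_all add: is_distribution_def algebra_simps\<close>)
qed

lemma is_distribution_scaleR:
  assumes "is_distribution u"
  shows "is_distribution (\<lambda>\<phi>. a *\<^sub>R u \<phi>)"
proof -
  obtain C N where CN: "\<And>\<phi>. test_function \<phi> \<Longrightarrow> norm (u \<phi>) \<le> C * test_seminorm N \<phi>"
    using assms unfolding is_distribution_def by blast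
  have "norm (a *\<^sub>R u \<phi>) \<le> (\<bar>a\<bar> * C) * test_seminorm N \<phi>" if "test_function \<phi>" for \<phi>
    using mult_left_mono[OF CN[OF that], of "\<bar>a\<bar>"] by (simp add: mult.assoc)
  then have bd: "\<exists>C N. \<forall>\<phi>. test_function \<phi> \<longrightarrow> norm (a *\<^sub>R u \<phi>) \<le> C * test_seminorm N \<phi>"
    by blast
  show ?thesis
    unfolding is_distribution_def
  proof (intro conjI)
    show "\<exists>C N. \<forall>\<phi>. test_function \<phi> \<longrightarrow> norm (a *\<^sub>R u \<phi>) \<le> C * test_seminorm N \<phi>"
      by (rule bd)
  qed (use assms in \<open>simp_all add: is_distribution_def algebra_simps\<close>)
qed

typedef distribution = "{u. is_distribution u}"
  morphisms pairing Abs_distribution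
  using is_distribution_zero by blast

setup_lifting type_definition_distribution

instantiation distribution :: real_vector
begin

lift_definition zero_distribution :: distribution is "\<lambda>_. 0"
  by (rule is_distribution_zero)

lift_definition plus_distribution :: "distribution \<Rightarrow> distribution \<Rightarrow> distribution"
  is "\<lambda>u v \<phi>. u \<phi> + v \<phi>"
  by (rule is_distribution_add)

lift_definition scaleR_distribution :: "real \<Rightarrow> distribution \<Rightarrow> distribution"
  is "\<lambda>a u \<phi>. a *\<^sub>R u \<phi>"
  by (rule is_distribution_scaleR)

lift_definition uminus_distribution :: "distribution \<Rightarrow> distribution" is "\<lambda>u \<phi>. - u \<phi>"
  using is_distribution_scaleR[where a = "-1"] by simp

lift_definition minus_distribution :: "distribution \<Rightarrow> distribution \<Rightarrow> distribution"
  is "\<lambda>u v \<phi>. u \<phi> - v \<phi>"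
  using is_distribution_add[OF _ is_distribution_scaleR[where a = "-1"]] by simp

instance
  by (standard; transfer; simp add: fun_eq_iff algebra_simps)

end

definition fourier_coeff :: "distribution \<Rightarrow> int \<times> int \<Rightarrow> complex" where
  "fourier_coeff u = (\<lambda>(k1, k2). of_real (1 / (2 * pi)\<^sup>2) *
     pairing u (\<lambda>(x, y). exp (- \<i> * complex_of_real (of_int k1 * x + of_int k2 * y))))"

definition freq_norm :: "int \<times> int \<Rightarrow> real" where
  "freq_norm = (\<lambda>(k1, k2). sqrt ((of_int k1)\<^sup>2 + (of_int k2)\<^sup>2))"

definition Hs :: "real \<Rightarrow> distribution set" where
  "Hs s = {u. (\<lambda>k. (1 + freq_norm k) powr (2 * s) * (norm (fourier_coeff u k))\<^sup>2) summable_on UNIV}"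

definition Hs_norm :: "real \<Rightarrow> distribution \<Rightarrow> real" where
  "Hs_norm s u =
     sqrt ((2 * pi)\<^sup>2 * (\<Sum>\<^sub>\<infinity>k. (1 + freq_norm k) powr (2 * s) * (norm (fourier_coeff u k))\<^sup>2))"

text \<open>The multiplier with symbol \<open>m\<close>, for symbols of at most polynomial growth.\<close>

definition fourier_multiplier :: "(int \<times> int \<Rightarrow> complex) \<Rightarrow> distribution \<Rightarrow> distribution" where
  "fourier_multiplier m u = (THE v. \<forall>k. fourier_coeff v k = m k * fourier_coeff u k)"

definition eigen_freq :: "(int \<times> int \<Rightarrow> real) \<Rightarrow> int \<times> int \<Rightarrow> real" where
  "eigen_freq b k = of_int (fst k) * b k"

definition propagator :: "(int \<times> int \<Rightarrow> real) \<Rightarrow> real \<Rightarrow> distribution \<Rightarrow> distribution" where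
  "propagator b t = fourier_multiplier (\<lambda>k. exp (\<i> * complex_of_real (eigen_freq b k * t)))"

text \<open>
  The set where \<open>g\<close> is positive is an open interval of the circle, that is, the image of an open
  interval of the line under the quotient map.
\<close>

definition control_profile :: "(real \<Rightarrow> real) \<Rightarrow> bool" where
  "control_profile g \<longleftrightarrow>
     (\<forall>n x. (deriv ^^ n) g differentiable (at x)) \<and>
     (\<forall>x. g (x + 2 * pi) = g x) \<and>
     (\<forall>x. 0 \<le> g x) \<and>
     integral {0..2 * pi} g = 1 \<and>
     (\<exists>a b. a < b \<and> {x. 0 < g x} = (\<Union>n::int. {a + 2 * pi * of_int n <..< b + 2 * pi * of_int n})) \<and>
     closure {x. g x \<noteq> 0} = closure {x. 0 < g x}"

definition G1 :: "(real \<times> real \<Rightarrow> complex) \<Rightarrow> real \<times> real \<Rightarrow> complex" where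
  "G1 \<phi> = (\<lambda>(x, y). of_real (1 / (2 * pi)) * \<phi> (x, y)
     - of_real (1 / (2 * pi)\<^sup>2) * integral {0..2 * pi} (\<lambda>x'. \<phi> (x', y)))"

definition G2 :: "(real \<times> real \<Rightarrow> complex) \<Rightarrow> real \<times> real \<Rightarrow> complex" where
  "G2 \<phi> = (\<lambda>(x, y). of_real (1 / (2 * pi)) * \<phi> (x, y)
     - of_real (1 / (2 * pi)\<^sup>2) * integral {0..2 * pi} (\<lambda>y'. \<phi> (x, y')))"

definition G_fun ::
  "(real \<Rightarrow> real) \<Rightarrow> (real \<Rightarrow> real) \<Rightarrow> (real \<times> real \<Rightarrow> complex) \<Rightarrow> real \<times> real \<Rightarrow> complex" where
  "G_fun g1 g2 \<phi> = (\<lambda>(x, y). of_real (g2 y) * G1 \<phi> (x, y) + of_real (g1 x) * G2 \<phi> (x, y))"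

text \<open>
  The operator on functions is its own transpose for the bilinear pairing, so its action on
  distributions is given by duality with the same formula.
\<close>

lemma G_fun_transpose:
  fixes f \<phi> :: "real \<times> real \<Rightarrow> complex"
  assumes f: "continuous_on UNIV f" and \<phi>: "continuous_on UNIV \<phi>"
    and g1: "continuous_on UNIV g1" and g2: "continuous_on UNIV g2"
  shows "integral (cbox (0, 0) (2 * pi, 2 * pi)) (\<lambda>p. G_fun g1 g2 f p * \<phi> p) =
         integral (cbox (0, 0) (2 * pi, 2 * pi)) (\<lambda>p. f p * G_fun g1 g2 \<phi> p)"
proof -
  let ?B = "cbox (0, 0) (2 * pi, 2 * pi)" and ?J = "{0..2 * pi}"
  define X where "X F y = integral ?J (\<lambda>x'. F (x', y))" for F :: "real \<times> real \<Rightarrow> complex" and y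
  define Y where "Y F x = integral ?J (\<lambda>y'. F (x, y'))" for F :: "real \<times> real \<Rightarrow> complex" and x
  have cX: "continuous_on UNIV (X F)" if "continuous_on UNIV F" for F
    unfolding X_def box_real(2)[symmetric]
    by (rule integral_continuous_on_param)
       (auto simp: split_beta intro!: continuous_on_compose2[OF that] continuous_intros)
  have cY: "continuous_on UNIV (Y F)" if "continuous_on UNIV F" for F
    unfolding Y_def box_real(2)[symmetric]
    by (rule integral_continuous_on_param)
       (auto simp: split_beta intro!: continuous_on_compose2[OF that] continuous_intros)
  note ci = continuous_intros continuous_on_compose2[OF f] continuous_on_compose2[OF \<phi>]
    continuous_on_compose2[OF g1] continuous_on_compose2[OF g2]
    continuous_on_compose2[OF cX[OF f]] continuous_on_compose2[OF cX[OF \<phi>]]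
    continuous_on_compose2[OF cY[OF f]] continuous_on_compose2[OF cY[OF \<phi>]]
  define c d :: complex where "c = of_real (1 / (2 * pi))" and "d = of_real (1 / (2 * pi)\<^sup>2)"
  let ?A = "\<lambda>p. c * (of_real (g2 (snd p)) + of_real (g1 (fst p))) * f p * \<phi> p"
  let ?P = "\<lambda>F H p. of_real (g2 (snd p)) * X F (snd p) * H p :: complex"
  let ?Q = "\<lambda>F H p. of_real (g1 (fst p)) * Y F (fst p) * H p :: complex"
  have int: "?A integrable_on ?B" "?P f \<phi> integrable_on ?B" "?P \<phi> f integrable_on ?B"
      "?Q f \<phi> integrable_on ?B" "?Q \<phi> f integrable_on ?B"
    by (intro integrable_continuous ci; simp)+
  have expand: "integral ?B (\<lambda>p. G_fun g1 g2 F p * H p) =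
      integral ?B (\<lambda>p. c * (of_real (g2 (snd p)) + of_real (g1 (fst p))) * F p * H p)
        - d * integral ?B (?P F H) - d * integral ?B (?Q F H)"
    if i: "(\<lambda>p. c * (of_real (g2 (snd p)) + of_real (g1 (fst p))) * F p * H p) integrable_on ?B"
      "?P F H integrable_on ?B" "?Q F H integrable_on ?B" for F H
  proof -
    have "G_fun g1 g2 F p * H p =
        c * (of_real (g2 (snd p)) + of_real (g1 (fst p))) * F p * H p - d * ?P F H p - d * ?Q F H p" for p
      by (cases p) (simp add: G_fun_def G1_def G2_def X_def Y_def c_def d_def algebra_simps add_divide_distrib)
    then show ?thesis
      using i by (simp add: integral_diff integrable_diff integrable_on_mult_right)
  qed
  have P: "integral ?B (?P F H) = integral ?J (\<lambda>y. of_real (g2 y) * X F y * X H y)"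
    if c: "continuous_on UNIV F" "continuous_on UNIV H" for F H
  proof -
    have cont: "continuous_on ?B (?P F H)"
      by (intro ci continuous_on_compose2[OF cX[OF c(1)]] continuous_on_compose2[OF c(2)]; simp)
    have "integral ?B (?P F H) = integral ?J (\<lambda>x. integral ?J (\<lambda>y. ?P F H (x, y)))"
      using integral_prod_continuous[OF cont] by simp
    also have "\<dots> = integral ?J (\<lambda>y. integral ?J (\<lambda>x. ?P F H (x, y)))"
      using integral_swap_continuous[of 0 0 "2 * pi" "2 * pi" "\<lambda>x y. ?P F H (x, y)"] cont
      by (simp add: split_beta)
    finally show ?thesis by (simp add: X_def)
  qed
  have Q: "integral ?B (?Q F H) = integral ?J (\<lambda>x. of_real (g1 x) * Y F x * Y H x)"
    if c: "continuous_on UNIV F" "continuous_on UNIV H" for F H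
  proof -
    have cont: "continuous_on ?B (?Q F H)"
      by (intro ci continuous_on_compose2[OF cY[OF c(1)]] continuous_on_compose2[OF c(2)]; simp)
    have "integral ?B (?Q F H) = integral ?J (\<lambda>x. integral ?J (\<lambda>y. ?Q F H (x, y)))"
      using integral_prod_continuous[OF cont] by simp
    then show ?thesis by (simp add: Y_def)
  qed
  have A': "(\<lambda>p. c * (of_real (g2 (snd p)) + of_real (g1 (fst p))) * \<phi> p * f p) = ?A"
    by (simp add: fun_eq_iff)
  have "integral ?B (\<lambda>p. G_fun g1 g2 f p * \<phi> p) = integral ?B (\<lambda>p. G_fun g1 g2 \<phi> p * f p)"
    using expand[OF int(1,2,4)] expand[of \<phi> f, unfolded A', OF int(1,3,5)]
      P[OF f \<phi>] P[OF \<phi> f] Q[OF f \<phi>] Q[OF \<phi> f]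
    by (simp add: mult.assoc mult.commute mult.left_commute)
  then show ?thesis by (simp add: mult.commute)
qed

text \<open>Meaningful for smooth periodic \<open>g1\<close> and \<open>g2\<close>, which keep \<open>G_fun g1 g2 \<phi>\<close> a test function.\<close>

definition G :: "(real \<Rightarrow> real) \<Rightarrow> (real \<Rightarrow> real) \<Rightarrow> distribution \<Rightarrow> distribution" where
  "G g1 g2 u = Abs_distribution (\<lambda>\<phi>. if test_function \<phi> then pairing u (G_fun g1 g2 \<phi>) else 0)"

text \<open>
  Strong measurability and the Bochner integral with respect to the norm of \<open>Hs s\<close>. The library
  versions take the norm from the type class, whereas here the type carries one norm for each \<open>s\<close>.
\<close>

definition Hs_measurable :: "real \<Rightarrow> 'a measure \<Rightarrow> ('a \<Rightarrow> distribution) \<Rightarrow> bool" where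
  "Hs_measurable s M f \<longleftrightarrow> f ` space M \<subseteq> Hs s \<and>
     (\<exists>F. (\<forall>i. simple_function M (F i) \<and> F i ` space M \<subseteq> Hs s) \<and>
          (AE t in M. (\<lambda>i. Hs_norm s (F i t - f t)) \<longlonglongrightarrow> 0))"

definition has_Hs_integral ::
  "real \<Rightarrow> 'a measure \<Rightarrow> ('a \<Rightarrow> distribution) \<Rightarrow> distribution \<Rightarrow> bool" where
  "has_Hs_integral s M f v \<longleftrightarrow> Hs_measurable s M f \<and> v \<in> Hs s \<and>
     (\<exists>F. (\<forall>i. Bochner_Integration.simple_bochner_integrable M (F i) \<and> F i ` space M \<subseteq> Hs s) \<and>
          (\<lambda>i. \<integral>\<^sup>+ t. ennreal (Hs_norm s (f t - F i t)) \<partial>M) \<longlonglongrightarrow> 0 \<and>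
          (\<lambda>i. Hs_norm s (Bochner_Integration.simple_bochner_integral M (F i) - v)) \<longlonglongrightarrow> 0)"

definition L2_Hs :: "real \<Rightarrow> real \<Rightarrow> (real \<Rightarrow> distribution) set" where
  "L2_Hs T s = {h. Hs_measurable s (lebesgue_on {0..T}) h \<and>
     integrable (lebesgue_on {0..T}) (\<lambda>t. (Hs_norm s (h t))\<^sup>2)}"

definition L2_Hs_norm :: "real \<Rightarrow> real \<Rightarrow> (real \<Rightarrow> distribution) \<Rightarrow> real" where
  "L2_Hs_norm T s h = sqrt (\<integral>t. (Hs_norm s (h t))\<^sup>2 \<partial>lebesgue_on {0..T})"

definition C_Hs :: "real \<Rightarrow> real \<Rightarrow> (real \<Rightarrow> distribution) set" where
  "C_Hs T s = {u. \<forall>t\<in>{0..T}. u t \<in> Hs s \<and>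
     ((\<lambda>\<tau>. Hs_norm s (u \<tau> - u t)) \<longlongrightarrow> 0) (at t within {0..T})}"

text \<open>Mild solutions on \<open>[0, T]\<close> of the equation with forcing \<open>f\<close> and initial datum \<open>u0\<close>.\<close>

definition mild_solution :: "real \<Rightarrow> (int \<times> int \<Rightarrow> real) \<Rightarrow> real \<Rightarrow>
    (real \<Rightarrow> distribution) \<Rightarrow> distribution \<Rightarrow> (real \<Rightarrow> distribution) \<Rightarrow> bool" where
  "mild_solution s b T f u0 u \<longleftrightarrow> u \<in> C_Hs T s \<and> u 0 = u0 \<and>
     (\<forall>t\<in>{0..T}. has_Hs_integral s (lebesgue_on {0..t})
        (\<lambda>t'. propagator b (t - t') (f t')) (u t - propagator b t u0))"

text \<open>
  The gaps live in \<open>ereal\<close>: the infimum over no pairs is \<open>\<infinity>\<close>, the asymptotic gap may be \<open>\<infinity>\<close>,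
  and then \<open>2\<pi>\<close> divided by it is \<open>0\<close>.
\<close>

definition spectral_gap :: "(int \<times> int \<Rightarrow> real) \<Rightarrow> (int \<times> int) set \<Rightarrow> ereal" where
  "spectral_gap lam K =
     (INF (k, k')\<in>{(k, k'). k \<in> K \<and> k' \<in> K \<and> k \<noteq> k'}. ereal \<bar>lam k - lam k'\<bar>)"

definition asymptotic_gap :: "(int \<times> int \<Rightarrow> real) \<Rightarrow> (int \<times> int) set \<Rightarrow> ereal" where
  "asymptotic_gap lam K = (SUP S\<in>{S. S \<subseteq> K \<and> finite S}. spectral_gap lam (K - S))"

end

theory Submission
  imports Defs
begin

text \<open>On Fourier coefficients the control operator is a matrix. A control of the form
  \<open>h(t)^(k) = q_l(T - t) a_k\<close> with \<open>l = lambda_k\<close>, where the functions \<open>q_l\<close> are biorthogonal on \<open>[0, T]\<close> to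
  the exponentials \<open>exp (i m t)\<close> over all eigenvalues \<open>m\<close>, reaches the target as soon as \<open>a\<close> solves the
  resonant part of the matrix equation, which couples only modes of equal eigenvalue. By (ii) and (iii) that
  part consists of uniformly invertible blocks of size at most two, so the norm of \<open>h\<close> is controlled once
  the \<open>q_l\<close> are bounded uniformly in \<open>l\<close>. No Riesz basis property is needed for this: under Ingham's gap
  condition \<open>q_l\<close> is a half sine wave times an exponential sum whose coefficients come from a Neumann
  series for a diagonally dominant Gram matrix, and finitely many further frequencies are annihilated by
  differences \<open>p(t) - exp (- i m e) p(t - e)\<close> with small delays \<open>e\<close>.\<close>

section \<open>Biorthogonal families under a gap condition\<close>

text \<open>A sup norm bound is what is wanted of q_l: every function of time built from these
  pulses then has Fourier coefficients dominated by one fixed sequence of a weighted l2 space, and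
  continuity, Bochner integrability and the norm of h follow by dominated convergence. The half sine
  wave fits the critical length because its transform decays quadratically: on an interval of length
  L the off-diagonal Gram entries compare with the series of 1/(4m^2-1) over nonzero integers m,
  whose sum is 1. The column sums are at most (2 pi/(gL))^2, which is below 1 exactly when gL > 2
  pi. All modes with k1 = 0 share the eigenvalue 0, and (ii) is silent about them. They stay
  uncoupled because the g2 part of the operator ignores modes that are constant in x, while the g1
  part keeps k2 and so falls under (iii). Distributions are concrete functionals here, so they must
  first be shown to be determined by their coefficients, and the operator to be a convolution-type
  matrix. Both rest on Fourier series of test functions converging in every test seminorm.\<close>

lemma continuous_on_infsum:
  fixes f :: "'a \<Rightarrow> 'b::topological_space \<Rightarrow> 'c::banach"
  assumes bound: "\<And>x y. x \<in> X \<Longrightarrow> y \<in> Y \<Longrightarrow> norm (f x y) \<le> M x"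
    and summable: "M summable_on X"
    and cont: "\<And>x. x \<in> X \<Longrightarrow> continuous_on Y (f x)"
  shows "continuous_on Y (\<lambda>y. \<Sum>\<^sub>\<infinity>x\<in>X. f x y)"
proof (rule uniform_limit_theorem[OF _ Weierstrass_m_test_general[OF bound summable]])
  show "\<forall>\<^sub>F F in finite_subsets_at_top X. continuous_on Y (\<lambda>y. \<Sum>x\<in>F. f x y)"
    by (intro eventually_finite_subsets_at_top_weakI continuous_on_sum cont) auto
qed auto

lemma has_sum_integral_cbox:
  fixes f :: "'a \<Rightarrow> 'b::euclidean_space \<Rightarrow> 'c::banach"
  assumes bound: "\<And>x y. x \<in> X \<Longrightarrow> y \<in> cbox a b \<Longrightarrow> norm (f x y) \<le> M x"
    and summable: "M summable_on X"
    and cont: "\<And>x. x \<in> X \<Longrightarrow> continuous_on (cbox a b) (f x)"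
  shows "((\<lambda>x. integral (cbox a b) (f x)) has_sum
           integral (cbox a b) (\<lambda>y. \<Sum>\<^sub>\<infinity>x\<in>X. f x y)) X"
proof -
  \<comment> \<open>Extension by zero outside \<open>X\<close> makes the partial sum over every
    finite \<open>F\<close> continuous, as required below, and not only over those inside
    \<open>X\<close>.\<close>
  define h where "h x = (if x \<in> X then f x else (\<lambda>_. 0))" for x
  have cont_h: "continuous_on (cbox a b) (h x)" for x
    unfolding h_def using cont by auto
  have "uniform_limit (cbox a b) (\<lambda>F y. \<Sum>x\<in>F. h x y) (\<lambda>y. \<Sum>\<^sub>\<infinity>x\<in>X. h x y) (finite_subsets_at_top X)"
    by (rule Weierstrass_m_test_general[OF _ summable]) (simp add: h_def bound)
  moreover have "continuous_on (cbox a b) (\<lambda>y. \<Sum>x\<in>F. h x y)" for F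
    by (intro continuous_on_sum cont_h)
  ultimately obtain I J where IJ: "\<And>F. ((\<lambda>y. \<Sum>x\<in>F. h x y) has_integral I F) (cbox a b)"
    "((\<lambda>y. \<Sum>\<^sub>\<infinity>x\<in>X. h x y) has_integral J) (cbox a b)" "(I \<longlongrightarrow> J) (finite_subsets_at_top X)"
    by (rule uniform_limit_integral_cbox) auto
  have "I F = (\<Sum>x\<in>F. integral (cbox a b) (h x))" for F
  proof (cases "finite F")
    case True
    have "((\<lambda>y. \<Sum>x\<in>F. h x y) has_integral (\<Sum>x\<in>F. integral (cbox a b) (h x))) (cbox a b)"
      by (intro has_integral_sum True integrable_integral integrable_continuous cont_h)
    with IJ(1) show ?thesis using has_integral_unique by blast
  next
    case False
    then show ?thesis using IJ(1)[of F] by simp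
  qed
  then have "I = sum (\<lambda>x. integral (cbox a b) (h x))" by auto
  then have "((\<lambda>x. integral (cbox a b) (h x)) has_sum J) X"
    using IJ(3) by (simp add: has_sum_def)
  then have "((\<lambda>x. integral (cbox a b) (f x)) has_sum J) X"
    by (simp add: h_def cong: has_sum_cong)
  moreover have "(\<lambda>y. \<Sum>\<^sub>\<infinity>x\<in>X. h x y) = (\<lambda>y. \<Sum>\<^sub>\<infinity>x\<in>X. f x y)"
    by (intro ext infsum_cong) (simp add: h_def)
  ultimately show ?thesis
    using integral_unique[OF IJ(2)] by metis
qed

section \<open>Neumann series for matrices with small column sums\<close>

lemma l1_operator_bound:
  fixes M :: "'a \<Rightarrow> 'a \<Rightarrow> complex"
  assumes M: "\<And>\<mu>. \<mu> \<in> A \<Longrightarrow> (\<lambda>\<nu>. norm (M \<nu> \<mu>)) summable_on A"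
      "\<And>\<mu>. \<mu> \<in> A \<Longrightarrow> (\<Sum>\<^sub>\<infinity>\<nu>\<in>A. norm (M \<nu> \<mu>)) \<le> \<theta>"
    and x: "(\<lambda>\<mu>. norm (x \<mu>)) summable_on A"
  shows "(\<lambda>\<nu>. norm (\<Sum>\<^sub>\<infinity>\<mu>\<in>A. M \<nu> \<mu> * x \<mu>)) summable_on A"
    and "(\<Sum>\<^sub>\<infinity>\<nu>\<in>A. norm (\<Sum>\<^sub>\<infinity>\<mu>\<in>A. M \<nu> \<mu> * x \<mu>)) \<le> \<theta> * (\<Sum>\<^sub>\<infinity>\<mu>\<in>A. norm (x \<mu>))"
proof -
  let ?S = "\<lambda>\<mu>. \<Sum>\<^sub>\<infinity>\<nu>\<in>A. norm (M \<nu> \<mu>)"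
  have hs: "((\<lambda>\<nu>. norm (M \<nu> \<mu> * x \<mu>)) has_sum (?S \<mu> * norm (x \<mu>))) A" if "\<mu> \<in> A" for \<mu>
    unfolding norm_mult by (intro has_sum_cmult_left has_sum_infsum M that)
  have S0: "0 \<le> ?S \<mu>" for \<mu> by (intro infsum_nonneg) auto
  have x\<theta>: "(\<lambda>\<mu>. \<theta> * norm (x \<mu>)) summable_on A"
    by (intro summable_on_cmult_right x)
  have le: "?S \<mu> * norm (x \<mu>) \<le> \<theta> * norm (x \<mu>)" if "\<mu> \<in> A" for \<mu>
    using M(2)[OF that] by (intro mult_right_mono) auto
  have Sx: "(\<lambda>\<mu>. ?S \<mu> * norm (x \<mu>)) summable_on A"
    by (rule summable_on_comparison_test[OF x\<theta> le]) (auto simp: S0)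
  \<comment> \<open>Tonelli: the columns are summed first, where the hypothesis gives a bound by
    \<open>\<theta>\<close>; absolute summability of the double family then allows the rows to be
    summed first.\<close>
  have sig: "(\<lambda>(\<mu>, \<nu>). norm (M \<nu> \<mu> * x \<mu>)) summable_on A \<times> A"
    by (rule summable_on_SigmaI[where g = "\<lambda>\<mu>. ?S \<mu> * norm (x \<mu>)"]) (use hs Sx in auto)
  then have sig': "(\<lambda>(\<nu>, \<mu>). norm (M \<nu> \<mu> * x \<mu>)) summable_on A \<times> A"
    by (subst summable_on_swap) (simp add: case_prod_unfold)
  have row: "(\<lambda>\<mu>. norm (M \<nu> \<mu> * x \<mu>)) summable_on A" if "\<nu> \<in> A" for \<nu>
    using summable_on_SigmaD1[OF sig' that] by simp
  have rows: "(\<lambda>\<nu>. \<Sum>\<^sub>\<infinity>\<mu>\<in>A. norm (M \<nu> \<mu> * x \<mu>)) summable_on A"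
    using summable_on_Sigma_banach[OF sig'] by simp
  have nle: "norm (\<Sum>\<^sub>\<infinity>\<mu>\<in>A. M \<nu> \<mu> * x \<mu>) \<le> (\<Sum>\<^sub>\<infinity>\<mu>\<in>A. norm (M \<nu> \<mu> * x \<mu>))" if "\<nu> \<in> A" for \<nu>
    by (rule norm_infsum_bound[OF row[OF that]])
  show s: "(\<lambda>\<nu>. norm (\<Sum>\<^sub>\<infinity>\<mu>\<in>A. M \<nu> \<mu> * x \<mu>)) summable_on A"
    by (rule summable_on_comparison_test[OF rows nle]) auto
  have "(\<Sum>\<^sub>\<infinity>\<nu>\<in>A. norm (\<Sum>\<^sub>\<infinity>\<mu>\<in>A. M \<nu> \<mu> * x \<mu>)) \<le> (\<Sum>\<^sub>\<infinity>\<nu>\<in>A. \<Sum>\<^sub>\<infinity>\<mu>\<in>A. norm (M \<nu> \<mu> * x \<mu>))"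
    by (rule infsum_mono[OF s rows nle])
  also have "\<dots> = (\<Sum>\<^sub>\<infinity>\<mu>\<in>A. \<Sum>\<^sub>\<infinity>\<nu>\<in>A. norm (M \<nu> \<mu> * x \<mu>))"
    by (rule infsum_swap_banach[OF sig'])
  also have "\<dots> = (\<Sum>\<^sub>\<infinity>\<mu>\<in>A. ?S \<mu> * norm (x \<mu>))"
    by (intro infsum_cong infsumI hs)
  also have "\<dots> \<le> (\<Sum>\<^sub>\<infinity>\<mu>\<in>A. \<theta> * norm (x \<mu>))"
    by (rule infsum_mono[OF Sx x\<theta> le])
  also have "\<dots> = \<theta> * (\<Sum>\<^sub>\<infinity>\<mu>\<in>A. norm (x \<mu>))"
    by (rule infsum_cmult_right')
  finally show "(\<Sum>\<^sub>\<infinity>\<nu>\<in>A. norm (\<Sum>\<^sub>\<infinity>\<mu>\<in>A. M \<nu> \<mu> * x \<mu>)) \<le> \<theta> * (\<Sum>\<^sub>\<infinity>\<mu>\<in>A. norm (x \<mu>))" .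
qed

text \<open>Inverts \<open>1 + M\<close> on a unit vector. The space is l1 and not l2 because
  absolutely summable coefficients make the exponential series formed from them uniformly convergent
  and bounded by their l1 norm. The bound \<open>1 / (1 - \<theta>)\<close> is the geometric series
  and does not depend on \<open>l\<close>.\<close>

lemma neumann_delta:
  fixes M :: "'a \<Rightarrow> 'a \<Rightarrow> complex"
  assumes M: "\<And>\<mu>. \<mu> \<in> A \<Longrightarrow> (\<lambda>\<nu>. norm (M \<nu> \<mu>)) summable_on A"
      "\<And>\<mu>. \<mu> \<in> A \<Longrightarrow> (\<Sum>\<^sub>\<infinity>\<nu>\<in>A. norm (M \<nu> \<mu>)) \<le> \<theta>"
    and \<theta>: "0 \<le> \<theta>" "\<theta> < 1" and l: "l \<in> A"
  obtains d where "(\<lambda>\<mu>. norm (d \<mu>)) summable_on A" "(\<Sum>\<^sub>\<infinity>\<mu>\<in>A. norm (d \<mu>)) \<le> 1 / (1 - \<theta>)"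
    "\<And>\<nu>. \<nu> \<in> A \<Longrightarrow> d \<nu> + (\<Sum>\<^sub>\<infinity>\<mu>\<in>A. M \<nu> \<mu> * d \<mu>) = (if \<nu> = l then 1 else 0)"
proof -
  \<comment> \<open>\<open>D n\<close> is (-M)^n applied to the unit vector at \<open>l\<close>; its
    l1 norm is at most \<open>\<theta> ^ n\<close>.\<close>
  define D where "D = rec_nat (\<lambda>\<nu>. if \<nu> = l then 1 else 0 :: complex)
    (\<lambda>n x \<nu>. - (\<Sum>\<^sub>\<infinity>\<mu>\<in>A. M \<nu> \<mu> * x \<mu>))"
  have D0: "D 0 = (\<lambda>\<nu>. if \<nu> = l then 1 else 0)" and
    DS: "D (Suc n) = (\<lambda>\<nu>. - (\<Sum>\<^sub>\<infinity>\<mu>\<in>A. M \<nu> \<mu> * D n \<mu>))" for n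
    by (simp_all add: D_def)
  have Dn: "(\<lambda>\<mu>. norm (D n \<mu>)) summable_on A \<and> (\<Sum>\<^sub>\<infinity>\<mu>\<in>A. norm (D n \<mu>)) \<le> \<theta> ^ n" for n
  proof (induction n)
    case 0
    have "((\<lambda>\<mu>. norm (D 0 \<mu>)) has_sum 1) A"
      by (rule has_sum_finite_neutralI[of "{l}"]) (use l in \<open>auto simp: D0\<close>)
    then show ?case by (auto simp: has_sum_iff)
  next
    case (Suc n)
    then have "\<theta> * (\<Sum>\<^sub>\<infinity>\<mu>\<in>A. norm (D n \<mu>)) \<le> \<theta> * \<theta> ^ n"
      using \<theta> by (intro mult_left_mono) auto
    moreover have "(\<Sum>\<^sub>\<infinity>\<nu>\<in>A. norm (\<Sum>\<^sub>\<infinity>\<mu>\<in>A. M \<nu> \<mu> * D n \<mu>)) \<le> \<theta> * (\<Sum>\<^sub>\<infinity>\<mu>\<in>A. norm (D n \<mu>))"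
      using Suc by (intro l1_operator_bound M) auto
    moreover have "(\<lambda>\<nu>. norm (\<Sum>\<^sub>\<infinity>\<mu>\<in>A. M \<nu> \<mu> * D n \<mu>)) summable_on A"
      using Suc by (intro l1_operator_bound(1)[OF M]) auto
    ultimately show ?case by (simp add: DS)
  qed
  have geo: "((\<lambda>n. \<theta> ^ n) has_sum (1 / (1 - \<theta>))) UNIV"
    using \<theta> by (intro norm_summable_imp_has_sum geometric_sums) (auto simp: norm_power intro: summable_geometric)
  have Sn: "(\<lambda>n. \<Sum>\<^sub>\<infinity>\<mu>\<in>A. norm (D n \<mu>)) summable_on UNIV"
    by (rule summable_on_comparison_test[OF has_sum_imp_summable[OF geo]])
       (use Dn in \<open>auto intro!: infsum_nonneg\<close>)
  have sig: "(\<lambda>(n, \<mu>). norm (D n \<mu>)) summable_on UNIV \<times> A"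
    by (rule summable_on_SigmaI[where g = "\<lambda>n. \<Sum>\<^sub>\<infinity>\<mu>\<in>A. norm (D n \<mu>)"])
       (use Dn Sn in \<open>auto intro!: has_sum_infsum\<close>)
  then have sig': "(\<lambda>(\<mu>, n). norm (D n \<mu>)) summable_on A \<times> UNIV"
    by (subst summable_on_swap) (simp add: case_prod_unfold)
  have col: "(\<lambda>n. norm (D n \<mu>)) summable_on UNIV" if "\<mu> \<in> A" for \<mu>
    using summable_on_SigmaD1[OF sig' that] by simp
  have cols: "(\<lambda>\<mu>. \<Sum>\<^sub>\<infinity>n. norm (D n \<mu>)) summable_on A"
    using summable_on_Sigma_banach[OF sig'] by simp
  define d where "d \<mu> = (\<Sum>\<^sub>\<infinity>n. D n \<mu>)" for \<mu>
  have nd: "norm (d \<mu>) \<le> (\<Sum>\<^sub>\<infinity>n. norm (D n \<mu>))" if "\<mu> \<in> A" for \<mu>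
    unfolding d_def by (rule norm_infsum_bound[OF col[OF that]])
  have sd: "(\<lambda>\<mu>. norm (d \<mu>)) summable_on A"
    by (rule summable_on_comparison_test[OF cols nd]) auto
  have "(\<Sum>\<^sub>\<infinity>\<mu>\<in>A. norm (d \<mu>)) \<le> (\<Sum>\<^sub>\<infinity>\<mu>\<in>A. \<Sum>\<^sub>\<infinity>n. norm (D n \<mu>))"
    by (rule infsum_mono[OF sd cols nd])
  also have "\<dots> = (\<Sum>\<^sub>\<infinity>n. \<Sum>\<^sub>\<infinity>\<mu>\<in>A. norm (D n \<mu>))"
    by (rule infsum_swap_banach[OF sig'])
  also have "\<dots> \<le> (\<Sum>\<^sub>\<infinity>n. \<theta> ^ n)"
    by (rule infsum_mono[OF Sn has_sum_imp_summable[OF geo]]) (use Dn in auto)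
  also have "\<dots> = 1 / (1 - \<theta>)" using geo by (rule infsumI)
  finally have sum_d: "(\<Sum>\<^sub>\<infinity>\<mu>\<in>A. norm (d \<mu>)) \<le> 1 / (1 - \<theta>)" .
  have eq: "d \<nu> + (\<Sum>\<^sub>\<infinity>\<mu>\<in>A. M \<nu> \<mu> * d \<mu>) = (if \<nu> = l then 1 else 0)" if \<nu>: "\<nu> \<in> A" for \<nu>
  proof -
    \<comment> \<open>A single entry is at most its column sum, hence at most 1. This makes the
      series over pairs (\<mu>, n) absolutely summable, so that \<open>M\<close> may be applied to
      \<open>d\<close> term by term.\<close>
    have M1: "norm (M \<nu> \<mu>) \<le> 1" if "\<mu> \<in> A" for \<mu>
    proof -
      have "norm (M \<nu> \<mu>) = (\<Sum>x\<in>{\<nu>}. norm (M x \<mu>))" by simp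
      also have "\<dots> \<le> (\<Sum>\<^sub>\<infinity>\<nu>\<in>A. norm (M \<nu> \<mu>))"
        by (rule finite_sum_le_infsum[OF M(1)[OF that]]) (use \<nu> in auto)
      finally show ?thesis using M(2)[OF that] \<theta> by linarith
    qed
    have "(\<lambda>x. norm (case x of (\<mu>, n) \<Rightarrow> M \<nu> \<mu> * D n \<mu>)) summable_on A \<times> UNIV"
    proof (rule summable_on_comparison_test[OF sig'])
      fix x assume "x \<in> A \<times> (UNIV :: nat set)"
      then show "norm (case x of (\<mu>, n) \<Rightarrow> M \<nu> \<mu> * D n \<mu>) \<le> (case x of (\<mu>, n) \<Rightarrow> norm (D n \<mu>))"
        using M1 by (auto simp: norm_mult mult_left_le_one_le)
    qed auto
    then have s: "(\<lambda>(\<mu>, n). M \<nu> \<mu> * D n \<mu>) summable_on A \<times> UNIV"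
      by (rule abs_summable_summable)
    have "(\<Sum>\<^sub>\<infinity>\<mu>\<in>A. M \<nu> \<mu> * d \<mu>) = (\<Sum>\<^sub>\<infinity>\<mu>\<in>A. \<Sum>\<^sub>\<infinity>n. M \<nu> \<mu> * D n \<mu>)"
      unfolding d_def by (intro infsum_cong) (simp add: infsum_cmult_right')
    also have "\<dots> = (\<Sum>\<^sub>\<infinity>n. \<Sum>\<^sub>\<infinity>\<mu>\<in>A. M \<nu> \<mu> * D n \<mu>)"
      by (rule infsum_swap_banach[OF s])
    also have "\<dots> = - (\<Sum>\<^sub>\<infinity>n. D (Suc n) \<nu>)"
      by (simp add: DS infsum_uminus)
    also have "(\<Sum>\<^sub>\<infinity>n. D (Suc n) \<nu>) = (\<Sum>\<^sub>\<infinity>n\<in>range Suc. D n \<nu>)"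
      by (subst infsum_reindex) (auto simp: o_def)
    finally have 1: "(\<Sum>\<^sub>\<infinity>\<mu>\<in>A. M \<nu> \<mu> * d \<mu>) = - (\<Sum>\<^sub>\<infinity>n\<in>range Suc. D n \<nu>)" .
    have sD: "(\<lambda>n. D n \<nu>) summable_on UNIV"
      using abs_summable_summable[OF col[OF \<nu>]] .
    have "d \<nu> = (\<Sum>\<^sub>\<infinity>n\<in>insert 0 (range Suc). D n \<nu>)"
      unfolding d_def by (metis UNIV_nat_eq)
    also have "\<dots> = D 0 \<nu> + (\<Sum>\<^sub>\<infinity>n\<in>range Suc. D n \<nu>)"
      by (rule infsum_insert) (use sD summable_on_subset_banach in auto)
    finally show ?thesis using 1 by (simp add: D0)
  qed
  from that[OF sd sum_d eq] show ?thesis .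
qed

section \<open>Pulses with prescribed moments at gapped frequencies\<close>

definition separated :: "real \<Rightarrow> real set \<Rightarrow> bool" where
  "separated g A \<longleftrightarrow> (\<forall>x\<in>A. \<forall>y\<in>A. x \<noteq> y \<longrightarrow> g \<le> \<bar>x - y\<bar>)"

text \<open>The bound \<open>B\<close> is carried as a parameter since what matters later is one
  bound for the whole biorthogonal family. Continuity is required on all of the line, so a pulse
  vanishes at both ends of its interval and remains a pulse after a delay.\<close>

definition pulse :: "real \<Rightarrow> real \<Rightarrow> (real \<Rightarrow> complex) \<Rightarrow> bool" where
  "pulse L B p \<longleftrightarrow> continuous_on UNIV p \<and> (\<forall>t. t \<notin> {0..L} \<longrightarrow> p t = 0) \<and> (\<forall>t. norm (p t) \<le> B)"

lemma pulse_mono: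
  assumes "pulse L B p" "L \<le> L'" "B \<le> B'"
  shows "pulse L' B' p"
proof -
  have "norm (p t) \<le> B'" for t
    using assms order_trans[of "norm (p t)" B B'] by (simp add: pulse_def)
  then show ?thesis using assms by (auto simp: pulse_def)
qed

text \<open>The integral runs over the whole line, so the value does not change when a pulse is
  regarded as supported in a longer interval.\<close>

definition moment :: "(real \<Rightarrow> complex) \<Rightarrow> real \<Rightarrow> complex" where
  "moment p \<xi> = integral UNIV (\<lambda>t. p t * exp (\<i> * complex_of_real (\<xi> * t)))"

lemma moment_eq:
  assumes "pulse L B p" "a \<le> 0" "L \<le> b"
  shows "moment p \<xi> = integral {a..b} (\<lambda>t. p t * exp (\<i> * complex_of_real (\<xi> * t)))"
proof -
  have "(\<lambda>t. p t * exp (\<i> * complex_of_real (\<xi> * t))) =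
      (\<lambda>t. if t \<in> {a..b} then p t * exp (\<i> * complex_of_real (\<xi> * t)) else 0)"
    using assms by (force simp: pulse_def fun_eq_iff)
  then show ?thesis
    unfolding moment_def using integral_restrict_UNIV by metis
qed

text \<open>Partial fractions: the term is half of 1/(2m-1) - 1/(2m+1), and the sum over 0 < |m|
  \<le> N telescopes to 1 - 1/(2N+1). The value 1 of the full series is the source of the constant 2
  pi in the control time.\<close>

lemma sum_inverse_four_square_minus_one_le:
  assumes "finite I" "0 \<notin> I"
  shows "(\<Sum>m\<in>I. 1 / (4 * (real_of_int m)\<^sup>2 - 1)) \<le> 1"
proof -
  have tel: "(\<Sum>m\<in>{- int N..int N} - {0}. 1 / (4 * (real_of_int m)\<^sup>2 - 1)) = 1 - 1 / (2 * real N + 1)" for N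
  proof (induction N)
    case (Suc N)
    have "{- int (Suc N)..int (Suc N)} - {0} =
        insert (1 + int N) (insert (- 1 - int N) ({- int N..int N} - {0}))"
      by auto
    moreover have "1 / (4 * (1 + real N)\<^sup>2 - 1) = (1 / (2 * real N + 1) - 1 / (2 * real N + 3)) / 2"
    proof -
      have "4 * (1 + real N)\<^sup>2 - 1 = (2 * real N + 1) * (2 * real N + 3)"
        by (simp add: power2_eq_square algebra_simps)
      moreover have "1 / (x * y) = (1 / x - 1 / y) / 2" if "0 < x" "y = x + 2" for x y :: real
        using that by (simp add: diff_frac_eq)
      moreover have "0 < 2 * real N + 1" "2 * real N + 3 = (2 * real N + 1) + 2" by simp_all
      ultimately show ?thesis by metis
    qed
    moreover have "(- 1 - real N)\<^sup>2 = (1 + real N)\<^sup>2" by (simp add: power2_eq_square algebra_simps)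
    ultimately show ?case using Suc by (simp add: add_ac)
  qed auto
  have "\<exists>N. I \<subseteq> {- int N..int N}"
  proof -
    have "finite ((\<lambda>m. nat \<bar>m\<bar>) ` I)" using assms by auto
    then obtain N where "\<And>m. m \<in> I \<Longrightarrow> nat \<bar>m\<bar> \<le> N"
      using finite_nat_set_iff_bounded_le by (metis image_eqI)
    then show ?thesis by (intro exI[of _ N]) force
  qed
  then obtain N where "I \<subseteq> {- int N..int N} - {0}" using assms by auto
  then have "(\<Sum>m\<in>I. 1 / (4 * (real_of_int m)\<^sup>2 - 1)) \<le>
      (\<Sum>m\<in>{- int N..int N} - {0}. 1 / (4 * (real_of_int m)\<^sup>2 - 1))"
  proof (intro sum_mono2)
    fix m assume "m \<in> {- int N..int N} - {0} - I"
    then have "1 \<le> m\<^sup>2" by (simp add: int_one_le_iff_zero_less)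
    then have "1 \<le> (real_of_int m)\<^sup>2" by (metis of_int_1_le_iff of_int_power)
    then show "0 \<le> 1 / (4 * (real_of_int m)\<^sup>2 - 1)" by simp
  qed auto
  also have "\<dots> \<le> 1" unfolding tel by simp
  finally show ?thesis .
qed

text \<open>Among sets with gap \<open>g\<close>, arithmetic progressions are the worst case. Each
  point is compared with the point of the progression \<nu> + g m that is next to it on the side of
  \<nu>; the factor \<open>(2 * a / g)\<^sup>2\<close> appears when \<open>g\<close> is scaled out
  of the resulting series.\<close>

lemma separated_sum_le:
  assumes sep: "separated g A" and a: "0 < a" "2 * a < g" and \<nu>: "\<nu> \<in> A"
    and F: "finite F" "F \<subseteq> A - {\<nu>}"
  shows "(\<Sum>\<mu>\<in>F. a\<^sup>2 / ((\<nu> - \<mu>)\<^sup>2 - a\<^sup>2)) \<le> (2 * a / g)\<^sup>2"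
proof -
  \<comment> \<open>Rounding goes towards \<nu> from either side, so distances only decrease and no
    point is sent to 0. Two points with the same image lie on one side of \<nu> at distance less
    than \<open>g\<close>, which gives injectivity.\<close>
  define m where "m \<mu> = (if \<mu> > \<nu> then \<lfloor>(\<mu> - \<nu>) / g\<rfloor> else - \<lfloor>(\<nu> - \<mu>) / g\<rfloor>)" for \<mu>
  have g: "g > 0" using a by simp
  have far: "g \<le> \<bar>\<mu> - \<nu>\<bar>" if "\<mu> \<in> F" for \<mu>
    using sep \<nu> F that by (auto simp: separated_def)
  have m1: "1 \<le> \<bar>m \<mu>\<bar>" "real_of_int \<bar>m \<mu>\<bar> * g \<le> \<bar>\<nu> - \<mu>\<bar>" "(m \<mu> > 0) = (\<mu> > \<nu>)"
    "\<bar>\<nu> - \<mu>\<bar> < (real_of_int \<bar>m \<mu>\<bar> + 1) * g"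
    if \<mu>: "\<mu> \<in> F" for \<mu>
  proof -
    define x where "x = \<bar>\<mu> - \<nu>\<bar>"
    have x: "1 \<le> x / g" using far[OF \<mu>] g by (simp add: x_def)
    then have f: "1 \<le> \<lfloor>x / g\<rfloor>" by simp
    have m: "m \<mu> = (if \<mu> > \<nu> then \<lfloor>x / g\<rfloor> else - \<lfloor>x / g\<rfloor>)" by (simp add: m_def x_def)
    show "1 \<le> \<bar>m \<mu>\<bar>" "(m \<mu> > 0) = (\<mu> > \<nu>)" using f by (auto simp: m)
    have ab: "\<bar>m \<mu>\<bar> = \<lfloor>x / g\<rfloor>" using f by (auto simp: m)
    have "real_of_int \<lfloor>x / g\<rfloor> * g \<le> x"
      using pos_le_divide_eq[OF g, of "real_of_int \<lfloor>x / g\<rfloor>" x] by simp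
    moreover have "x < (real_of_int \<lfloor>x / g\<rfloor> + 1) * g"
      using pos_divide_less_eq[OF g, of x "real_of_int \<lfloor>x / g\<rfloor> + 1"] by simp
    ultimately show "real_of_int \<bar>m \<mu>\<bar> * g \<le> \<bar>\<nu> - \<mu>\<bar>" "\<bar>\<nu> - \<mu>\<bar> < (real_of_int \<bar>m \<mu>\<bar> + 1) * g"
      by (simp_all add: ab x_def abs_minus_commute)
  qed
  have inj: "inj_on m F"
  proof (rule inj_onI, rule ccontr)
    fix x y assume xy: "x \<in> F" "y \<in> F" "m x = m y" "x \<noteq> y"
    then have "g \<le> \<bar>x - y\<bar>" using sep F by (auto simp: separated_def)
    moreover have "(x > \<nu>) = (y > \<nu>)" using m1(3) xy by metis
    ultimately show False
      using m1(2,4)[OF xy(1)] m1(2,4)[OF xy(2)] xy(3) by (auto simp: abs_if algebra_simps split: if_splits)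
  qed
  have "(\<Sum>\<mu>\<in>F. a\<^sup>2 / ((\<nu> - \<mu>)\<^sup>2 - a\<^sup>2)) \<le> (\<Sum>\<mu>\<in>F. (2 * a / g)\<^sup>2 * (1 / (4 * (real_of_int (m \<mu>))\<^sup>2 - 1)))"
  proof (rule sum_mono)
    fix \<mu> assume \<mu>: "\<mu> \<in> F"
    define n where "n = (real_of_int (m \<mu>))\<^sup>2"
    have "1 \<le> (m \<mu>)\<^sup>2" using m1(1)[OF \<mu>] by (simp add: int_one_le_iff_zero_less)
    then have n: "1 \<le> n" unfolding n_def by (metis of_int_1_le_iff of_int_power)
    have "(real_of_int \<bar>m \<mu>\<bar> * g)\<^sup>2 \<le> \<bar>\<nu> - \<mu>\<bar>\<^sup>2"
      using m1(2)[OF \<mu>] g by (intro power_mono) auto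
    then have ng: "n * g\<^sup>2 \<le> (\<nu> - \<mu>)\<^sup>2" by (simp add: n_def power_mult_distrib)
    have "(2 * a)\<^sup>2 < g\<^sup>2" using a by (intro power_strict_mono) auto
    then have g4: "4 * a\<^sup>2 < g\<^sup>2" by (simp add: power_mult_distrib)
    \<comment> \<open>Since a^2 < g^2/4, the subtracted term is at most a quarter of g^2; this
      produces the shape 4m^2 - 1.\<close>
    have "(4 * n - 1) * g\<^sup>2 / 4 \<le> n * g\<^sup>2 - a\<^sup>2" using g4 by (simp add: field_simps)
    also have "\<dots> \<le> (\<nu> - \<mu>)\<^sup>2 - a\<^sup>2" using ng by simp
    finally have den: "(4 * n - 1) * g\<^sup>2 / 4 \<le> (\<nu> - \<mu>)\<^sup>2 - a\<^sup>2" .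
    have pos: "0 < (4 * n - 1) * g\<^sup>2 / 4" using n g by simp
    have "a\<^sup>2 / ((\<nu> - \<mu>)\<^sup>2 - a\<^sup>2) \<le> a\<^sup>2 / ((4 * n - 1) * g\<^sup>2 / 4)"
      using den pos by (intro divide_left_mono mult_pos_pos) auto
    also have "\<dots> = (2 * a / g)\<^sup>2 * (1 / (4 * n - 1))"
      by (simp add: power_divide power_mult_distrib mult.commute)
    finally show "a\<^sup>2 / ((\<nu> - \<mu>)\<^sup>2 - a\<^sup>2) \<le> (2 * a / g)\<^sup>2 * (1 / (4 * (real_of_int (m \<mu>))\<^sup>2 - 1))"
      by (simp add: n_def)
  qed
  also have "\<dots> = (2 * a / g)\<^sup>2 * (\<Sum>k\<in>m ` F. 1 / (4 * (real_of_int k)\<^sup>2 - 1))"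
    by (simp add: sum_distrib_left sum.reindex[OF inj])
  also have "\<dots> \<le> (2 * a / g)\<^sup>2 * 1"
  proof (intro mult_left_mono sum_inverse_four_square_minus_one_le)
    show "0 \<notin> m ` F" using m1(1) by force
  qed (use F in auto)
  finally show ?thesis by simp
qed

text \<open>The Fourier transform of one arch of a sine, supported on an interval of length pi/a.
  The factor a/2 gives the arch total mass 1, hence the value 1 at frequency 0.\<close>

definition sine_kernel :: "real \<Rightarrow> real \<Rightarrow> complex" where
  "sine_kernel a \<xi> = integral {0..pi / a}
     (\<lambda>t. complex_of_real (a / 2 * sin (a * t)) * exp (\<i> * complex_of_real (\<xi> * t)))"

lemma sine_kernel_eq:
  assumes a: "0 < a" and \<xi>: "\<xi>\<^sup>2 \<noteq> a\<^sup>2"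
  shows "sine_kernel a \<xi> =
    complex_of_real (a\<^sup>2 / (2 * (a\<^sup>2 - \<xi>\<^sup>2))) * (1 + exp (\<i> * complex_of_real (\<xi> * (pi / a))))"
proof -
  define c where "c = complex_of_real (a / (2 * (a\<^sup>2 - \<xi>\<^sup>2)))"
  \<comment> \<open>An antiderivative of the integrand, found by integrating by parts twice. At both
    ends the sine vanishes and the cosine is 1 or -1, which leaves the two terms of the
    formula.\<close>
  define P where "P t = c * (exp (\<i> * complex_of_real (\<xi> * t)) *
      (\<i> * of_real \<xi> * of_real (sin (a * t)) - of_real a * of_real (cos (a * t))))" for t :: real
  have ne: "complex_of_real a * complex_of_real a - complex_of_real \<xi> * complex_of_real \<xi> \<noteq> 0"
    using \<xi> by (metis eq_iff_diff_eq_0 of_real_eq_iff of_real_mult power2_eq_square)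
  have ii: "\<i> * (\<i> * z) = - z" for z by (metis mult.assoc i_squared mult_minus1)
  have "(P has_vector_derivative
      complex_of_real (a / 2 * sin (a * t)) * exp (\<i> * complex_of_real (\<xi> * t))) (at t within S)" for t S
  proof -
    have "((\<lambda>t. complex_of_real (\<xi> * t)) has_vector_derivative of_real \<xi>) (at t within S)"
      by (auto intro!: derivative_eq_intros)
    then have e: "((\<lambda>t. exp (\<i> * complex_of_real (\<xi> * t))) has_vector_derivative
        (\<i> * of_real \<xi>) * exp (\<i> * complex_of_real (\<xi> * t))) (at t within S)"
      by (intro has_vector_derivative_eq_rhs[OF field_vector_diff_chain_within[where g = exp and f = "\<lambda>t. \<i> * complex_of_real (\<xi> * t)", unfolded o_def]])
         (auto intro!: derivative_eq_intros DERIV_exp DERIV_subset[OF DERIV_exp])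
    have s: "((\<lambda>t. complex_of_real (sin (a * t))) has_vector_derivative of_real (a * cos (a * t))) (at t within S)"
      by (auto intro!: derivative_eq_intros has_vector_derivative_of_real simp: has_real_derivative_iff_has_vector_derivative[symmetric])
    have c: "((\<lambda>t. complex_of_real (cos (a * t))) has_vector_derivative of_real (- a * sin (a * t))) (at t within S)"
      by (auto intro!: derivative_eq_intros has_vector_derivative_of_real simp: has_real_derivative_iff_has_vector_derivative[symmetric])
    have "(P has_vector_derivative c * (exp (\<i> * complex_of_real (\<xi> * t)) *
         (\<i> * of_real \<xi> * of_real (a * cos (a * t)) - of_real a * of_real (- a * sin (a * t)))
       + (\<i> * of_real \<xi>) * exp (\<i> * complex_of_real (\<xi> * t)) *
         (\<i> * of_real \<xi> * of_real (sin (a * t)) - of_real a * of_real (cos (a * t))))) (at t within S)"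
      unfolding P_def
      by (intro has_vector_derivative_mult_right has_vector_derivative_mult has_vector_derivative_diff e s c)
    moreover have "c * (exp (\<i> * complex_of_real (\<xi> * t)) *
         (\<i> * of_real \<xi> * of_real (a * cos (a * t)) - of_real a * of_real (- a * sin (a * t)))
       + (\<i> * of_real \<xi>) * exp (\<i> * complex_of_real (\<xi> * t)) *
         (\<i> * of_real \<xi> * of_real (sin (a * t)) - of_real a * of_real (cos (a * t))))
      = complex_of_real (a / 2 * sin (a * t)) * exp (\<i> * complex_of_real (\<xi> * t))"
      using ne by (simp add: c_def field_simps power2_eq_square ii)
    ultimately show ?thesis by (rule has_vector_derivative_eq_rhs)
  qed
  then have "((\<lambda>t. complex_of_real (a / 2 * sin (a * t)) * exp (\<i> * complex_of_real (\<xi> * t)))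
      has_integral (P (pi / a) - P 0)) {0..pi / a}"
    using a by (intro fundamental_theorem_of_calculus) auto
  moreover have "P (pi / a) - P 0 =
      complex_of_real (a\<^sup>2 / (2 * (a\<^sup>2 - \<xi>\<^sup>2))) * (1 + exp (\<i> * complex_of_real (\<xi> * (pi / a))))"
    using a by (simp add: P_def c_def power2_eq_square algebra_simps add_divide_distrib)
  ultimately show ?thesis unfolding sine_kernel_def using integral_unique by metis
qed

text \<open>The decay is quadratic because the arch is continuous across its ends. A sharp cut-off
  would only give decay of order one and divergent column sums.\<close>

lemma norm_sine_kernel_le:
  assumes a: "0 < a" and \<xi>: "a < \<bar>\<xi>\<bar>"
  shows "norm (sine_kernel a \<xi>) \<le> a\<^sup>2 / (\<xi>\<^sup>2 - a\<^sup>2)"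
proof -
  have sq: "a\<^sup>2 < \<xi>\<^sup>2" using power_strict_mono[OF \<xi>, of 2] a by simp
  have "norm (1 + exp (\<i> * complex_of_real (\<xi> * (pi / a)))) \<le> 2"
    by (rule order_trans[OF norm_triangle_ineq]) (simp only: norm_exp_i_times norm_one; simp)
  then have "\<bar>a\<^sup>2 / (2 * (a\<^sup>2 - \<xi>\<^sup>2))\<bar> * norm (1 + exp (\<i> * complex_of_real (\<xi> * (pi / a))))
      \<le> \<bar>a\<^sup>2 / (2 * (a\<^sup>2 - \<xi>\<^sup>2))\<bar> * 2"
    by (intro mult_left_mono) auto
  then have "norm (sine_kernel a \<xi>) \<le> \<bar>a\<^sup>2 / (2 * (a\<^sup>2 - \<xi>\<^sup>2))\<bar> * 2"
    using a sq by (subst sine_kernel_eq) (simp_all only: norm_mult norm_of_real)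
  also have "\<dots> = a\<^sup>2 / (\<xi>\<^sup>2 - a\<^sup>2)" using sq by (simp add: abs_if field_simps)
  finally show ?thesis .
qed

lemma sine_kernel_0: "0 < a \<Longrightarrow> sine_kernel a 0 = 1"
  by (subst sine_kernel_eq) auto


text \<open>In the bound, \<open>pi / (2 * L)\<close> is the height of the normalised sine arch of
  length \<open>L\<close>, and the remaining factor is the l1 norm of the coefficients of the
  exponential sum. Neither involves \<open>l\<close>.\<close>

lemma ingham_pulse:
  assumes sep: "separated g A" and L: "0 < L" "2 * pi < g * L" and l: "l \<in> A"
  shows "\<exists>p. pulse L (pi / (2 * L) / (1 - (2 * pi / (g * L))\<^sup>2)) p \<and>
    (\<forall>\<nu>\<in>A. moment p \<nu> = (if \<nu> = l then 1 else 0))"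
proof -
  define a where "a = pi / L"
  define \<theta> where "\<theta> = (2 * a / g)\<^sup>2"
  have g: "0 < g" using L by (smt (verit) mult_nonpos_nonneg pi_gt_zero)
  have a: "0 < a" "2 * a < g" "pi / a = L" using L g by (auto simp: a_def field_simps)
  have \<theta>: "0 \<le> \<theta>" "\<theta> < 1"
    using a g power_strict_mono[of "2 * a / g" 1 2] by (auto simp: \<theta>_def)
  have \<theta>': "\<theta> = (2 * pi / (g * L))\<^sup>2" by (simp add: \<theta>_def a_def mult.commute)
  \<comment> \<open>The Gram matrix of the exponentials for the sine weight, with the identity
    removed: its diagonal entries are \<open>sine_kernel a 0 = 1\<close>.\<close>
  define M where "M \<nu> \<mu> = (if \<nu> = \<mu> then 0 else sine_kernel a (\<nu> - \<mu>))" for \<nu> \<mu>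
  have fin: "(\<Sum>\<nu>\<in>F. norm (M \<nu> \<mu>)) \<le> \<theta>" if \<mu>: "\<mu> \<in> A" and F: "finite F" "F \<subseteq> A" for \<mu> F
  proof -
    have "(\<Sum>\<nu>\<in>F. norm (M \<nu> \<mu>)) = (\<Sum>\<nu>\<in>F - {\<mu>}. norm (M \<nu> \<mu>))"
      using F by (intro sum.mono_neutral_right) (auto simp: M_def)
    also have "\<dots> \<le> (\<Sum>\<nu>\<in>F - {\<mu>}. a\<^sup>2 / ((\<mu> - \<nu>)\<^sup>2 - a\<^sup>2))"
    proof (rule sum_mono)
      fix \<nu> assume \<nu>: "\<nu> \<in> F - {\<mu>}"
      then have "g \<le> \<bar>\<nu> - \<mu>\<bar>" using sep \<mu> F by (auto simp: separated_def)
      then have "norm (sine_kernel a (\<nu> - \<mu>)) \<le> a\<^sup>2 / ((\<nu> - \<mu>)\<^sup>2 - a\<^sup>2)"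
        using a by (intro norm_sine_kernel_le) auto
      then show "norm (M \<nu> \<mu>) \<le> a\<^sup>2 / ((\<mu> - \<nu>)\<^sup>2 - a\<^sup>2)"
        using \<nu> by (simp add: M_def power2_commute)
    qed
    also have "\<dots> \<le> \<theta>"
      unfolding \<theta>_def using F by (intro separated_sum_le[OF sep a(1,2) \<mu>]) auto
    finally show ?thesis .
  qed
  have M1: "(\<lambda>\<nu>. norm (M \<nu> \<mu>)) summable_on A" if "\<mu> \<in> A" for \<mu>
    by (rule nonneg_bdd_above_summable_on) (use fin[OF that] in \<open>auto intro!: bdd_aboveI2[where M = \<theta>]\<close>)
  have M2: "(\<Sum>\<^sub>\<infinity>\<nu>\<in>A. norm (M \<nu> \<mu>)) \<le> \<theta>" if "\<mu> \<in> A" for \<mu>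
    by (rule infsum_le_finite_sums[OF M1[OF that] fin[OF that]])
  obtain d where d: "(\<lambda>\<mu>. norm (d \<mu>)) summable_on A" "(\<Sum>\<^sub>\<infinity>\<mu>\<in>A. norm (d \<mu>)) \<le> 1 / (1 - \<theta>)"
    "\<And>\<nu>. \<nu> \<in> A \<Longrightarrow> d \<nu> + (\<Sum>\<^sub>\<infinity>\<mu>\<in>A. M \<nu> \<mu> * d \<mu>) = (if \<nu> = l then 1 else 0)"
    using neumann_delta[of A M, OF M1 M2 \<theta> l] by blast
  define S where "S t = (\<Sum>\<^sub>\<infinity>\<mu>\<in>A. d \<mu> * exp (\<i> * complex_of_real (- \<mu> * t)))" for t
  \<comment> \<open>Time is clamped to [0, L]. Because sin(a t) vanishes at both ends, the product
    is continuous on the line and zero outside without any case distinction.\<close>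
  define p where "p t = complex_of_real (a / 2 * sin (a * max 0 (min t L))) * S t" for t
  have cS: "continuous_on UNIV S"
    unfolding S_def
    by (rule continuous_on_infsum[OF _ d(1)]) (auto simp: norm_mult simp del: of_real_mult intro!: continuous_intros)
  have nS: "norm (S t) \<le> 1 / (1 - \<theta>)" for t
  proof -
    have "norm (S t) \<le> (\<Sum>\<^sub>\<infinity>\<mu>\<in>A. norm (d \<mu> * exp (\<i> * complex_of_real (- \<mu> * t))))"
      unfolding S_def by (rule norm_infsum_bound) (use d(1) in \<open>simp add: norm_mult del: of_real_mult\<close>)
    also have "\<dots> \<le> 1 / (1 - \<theta>)"
      using d(2) by (simp add: norm_mult del: of_real_mult)
    finally show ?thesis .
  qed
  have "pulse L (pi / (2 * L) / (1 - \<theta>)) p"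
    unfolding pulse_def
  proof (intro conjI allI impI)
    show "continuous_on UNIV p"
      unfolding p_def by (intro continuous_intros cS)
    fix t
    show "norm (p t) \<le> pi / (2 * L) / (1 - \<theta>)"
    proof -
      have "norm (p t) = a / 2 * \<bar>sin (a * max 0 (min t L))\<bar> * norm (S t)"
        unfolding p_def norm_mult norm_of_real abs_mult using a by simp
      also have "\<dots> \<le> a / 2 * 1 * (1 / (1 - \<theta>))"
        using a \<theta> nS by (intro mult_mono) auto
      finally show ?thesis by (simp add: a_def mult.commute)
    qed
    assume "t \<notin> {0..L}"
    then have "max 0 (min t L) = 0 \<or> max 0 (min t L) = L" using L by auto
    then show "p t = 0"
      using L by (auto simp: p_def a_def)
  qed
  moreover have "moment p \<nu> = (if \<nu> = l then 1 else 0)" if \<nu>: "\<nu> \<in> A" for \<nu>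
  proof -
    define f where "f \<mu> t = complex_of_real (a / 2 * sin (a * t)) * (d \<mu> * exp (\<i> * complex_of_real ((\<nu> - \<mu>) * t)))" for \<mu> t
    have nf: "norm (f \<mu> t) \<le> a / 2 * norm (d \<mu>)" for \<mu> t
    proof -
      have "norm (f \<mu> t) = a / 2 * \<bar>sin (a * t)\<bar> * norm (d \<mu>)"
        unfolding f_def norm_mult norm_of_real abs_mult norm_exp_i_times using a by simp
      also have "\<dots> \<le> a / 2 * 1 * norm (d \<mu>)"
        using a by (intro mult_mono) auto
      finally show ?thesis by simp
    qed
    have "((\<lambda>\<mu>. integral (cbox 0 L) (f \<mu>)) has_sum
             integral (cbox 0 L) (\<lambda>t. \<Sum>\<^sub>\<infinity>\<mu>\<in>A. f \<mu> t)) A"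
    proof (rule has_sum_integral_cbox[OF nf])
      show "(\<lambda>\<mu>. a / 2 * norm (d \<mu>)) summable_on A" by (intro summable_on_cmult_right d(1))
    qed (auto intro!: continuous_intros simp: f_def)
    moreover have "integral (cbox 0 L) (f \<mu>) = d \<mu> * sine_kernel a (\<nu> - \<mu>)" for \<mu>
    proof -
      have "f \<mu> = (\<lambda>t. d \<mu> * (complex_of_real (a / 2 * sin (a * t)) * exp (\<i> * complex_of_real ((\<nu> - \<mu>) * t))))"
        by (simp add: f_def fun_eq_iff)
      then show ?thesis by (simp add: sine_kernel_def a(3))
    qed
    moreover have "integral (cbox 0 L) (\<lambda>t. \<Sum>\<^sub>\<infinity>\<mu>\<in>A. f \<mu> t) = moment p \<nu>"
    proof -
      have "(\<Sum>\<^sub>\<infinity>\<mu>\<in>A. f \<mu> t) = p t * exp (\<i> * complex_of_real (\<nu> * t))" if "t \<in> {0..L}" for t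
      proof -
        have "f \<mu> t = complex_of_real (a / 2 * sin (a * t)) * exp (\<i> * complex_of_real (\<nu> * t)) *
            (d \<mu> * exp (\<i> * complex_of_real (- \<mu> * t)))" for \<mu>
          by (simp add: f_def exp_add[symmetric] algebra_simps)
        then have "(\<Sum>\<^sub>\<infinity>\<mu>\<in>A. f \<mu> t) = complex_of_real (a / 2 * sin (a * t)) * exp (\<i> * complex_of_real (\<nu> * t)) * S t"
          by (simp only: infsum_cmult_right' S_def)
        then show ?thesis using that by (simp add: p_def)
      qed
      then have "integral (cbox 0 L) (\<lambda>t. \<Sum>\<^sub>\<infinity>\<mu>\<in>A. f \<mu> t) =
          integral {0..L} (\<lambda>t. p t * exp (\<i> * complex_of_real (\<nu> * t)))"
        unfolding box_real(2) by (intro integral_cong)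
      also have "\<dots> = moment p \<nu>"
        by (rule moment_eq[symmetric]) (use \<open>pulse L _ p\<close> in auto)
      finally show ?thesis .
    qed
    ultimately have 1: "((\<lambda>\<mu>. d \<mu> * sine_kernel a (\<nu> - \<mu>)) has_sum moment p \<nu>) A"
      by simp
    \<comment> \<open>The diagonal term is split off, so that the moment becomes
      \<open>d \<nu>\<close> plus the \<nu>-th entry of \<open>M\<close> applied to
      \<open>d\<close>, the left side of the Neumann equation.\<close>
    have "((\<lambda>\<mu>. if \<mu> = \<nu> then d \<nu> else 0) has_sum d \<nu>) A"
      by (rule has_sum_finite_neutralI[of "{\<nu>}"]) (use \<nu> in auto)
    then have "((\<lambda>\<mu>. d \<mu> * sine_kernel a (\<nu> - \<mu>) + - (if \<mu> = \<nu> then d \<nu> else 0)) has_sum (moment p \<nu> + - d \<nu>)) A"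
      by (intro has_sum_add 1) (simp add: has_sum_uminus)
    moreover have "(\<lambda>\<mu>. d \<mu> * sine_kernel a (\<nu> - \<mu>) + - (if \<mu> = \<nu> then d \<nu> else 0)) = (\<lambda>\<mu>. M \<nu> \<mu> * d \<mu>)"
      using sine_kernel_0[OF a(1)] by (auto simp: M_def fun_eq_iff)
    ultimately have "(\<Sum>\<^sub>\<infinity>\<mu>\<in>A. M \<nu> \<mu> * d \<mu>) = moment p \<nu> - d \<nu>"
      by (simp add: has_sum_iff)
    then show ?thesis using d(3)[OF \<nu>] by simp
  qed
  ultimately show ?thesis unfolding \<theta>' by blast
qed

section \<open>Removal of single frequencies by delayed differences\<close>

lemma pulse_delayed_difference:
  fixes c :: complex and \<mu> :: real
  assumes p: "pulse L B p" and e: "0 \<le> e"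
  defines "q \<equiv> \<lambda>t. c * (p t - exp (- (\<i> * complex_of_real (\<mu> * e))) * p (t - e))"
  shows "pulse (L + e) (2 * norm c * B) q"
    and "moment q \<xi> = c * (1 - exp (\<i> * complex_of_real ((\<xi> - \<mu>) * e))) * moment p \<xi>"
proof -
  have cp: "continuous_on UNIV p" and bp: "norm (p t) \<le> B" and zp: "t \<notin> {0..L} \<Longrightarrow> p t = 0" for t
    using p by (auto simp: pulse_def)
  have ne: "norm (exp (- (\<i> * complex_of_real x))) = 1" for x
    using norm_exp_i_times[of "- x"] by simp
  show pq: "pulse (L + e) (2 * norm c * B) q"
    unfolding pulse_def
  proof (intro conjI allI impI)
    show "continuous_on UNIV q"
      unfolding q_def by (intro continuous_intros continuous_on_compose2[OF cp]) auto
    fix t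
    have "norm (p t - exp (- (\<i> * complex_of_real (\<mu> * e))) * p (t - e)) \<le> B + 1 * B"
      by (rule order_trans[OF norm_triangle_ineq4])
         (simp only: norm_mult ne, use add_mono[OF bp[of t] bp[of "t - e"]] in simp)
    then have "norm c * norm (p t - exp (- (\<i> * complex_of_real (\<mu> * e))) * p (t - e)) \<le> norm c * (B + 1 * B)"
      by (intro mult_left_mono) auto
    then show "norm (q t) \<le> 2 * norm c * B" by (simp add: q_def norm_mult)
    assume "t \<notin> {0..L + e}"
    then show "q t = 0" using e zp[of t] zp[of "t - e"] by (auto simp: q_def)
  qed
  \<comment> \<open>One interval [-e, L+e] serves the pulse, its delay and the difference; after the
    substitution it becomes [-2e, L], which still contains the support of \<open>p\<close>.\<close>
  define b where "b = L + e"
  let ?E = "\<lambda>t. exp (\<i> * complex_of_real (\<xi> * t))"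
  have int: "(\<lambda>t. p t * ?E t) integrable_on {-e..b}" "(\<lambda>t. p (t - e) * ?E t) integrable_on {-e..b}"
    by (intro integrable_continuous_real continuous_intros continuous_on_compose2[OF cp]; simp)+
  have m1: "integral {-e..b} (\<lambda>t. p t * ?E t) = moment p \<xi>"
    by (rule moment_eq[OF p, symmetric]) (use e in \<open>auto simp: b_def\<close>)
  \<comment> \<open>The substitution turns the delay into the factor exp(i \<xi> e). So the
    difference multiplies each moment by a scalar that vanishes at \<xi> = \<mu>, and moments that
    were zero remain zero.\<close>
  have "integral {-e..b} (\<lambda>t. p (t - e) * ?E t) =
      integral {-e - e..b - e} (\<lambda>t. p t * ?E (t + e))"
    using integral_shift_real_ivl[of "-e" e b "\<lambda>t. p (t - e) * ?E t"] by simp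
  also have "(\<lambda>t. p t * ?E (t + e)) = (\<lambda>t. ?E e * (p t * ?E t))"
    by (simp add: fun_eq_iff exp_add[symmetric] algebra_simps)
  also have "integral {-e - e..b - e} \<dots> = ?E e * integral {-e - e..b - e} (\<lambda>t. p t * ?E t)"
    by simp
  also have "integral {-e - e..b - e} (\<lambda>t. p t * ?E t) = moment p \<xi>"
    by (rule moment_eq[OF p, symmetric]) (use e in \<open>auto simp: b_def\<close>)
  finally have m2: "integral {-e..b} (\<lambda>t. p (t - e) * ?E t) = ?E e * moment p \<xi>" .
  have "moment q \<xi> = integral {-e..b} (\<lambda>t. q t * ?E t)"
    by (rule moment_eq[OF pq]) (use e in \<open>auto simp: b_def\<close>)
  also have "(\<lambda>t. q t * ?E t) =
      (\<lambda>t. c * (p t * ?E t - exp (- (\<i> * complex_of_real (\<mu> * e))) * (p (t - e) * ?E t)))"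
    by (simp add: q_def fun_eq_iff algebra_simps)
  also have "integral {-e..b} \<dots> =
      c * (moment p \<xi> - exp (- (\<i> * complex_of_real (\<mu> * e))) * (?E e * moment p \<xi>))"
    using int by (simp add: integral_diff integrable_on_mult_right m1 m2 del: of_real_mult)
  also have "\<dots> = c * (1 - exp (- (\<i> * complex_of_real (\<mu> * e))) * ?E e) * moment p \<xi>"
    by (simp add: algebra_simps)
  also have "exp (- (\<i> * complex_of_real (\<mu> * e))) * ?E e = exp (\<i> * complex_of_real ((\<xi> - \<mu>) * e))"
    by (simp add: exp_add[symmetric] algebra_simps)
  finally show "moment q \<xi> = c * (1 - exp (\<i> * complex_of_real ((\<xi> - \<mu>) * e))) * moment p \<xi>" .
qed

lemma norm_one_minus_exp_i:
  "norm (1 - exp (\<i> * complex_of_real y)) = 2 * \<bar>sin (y / 2)\<bar>"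
proof -
  have "1 - exp (\<i> * complex_of_real y) =
      exp (\<i> * complex_of_real (y / 2)) * (- (2 * \<i>) * complex_of_real (sin (y / 2)))"
  proof -
    have s: "2 * \<i> * complex_of_real (sin (y / 2)) = exp (\<i> * complex_of_real (y / 2)) - exp (- (\<i> * complex_of_real (y / 2)))"
      by (simp add: sin_exp_eq flip: sin_of_real)
    have "exp (\<i> * complex_of_real (y / 2)) * (- (2 * \<i>) * complex_of_real (sin (y / 2))) =
        - (exp (\<i> * complex_of_real (y / 2)) * (2 * \<i> * complex_of_real (sin (y / 2))))" by simp
    also have "\<dots> = 1 - exp (\<i> * complex_of_real y)"
      unfolding s by (simp add: algebra_simps flip: exp_add)
    finally show ?thesis by simp
  qed
  then show ?thesis by (simp only: norm_mult norm_exp_i_times) simp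
qed

lemma pulse_kill:
  assumes p: "pulse L B p" and e: "0 < e" and \<gamma>: "0 < \<gamma>" "\<gamma> \<le> \<bar>l - \<mu>\<bar>"
  shows "\<exists>q. pulse (L + e) (B / sin (min (\<gamma> * e) pi / 2)) q \<and> moment q l = moment p l \<and>
    moment q \<mu> = 0 \<and> (\<forall>\<xi>. moment p \<xi> = 0 \<longrightarrow> moment q \<xi> = 0)"
proof -
  define x where "x = \<bar>l - \<mu>\<bar>"
  \<comment> \<open>Cutting the delay at pi/x keeps the half angle x e'/2 within (0, pi/2], where
    the sine increases; the worst case is then x = \<gamma>.\<close>
  define e' where "e' = min e (pi / x)"
  define c where "c = inverse (1 - exp (\<i> * complex_of_real ((l - \<mu>) * e')))"
  define s where "s = sin (min (\<gamma> * e) pi / 2)"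
  have x: "0 < x" "\<gamma> \<le> x" using \<gamma> by (auto simp: x_def)
  have e': "0 < e'" "e' \<le> e" using e x by (auto simp: e'_def)
  have xe: "x * e' = min (x * e) pi" using x by (auto simp: e'_def min_def field_simps)
  have s0: "0 < s" unfolding s_def by (rule sin_gt_zero) (use e \<gamma> pi_gt_zero in \<open>auto simp: min_less_iff_disj\<close>)
  have "min (\<gamma> * e) pi \<le> min (x * e) pi"
    using e x by (intro min.mono mult_right_mono) auto
  moreover have "0 \<le> min (\<gamma> * e) pi" using e \<gamma> by simp
  moreover have "min (x * e) pi \<le> pi" by simp
  ultimately have "s \<le> sin (x * e' / 2)"
    unfolding s_def xe by (intro sin_monotone_2pi_le) linarith+
  moreover have "\<bar>sin ((l - \<mu>) * e' / 2)\<bar> = \<bar>sin (x * e' / 2)\<bar>"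
  proof (cases "0 \<le> l - \<mu>")
    case False
    then have "x * e' / 2 = - ((l - \<mu>) * e' / 2)" by (simp add: x_def abs_if field_simps)
    then show ?thesis by (simp only: sin_minus abs_minus_cancel)
  qed (simp add: x_def)
  ultimately have "2 * s \<le> norm (1 - exp (\<i> * complex_of_real ((l - \<mu>) * e')))"
    unfolding norm_one_minus_exp_i by linarith
  then have c: "norm c \<le> 1 / (2 * s)" "c * (1 - exp (\<i> * complex_of_real ((l - \<mu>) * e'))) = 1"
  proof -
    have "norm (inverse z) \<le> 1 / (2 * s) \<and> inverse z * z = 1" if "2 * s \<le> norm z" for z :: complex
      using that s0 le_imp_inverse_le[of "2 * s" "norm z"]
      by (auto simp: norm_inverse inverse_eq_divide norm_divide)
    from this[OF \<open>2 * s \<le> norm (1 - _)\<close>]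
    show "norm c \<le> 1 / (2 * s)" "c * (1 - exp (\<i> * complex_of_real ((l - \<mu>) * e'))) = 1"
      unfolding c_def by blast+
  qed
  define q where "q t = c * (p t - exp (- (\<i> * complex_of_real (\<mu> * e'))) * p (t - e'))" for t
  have B: "0 \<le> B" using p norm_ge_zero[of "p 0"] unfolding pulse_def by (blast intro: order_trans)
  have q: "pulse (L + e') (2 * norm c * B) q"
    "\<And>\<xi>. moment q \<xi> = c * (1 - exp (\<i> * complex_of_real ((\<xi> - \<mu>) * e'))) * moment p \<xi>"
    using pulse_delayed_difference[OF p less_imp_le[OF e'(1)], of c \<mu>] by (simp_all add: q_def[abs_def])
  have "2 * norm c * B \<le> B / s"
    using mult_right_mono[OF c(1) B] s0 by (simp add: field_simps)
  then have "pulse (L + e) (B / s) q"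
    by (intro pulse_mono[OF q(1)]) (use e'(2) in auto)
  moreover have "moment q l = moment p l" unfolding q(2) c(2) by simp
  ultimately show ?thesis
    by (intro exI[of _ q]) (simp add: q(2) s_def)
qed

text \<open>Removals can be iterated because each one keeps the zeros already gained and the moment
  at \<open>l\<close>. The loss depends only on the number of removed frequencies.\<close>

lemma pulse_kill_finite:
  assumes D: "finite D" and e: "0 < e" and \<gamma>: "0 < \<gamma>" "\<And>\<mu>. \<mu> \<in> D \<Longrightarrow> \<gamma> \<le> \<bar>l - \<mu>\<bar>"
    and p: "pulse L B p"
  shows "\<exists>q. pulse (L + real (card D) * e) (B / sin (min (\<gamma> * e) pi / 2) ^ card D) q \<and>
    moment q l = moment p l \<and> (\<forall>\<mu>\<in>D. moment q \<mu> = 0) \<and> (\<forall>\<xi>. moment p \<xi> = 0 \<longrightarrow> moment q \<xi> = 0)"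
  using D \<gamma>(2)
proof (induction D)
  case empty
  then show ?case using p by auto
next
  case (insert \<mu> D)
  then obtain q where q: "pulse (L + real (card D) * e) (B / sin (min (\<gamma> * e) pi / 2) ^ card D) q"
    "moment q l = moment p l" "\<forall>\<mu>\<in>D. moment q \<mu> = 0" "\<forall>\<xi>. moment p \<xi> = 0 \<longrightarrow> moment q \<xi> = 0"
    by auto
  from pulse_kill[OF q(1) e \<gamma>(1) insert.prems[of \<mu>]] obtain q' where
    "pulse (L + real (card D) * e + e) (B / sin (min (\<gamma> * e) pi / 2) ^ card D / sin (min (\<gamma> * e) pi / 2)) q'"
    "moment q' l = moment q l" "moment q' \<mu> = 0" "\<forall>\<xi>. moment q \<xi> = 0 \<longrightarrow> moment q' \<xi> = 0"
    by auto
  then show ?case using q insert by (intro exI[of _ q']) (auto simp: algebra_simps)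
qed

text \<open>Each target frequency is first separated from those in the gapped set that lie at distance at
  least \<open>g\<close>. The boundedly many remaining ones are then removed one by one, each at the cost of an
  arbitrarily short prolongation, so that neither the exceptional set nor the smaller overall gap
  affects the critical length.\<close>

theorem biorthogonal_pulses:
  assumes sep: "separated \<gamma> A" "0 < \<gamma>" and F: "finite F" "separated g (A - F)"
    and T: "0 < T" "2 * pi < g * T"
  obtains B where "0 \<le> B"
    "\<And>l. l \<in> A \<Longrightarrow> \<exists>q. pulse T B q \<and> (\<forall>\<nu>\<in>A. moment q \<nu> = (if \<nu> = l then 1 else 0))"
proof -
  have g: "0 < g" using T by (smt (verit) mult_nonpos_nonneg pi_gt_zero)
  \<comment> \<open>Halfway between the critical length 2 pi/g and \<open>T\<close>: long enough for
    the gap \<open>g\<close>, with time left for the delays.\<close>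
  define L where "L = (2 * pi / g + T) / 2"
  have L: "0 < L" "L < T" "2 * pi < g * L"
    using T g by (auto simp: L_def field_simps intro!: add_pos_pos)
  \<comment> \<open>An upper bound for the number of removals, whatever the target: the points of
    \<open>F\<close> and at most one point of \<open>A - F\<close> on each side of the target within
    distance \<open>g\<close>.\<close>
  define N where "N = card F + 2"
  define e where "e = (T - L) / real N"
  have e: "0 < e" "L + real N * e = T" using L by (auto simp: e_def N_def)
  define s where "s = sin (min (\<gamma> * e) pi / 2)"
  have s: "0 < s" "s \<le> 1" unfolding s_def by (rule sin_gt_zero) (use e sep pi_gt_zero in \<open>auto simp: min_less_iff_disj\<close>)
  define B where "B = pi / (2 * L) / (1 - (2 * pi / (g * L))\<^sup>2)"
  have "(2 * pi / (g * L))\<^sup>2 < 1\<^sup>2"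
    using L g by (intro power_strict_mono) auto
  then have B: "0 \<le> B" using L by (simp add: B_def)
  have "\<exists>q. pulse T (B / s ^ N) q \<and> (\<forall>\<nu>\<in>A. moment q \<nu> = (if \<nu> = l then 1 else 0))" if l: "l \<in> A" for l
  proof -
    \<comment> \<open>The target itself may belong to \<open>F\<close> or lie close to points of
      \<open>A - F\<close>; inserting it after deleting everything near it keeps the gap
      \<open>g\<close>.\<close>
    define A' where "A' = insert l {\<mu> \<in> A - F. g \<le> \<bar>\<mu> - l\<bar>}"
    define R where "R = {\<mu> \<in> A - F. l < \<mu> \<and> \<mu> < l + g}"
    define Q where "Q = {\<mu> \<in> A - F. \<mu> < l \<and> l - g < \<mu>}"
    define D where "D = A - A'"
    have one: "finite X \<and> card X \<le> 1" if "\<And>x y. x \<in> X \<Longrightarrow> y \<in> X \<Longrightarrow> x = y" for X :: "real set"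
    proof (cases "X = {}")
      case False
      then obtain x where "x \<in> X" by blast
      with that have "X = {x}" by blast
      then show ?thesis by simp
    qed auto
    have "x = y" if "x \<in> A - F" "y \<in> A - F" "\<bar>x - y\<bar> < g" for x y
      using F(2) that unfolding separated_def by force
    then have RQ: "finite R \<and> card R \<le> 1" "finite Q \<and> card Q \<le> 1"
    proof -
      show "finite R \<and> card R \<le> 1"
        by (rule one, rule \<open>\<And>x y. \<lbrakk>x \<in> A - F; y \<in> A - F; \<bar>x - y\<bar> < g\<rbrakk> \<Longrightarrow> x = y\<close>) (auto simp: R_def)
      show "finite Q \<and> card Q \<le> 1"
        by (rule one, rule \<open>\<And>x y. \<lbrakk>x \<in> A - F; y \<in> A - F; \<bar>x - y\<bar> < g\<rbrakk> \<Longrightarrow> x = y\<close>) (auto simp: Q_def)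
    qed
    have "D \<subseteq> F \<union> (R \<union> Q)"
      by (auto simp: D_def A'_def R_def Q_def)
    moreover have fin: "finite (F \<union> (R \<union> Q))" using F RQ by auto
    ultimately have D: "finite D" "card D \<le> card (F \<union> (R \<union> Q))"
      by (rule finite_subset, intro card_mono)
    moreover have "card (F \<union> (R \<union> Q)) \<le> card F + (card R + card Q)"
      using card_Un_le[of F "R \<union> Q"] card_Un_le[of R Q] by linarith
    ultimately have cD: "card D \<le> N" using RQ by (simp add: N_def)
    have "separated g A'"
      using F(2) by (auto simp: separated_def A'_def abs_minus_commute)
    moreover have "l \<in> A'" by (simp add: A'_def)
    ultimately obtain p where
      p: "pulse L B p" "\<And>\<nu>. \<nu> \<in> A' \<Longrightarrow> moment p \<nu> = (if \<nu> = l then 1 else 0)"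
      using ingham_pulse[OF _ L(1,3), of A' l] unfolding B_def by metis
    have "\<gamma> \<le> \<bar>l - \<mu>\<bar>" if "\<mu> \<in> D" for \<mu>
      using sep l that by (auto simp: D_def A'_def separated_def)
    from pulse_kill_finite[OF D(1) e(1) sep(2) this p(1)] obtain q where
      q: "pulse (L + real (card D) * e) (B / s ^ card D) q" "moment q l = moment p l"
        "\<forall>\<mu>\<in>D. moment q \<mu> = 0" "\<forall>\<xi>. moment p \<xi> = 0 \<longrightarrow> moment q \<xi> = 0"
      by (auto simp: s_def)
    have "L + real (card D) * e \<le> T"
      unfolding e(2)[symmetric] using cD e by (intro add_left_mono mult_right_mono) auto
    \<comment> \<open>As \<open>s\<close> is at most 1, passing from the actual number of removals
      to \<open>N\<close> only enlarges the bound and makes it the same for every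
      \<open>l\<close>.\<close>
    moreover have "B / s ^ card D \<le> B / s ^ N"
      using s B cD by (intro divide_left_mono power_decreasing) auto
    ultimately have "pulse T (B / s ^ N) q"
      by (intro pulse_mono[OF q(1)])
    moreover have "moment q \<nu> = (if \<nu> = l then 1 else 0)" if "\<nu> \<in> A" for \<nu>
    proof (cases "\<nu> \<in> D")
      case True
      then show ?thesis using q(3) by (auto simp: D_def A'_def)
    next
      case False
      then have "\<nu> \<in> A'" using that by (simp add: D_def)
      then show ?thesis using p(2)[of \<nu>] q(2,4) p(2)[of l] by (auto simp: A'_def)
    qed
    ultimately show ?thesis by blast
  qed
  moreover have "0 \<le> B / s ^ N" using B s by simp
  ultimately show ?thesis by (rule that[rotated])
qed

section \<open>Operators on test functions\<close>

text \<open>Covers both partial derivatives, so that the rules of calculus are proved once.\<close>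

definition dir_deriv :: "real \<times> real \<Rightarrow> (real \<times> real \<Rightarrow> complex) \<Rightarrow> real \<times> real \<Rightarrow> complex" where
  "dir_deriv v \<phi> p = frechet_derivative \<phi> (at p) v"

lemma pdx_dir: "pdx = dir_deriv (1, 0)" and pdy_dir: "pdy = dir_deriv (0, 1)"
  by (simp_all add: fun_eq_iff pdx_def pdy_def dir_deriv_def)

lemma dir_deriv_eq: "(\<phi> has_derivative \<phi>') (at p) \<Longrightarrow> dir_deriv v \<phi> p = \<phi>' v"
  unfolding dir_deriv_def using frechet_derivative_at by metis

lemma differentiable_has_derivative_dir:
  "\<phi> differentiable at p \<Longrightarrow> (\<phi> has_derivative (\<lambda>v. dir_deriv v \<phi> p)) (at p)"
  unfolding dir_deriv_def eta_contract_eq by (simp add: frechet_derivative_works[symmetric])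

lemma dir_deriv_add:
  assumes "\<phi> differentiable at p" "\<psi> differentiable at p"
  shows "dir_deriv v (\<lambda>p. \<phi> p + \<psi> p) p = dir_deriv v \<phi> p + dir_deriv v \<psi> p"
  by (rule dir_deriv_eq[OF has_derivative_add[OF assms[THEN differentiable_has_derivative_dir]]])

lemma dir_deriv_mult:
  assumes "\<phi> differentiable at p" "\<psi> differentiable at p"
  shows "dir_deriv v (\<lambda>p. \<phi> p * \<psi> p) p = \<phi> p * dir_deriv v \<psi> p + dir_deriv v \<phi> p * \<psi> p"
  by (rule dir_deriv_eq[OF has_derivative_mult[OF assms[THEN differentiable_has_derivative_dir]]])

lemma dir_deriv_cmult:
  assumes "\<phi> differentiable at p"
  shows "dir_deriv v (\<lambda>p. c * \<phi> p) p = c * dir_deriv v \<phi> p"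
  by (rule dir_deriv_eq[OF has_derivative_mult_right[OF differentiable_has_derivative_dir[OF assms]]])

lemma dir_deriv_sum:
  assumes "\<And>i. i \<in> I \<Longrightarrow> \<phi> i differentiable at p"
  shows "dir_deriv v (\<lambda>p. \<Sum>i\<in>I. \<phi> i p) p = (\<Sum>i\<in>I. dir_deriv v (\<phi> i) p)"
  by (rule dir_deriv_eq[OF has_derivative_sum]) (use assms differentiable_has_derivative_dir in auto)

text \<open>The first factor enters as a sequence \<open>g\<close> in which each member is the
  derivative of the one before. In the applications these are the derivatives of a function of one
  real variable, taken along the matching coordinate.\<close>

lemma dir_deriv_funpow_leibniz:
  assumes g: "\<And>i p. g i differentiable at p" "\<And>i. dir_deriv v (g i) = g (Suc i)"
    and w: "\<And>i p. (dir_deriv v ^^ i) w differentiable at p"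
  shows "(dir_deriv v ^^ n) (\<lambda>p. g 0 p * w p) =
    (\<lambda>p. \<Sum>i\<le>n. of_nat (n choose i) * (g i p * (dir_deriv v ^^ (n - i)) w p))"
proof (induction n)
  case (Suc n)
  let ?X = "\<lambda>i. (dir_deriv v ^^ i) w"
  have "(dir_deriv v ^^ Suc n) (\<lambda>p. g 0 p * w p) p =
      (\<Sum>i\<le>Suc n. of_nat (Suc n choose i) * (g i p * ?X (Suc n - i) p))" for p
  proof -
    have "(dir_deriv v ^^ Suc n) (\<lambda>p. g 0 p * w p) p =
        dir_deriv v (\<lambda>p. \<Sum>i\<le>n. of_nat (n choose i) * (g i p * ?X (n - i) p)) p"
      by (simp add: Suc)
    also have "\<dots> = (\<Sum>i\<le>n. of_nat (n choose i) * (g i p * ?X (Suc n - i) p + g (Suc i) p * ?X (n - i) p))"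
      by (simp add: dir_deriv_sum dir_deriv_cmult dir_deriv_mult g w Suc_diff_le
          cong: sum.cong_simp)
    also have "\<dots> = (\<Sum>i\<le>n. of_nat (n choose i) * (g i p * ?X (Suc n - i) p))
        + (\<Sum>i\<le>n. of_nat (n choose i) * (g (Suc i) p * ?X (n - i) p))"
      by (simp add: sum.distrib algebra_simps)
    \<comment> \<open>The added term i = n + 1 has binomial coefficient 0; it makes the index shift
      of the next line possible.\<close>
    also have "(\<Sum>i\<le>n. of_nat (n choose i) * (g i p * ?X (Suc n - i) p)) =
        (\<Sum>i\<le>Suc n. of_nat (n choose i) * (g i p * ?X (Suc n - i) p))" by simp
    also have "\<dots> = g 0 p * ?X (Suc n) p + (\<Sum>i\<le>n. of_nat (n choose Suc i) * (g (Suc i) p * ?X (n - i) p))"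
      by (subst sum.atMost_Suc_shift) simp
    also have "\<dots> + (\<Sum>i\<le>n. of_nat (n choose i) * (g (Suc i) p * ?X (n - i) p)) =
       g 0 p * ?X (Suc n) p + (\<Sum>i\<le>n. of_nat (Suc n choose Suc i) * (g (Suc i) p * ?X (n - i) p))"
      by (simp add: sum.distrib algebra_simps)
    also have "\<dots> = (\<Sum>i\<le>Suc n. of_nat (Suc n choose i) * (g i p * ?X (Suc n - i) p))"
      using sum.atMost_Suc_shift[of "\<lambda>i. of_nat (Suc n choose i) * (g i p * ?X (Suc n - i) p)" n] by simp
    finally show ?thesis .
  qed
  then show ?case by blast
qed simp

section \<open>Calculus of mixed partial derivatives\<close>

definition mixed :: "nat \<Rightarrow> nat \<Rightarrow> (real \<times> real \<Rightarrow> complex) \<Rightarrow> real \<times> real \<Rightarrow> complex" where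
  "mixed m n \<phi> = (pdx ^^ m) ((pdy ^^ n) \<phi>)"

lemma mixed_0: "mixed 0 0 \<phi> = \<phi>"
  and mixed_Suc_x: "mixed (Suc m) n \<phi> = pdx (mixed m n \<phi>)"
  and mixed_Suc_y: "mixed 0 (Suc n) \<phi> = pdy (mixed 0 n \<phi>)"
  by (simp_all add: mixed_def)

definition smooth :: "(real \<times> real \<Rightarrow> complex) \<Rightarrow> bool" where
  "smooth \<phi> \<longleftrightarrow> (\<forall>m n p. mixed m n \<phi> differentiable at p)"

definition periodic :: "(real \<times> real \<Rightarrow> 'a) \<Rightarrow> bool" where
  "periodic \<phi> \<longleftrightarrow> (\<forall>x y. \<phi> (x + 2 * pi, y) = \<phi> (x, y) \<and> \<phi> (x, y + 2 * pi) = \<phi> (x, y))"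

lemma test_function_iff: "test_function \<phi> \<longleftrightarrow> periodic \<phi> \<and> smooth \<phi>"
  by (simp add: test_function_def periodic_def smooth_def mixed_def)

lemma smoothD: "smooth \<phi> \<Longrightarrow> mixed m n \<phi> differentiable at p"
  unfolding smooth_def by blast

lemma continuous_mixed: "smooth \<phi> \<Longrightarrow> continuous_on S (mixed m n \<phi>)"
  by (meson continuous_at_imp_continuous_on differentiable_imp_continuous_within smoothD)

lemma continuous_test_function: "test_function \<phi> \<Longrightarrow> continuous_on S \<phi>"
  using continuous_mixed[of \<phi> S 0 0] by (simp add: test_function_iff mixed_0)

lemma mixed_induct [consumes 1, case_names zero y x]:
  assumes "smooth \<phi>"
    and "P 0 0 \<phi>"
    and "\<And>n. P 0 n (mixed 0 n \<phi>) \<Longrightarrow> P 0 (Suc n) (pdy (mixed 0 n \<phi>))"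
    and "\<And>m n. P m n (mixed m n \<phi>) \<Longrightarrow> P (Suc m) n (pdx (mixed m n \<phi>))"
  shows "P m n (mixed m n \<phi>)"
proof (induction m)
  case 0
  show ?case by (induction n) (use assms in \<open>simp_all add: mixed_0 mixed_Suc_y\<close>)
qed (use assms in \<open>simp add: mixed_Suc_x\<close>)

text \<open>All derivatives are identified by guessing a table \<open>\<psi>\<close> and checking
  one step in each direction. As \<open>mixed\<close> takes the y-derivatives before the
  x-derivatives, \<open>pdy\<close> is checked only where m = 0, and the symmetry of second
  derivatives never enters.\<close>

lemma mixed_unique:
  assumes "\<psi> 0 0 = \<phi>" "\<And>n. pdy (\<psi> 0 n) = \<psi> 0 (Suc n)" "\<And>m n. pdx (\<psi> m n) = \<psi> (Suc m) n"
  shows "mixed m n \<phi> = \<psi> m n"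
proof (induction m)
  case 0
  show ?case by (induction n) (simp_all add: mixed_0 mixed_Suc_y assms)
qed (simp add: mixed_Suc_x assms)

lemma smoothI:
  assumes "\<psi> 0 0 = \<phi>" "\<And>n. pdy (\<psi> 0 n) = \<psi> 0 (Suc n)" "\<And>m n. pdx (\<psi> m n) = \<psi> (Suc m) n"
    and "\<And>m n p. \<psi> m n differentiable at p"
  shows "smooth \<phi>"
  using mixed_unique[OF assms(1-3)] assms(4) by (simp add: smooth_def)

lemma
  assumes "smooth \<phi>" "smooth \<psi>"
  shows mixed_add: "mixed m n (\<lambda>p. \<phi> p + \<psi> p) = (\<lambda>p. mixed m n \<phi> p + mixed m n \<psi> p)"
    and smooth_add: "smooth (\<lambda>p. \<phi> p + \<psi> p)"
proof -
  have *: "pdy (\<lambda>p. mixed 0 n \<phi> p + mixed 0 n \<psi> p) = (\<lambda>p. mixed 0 (Suc n) \<phi> p + mixed 0 (Suc n) \<psi> p)"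
    "pdx (\<lambda>p. mixed m n \<phi> p + mixed m n \<psi> p) = (\<lambda>p. mixed (Suc m) n \<phi> p + mixed (Suc m) n \<psi> p)" for m n
    using assms by (simp_all add: mixed_Suc_x mixed_Suc_y pdx_dir pdy_dir dir_deriv_add smoothD fun_eq_iff)
  show "mixed m n (\<lambda>p. \<phi> p + \<psi> p) = (\<lambda>p. mixed m n \<phi> p + mixed m n \<psi> p)"
    by (rule mixed_unique) (simp_all add: * mixed_0)
  show "smooth (\<lambda>p. \<phi> p + \<psi> p)"
    by (rule smoothI[of "\<lambda>m n p. mixed m n \<phi> p + mixed m n \<psi> p"]) (use assms in \<open>simp_all add: * mixed_0 smoothD\<close>)
qed

lemma
  assumes "smooth \<phi>"
  shows mixed_cmult: "mixed m n (\<lambda>p. c * \<phi> p) = (\<lambda>p. c * mixed m n \<phi> p)"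
    and smooth_cmult: "smooth (\<lambda>p. c * \<phi> p)"
proof -
  have *: "pdy (\<lambda>p. c * mixed 0 n \<phi> p) = (\<lambda>p. c * mixed 0 (Suc n) \<phi> p)"
    "pdx (\<lambda>p. c * mixed m n \<phi> p) = (\<lambda>p. c * mixed (Suc m) n \<phi> p)" for m n
    using assms by (simp_all add: mixed_Suc_x mixed_Suc_y pdx_dir pdy_dir dir_deriv_cmult smoothD fun_eq_iff)
  show "mixed m n (\<lambda>p. c * \<phi> p) = (\<lambda>p. c * mixed m n \<phi> p)"
    by (rule mixed_unique) (simp_all add: * mixed_0)
  show "smooth (\<lambda>p. c * \<phi> p)"
    by (rule smoothI[of "\<lambda>m n p. c * mixed m n \<phi> p"]) (use assms in \<open>simp_all add: * mixed_0 smoothD differentiable_mult\<close>)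
qed

section \<open>Multiplication by a smooth periodic function of one coordinate\<close>

definition smooth_real :: "(real \<Rightarrow> real) \<Rightarrow> bool" where
  "smooth_real g \<longleftrightarrow> (\<forall>n x. (deriv ^^ n) g differentiable (at x)) \<and> (\<forall>x. g (x + 2 * pi) = g x)"

lemma control_profile_smooth_real: "control_profile g \<Longrightarrow> smooth_real g"
  by (simp add: control_profile_def smooth_real_def)

context
  fixes g :: "real \<Rightarrow> real"
  assumes g: "smooth_real g"
begin

lemma deriv_has_derivative: "((deriv ^^ n) g has_derivative (\<lambda>h. h * (deriv ^^ Suc n) g x)) (at x)"
proof -
  have "(deriv ^^ n) g field_differentiable (at x)"
    using g by (metis smooth_real_def real_differentiable_def field_differentiable_def)
  then have "((deriv ^^ n) g has_field_derivative deriv ((deriv ^^ n) g) x) (at x)"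
    by (simp add: field_differentiable_derivI)
  then show ?thesis unfolding has_field_derivative_def by (simp add: mult.commute[of _ "deriv _ _"])
qed

lemma coordinate_has_derivative:
  "((\<lambda>p. complex_of_real ((deriv ^^ n) g (fst p))) has_derivative
      (\<lambda>h. complex_of_real (fst h * (deriv ^^ Suc n) g (fst p)))) (at p)"
  "((\<lambda>p. complex_of_real ((deriv ^^ n) g (snd p))) has_derivative
      (\<lambda>h. complex_of_real (snd h * (deriv ^^ Suc n) g (snd p)))) (at p)"
  by (rule has_derivative_of_real has_derivative_compose[OF _ deriv_has_derivative]
      has_derivative_fst has_derivative_snd has_derivative_ident)+

lemma coordinate_differentiable:
  "(\<lambda>p. complex_of_real ((deriv ^^ n) g (fst p))) differentiable at p"
  "(\<lambda>p. complex_of_real ((deriv ^^ n) g (snd p))) differentiable at p"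
  using coordinate_has_derivative differentiable_def by blast+

lemma coordinate_dir_deriv:
  "dir_deriv v (\<lambda>p. complex_of_real ((deriv ^^ n) g (fst p))) p = complex_of_real (fst v * (deriv ^^ Suc n) g (fst p))"
  "dir_deriv v (\<lambda>p. complex_of_real ((deriv ^^ n) g (snd p))) p = complex_of_real (snd v * (deriv ^^ Suc n) g (snd p))"
  using dir_deriv_eq[OF coordinate_has_derivative(1)] dir_deriv_eq[OF coordinate_has_derivative(2)] by auto

lemma deriv_funpow_bounded: "\<exists>C. \<forall>x. \<bar>(deriv ^^ n) g x\<bar> \<le> C"
proof -
  have per: "(deriv ^^ n) g (x + 2 * pi) = (deriv ^^ n) g x" for x n
  proof (induction n arbitrary: x)
    case 0
    then show ?case using g by (simp add: smooth_real_def)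
  next
    case (Suc n)
    have "((\<lambda>x. (deriv ^^ n) g (x + 2 * pi)) has_derivative (\<lambda>h. h * (deriv ^^ Suc n) g (x + 2 * pi))) (at x)"
      by (rule has_derivative_compose[OF _ deriv_has_derivative]) (auto intro!: derivative_eq_intros)
    then have "((deriv ^^ n) g has_derivative (\<lambda>h. h * (deriv ^^ Suc n) g (x + 2 * pi))) (at x)"
      by (simp add: Suc)
    from has_derivative_unique[OF this deriv_has_derivative]
    show ?case by (simp add: fun_eq_iff) (metis mult_1)
  qed
  \<comment> \<open>The function of one variable is viewed as a function on the plane that is
    constant in y, to which the bound for periodic functions applies.\<close>
  have "continuous_on UNIV (\<lambda>p :: real \<times> real. complex_of_real ((deriv ^^ n) g (fst p)))"
    by (intro continuous_at_imp_continuous_on ballI differentiable_imp_continuous_within coordinate_differentiable)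
  then have "bdd_above (range (\<lambda>p. norm (complex_of_real ((deriv ^^ n) g (fst (p :: real \<times> real))))))"
    by (intro bdd_above_norm_periodic) (auto simp: per)
  then obtain C where "\<And>p :: real \<times> real. norm (complex_of_real ((deriv ^^ n) g (fst p))) \<le> C"
    unfolding bdd_above_def by auto
  then have "\<bar>(deriv ^^ n) g x\<bar> \<le> C" for x
    by (metis fst_conv norm_of_real)
  then show ?thesis by blast
qed

lemma
  assumes \<phi>: "smooth \<phi>"
  shows mixed_mult_snd: "mixed m n (\<lambda>p. complex_of_real (g (snd p)) * \<phi> p) =
      (\<lambda>p. \<Sum>i\<le>n. of_nat (n choose i) * (of_real ((deriv ^^ i) g (snd p)) * mixed m (n - i) \<phi> p))"
    and smooth_mult_snd: "smooth (\<lambda>p. complex_of_real (g (snd p)) * \<phi> p)"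
proof -
  let ?\<psi> = "\<lambda>m n p. \<Sum>i\<le>n. of_nat (n choose i) * (complex_of_real ((deriv ^^ i) g (snd p)) * mixed m (n - i) \<phi> p)"
  have d: "(\<lambda>p. of_nat (n choose i) * (complex_of_real ((deriv ^^ i) g (snd p)) * mixed m (n - i) \<phi> p)) differentiable at p" for m n i p
    by (intro differentiable_mult differentiable_const coordinate_differentiable smoothD \<phi>)
  have x: "pdx (?\<psi> m n) = ?\<psi> (Suc m) n" for m n
    by (rule ext) (simp add: pdx_dir mixed_Suc_x dir_deriv_sum[OF d] dir_deriv_cmult dir_deriv_mult differentiable_mult
        coordinate_differentiable coordinate_dir_deriv smoothD \<phi>)
  \<comment> \<open>The closed form is obtained for every \<open>n\<close> at once from the Leibniz
    rule. The step rule for \<open>pdy\<close> then needs no differentiation of the sum: one more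
    derivative is the closed form at \<open>Suc n\<close>.\<close>
  have y': "(pdy ^^ n) (\<lambda>p. complex_of_real (g (snd p)) * \<phi> p) = ?\<psi> 0 n" for n
  proof -
    have eq: "(dir_deriv (0, 1) ^^ i) \<phi> = mixed 0 i \<phi>" for i
      by (simp add: mixed_def pdy_dir)
    show ?thesis
      using dir_deriv_funpow_leibniz[of "\<lambda>i p. of_real ((deriv ^^ i) g (snd p))" "(0, 1)" \<phi> n] \<phi>
      by (simp add: eq pdy_dir coordinate_differentiable coordinate_dir_deriv smoothD fun_eq_iff del: funpow.simps)
  qed
  have y: "pdy (?\<psi> 0 n) = ?\<psi> 0 (Suc n)" for n
    unfolding y'[symmetric] by simp
  have 0: "?\<psi> 0 0 = (\<lambda>p. complex_of_real (g (snd p)) * \<phi> p)" by (simp add: mixed_0)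
  show "mixed m n (\<lambda>p. complex_of_real (g (snd p)) * \<phi> p) = ?\<psi> m n"
    by (rule mixed_unique[OF 0 y x])
  show "smooth (\<lambda>p. complex_of_real (g (snd p)) * \<phi> p)"
    by (rule smoothI[OF 0 y x]) (intro differentiable_sum d finite_atMost ballI)
qed

lemma
  assumes \<phi>: "smooth \<phi>"
  shows mixed_mult_fst: "mixed m n (\<lambda>p. complex_of_real (g (fst p)) * \<phi> p) =
      (\<lambda>p. \<Sum>i\<le>m. of_nat (m choose i) * (of_real ((deriv ^^ i) g (fst p)) * mixed (m - i) n \<phi> p))"
    and smooth_mult_fst: "smooth (\<lambda>p. complex_of_real (g (fst p)) * \<phi> p)"
proof -
  let ?\<psi> = "\<lambda>m n p. \<Sum>i\<le>m. of_nat (m choose i) * (complex_of_real ((deriv ^^ i) g (fst p)) * mixed (m - i) n \<phi> p)"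
  have d: "(\<lambda>p. of_nat (m choose i) * (complex_of_real ((deriv ^^ i) g (fst p)) * mixed (m - i) n \<phi> p)) differentiable at p" for m n i p
    by (intro differentiable_mult differentiable_const coordinate_differentiable smoothD \<phi>)
  have y: "pdy (?\<psi> 0 n) = ?\<psi> 0 (Suc n)" for n
    using coordinate_differentiable(1)[of 0] coordinate_dir_deriv(1)[of _ 0]
    by (intro ext) (simp add: pdy_dir mixed_Suc_y dir_deriv_mult smoothD \<phi>)
  have x': "(pdx ^^ m) (\<lambda>p. complex_of_real (g (fst p)) * mixed 0 n \<phi> p) = ?\<psi> m n" for m n
  proof -
    have eq: "(dir_deriv (1, 0) ^^ i) (mixed 0 n \<phi>) = mixed i n \<phi>" for i
      by (simp add: mixed_def pdx_dir)
    show ?thesis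
      using dir_deriv_funpow_leibniz[of "\<lambda>i p. of_real ((deriv ^^ i) g (fst p))" "(1, 0)" "mixed 0 n \<phi>" m] \<phi>
      by (simp add: eq pdx_dir coordinate_differentiable coordinate_dir_deriv smoothD fun_eq_iff del: funpow.simps)
  qed
  have x: "pdx (?\<psi> m n) = ?\<psi> (Suc m) n" for m n
    unfolding x'[symmetric] by simp
  have 0: "?\<psi> 0 0 = (\<lambda>p. complex_of_real (g (fst p)) * \<phi> p)" by (simp add: mixed_0)
  show "mixed m n (\<lambda>p. complex_of_real (g (fst p)) * \<phi> p) = ?\<psi> m n"
    by (rule mixed_unique[OF 0 y x])
  show "smooth (\<lambda>p. complex_of_real (g (fst p)) * \<phi> p)"
    by (rule smoothI[OF 0 y x]) (intro differentiable_sum d finite_atMost ballI)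
qed

end

section \<open>Averages over one coordinate\<close>

lemma has_derivative_partial:
  assumes "\<phi> differentiable at (x, y)"
  shows "((\<lambda>x. \<phi> (x, y)) has_vector_derivative pdx \<phi> (x, y)) (at x within S)"
    and "((\<lambda>y. \<phi> (x, y)) has_vector_derivative pdy \<phi> (x, y)) (at y within T)"
proof -
  have d: "(\<phi> has_derivative (\<lambda>v. dir_deriv v \<phi> (x, y))) (at (x, y))"
    by (rule differentiable_has_derivative_dir[OF assms])
  interpret linear "\<lambda>v. dir_deriv v \<phi> (x, y)"
    using d has_derivative_linear by blast
  have s: "dir_deriv (h, 0) \<phi> (x, y) = h *\<^sub>R pdx \<phi> (x, y)" "dir_deriv (0, h) \<phi> (x, y) = h *\<^sub>R pdy \<phi> (x, y)" for h
    using scaleR[of h "(1, 0)"] scaleR[of h "(0, 1)"] by (simp_all add: pdx_dir pdy_dir)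
  have "((\<lambda>x. \<phi> (x, y)) has_derivative (\<lambda>h. dir_deriv (h, 0) \<phi> (x, y))) (at x)"
    by (rule has_derivative_compose[of "\<lambda>x. (x, y)" "\<lambda>h. (h, 0)" x UNIV \<phi>, OF _ d]) (auto intro!: derivative_eq_intros)
  then show "((\<lambda>x. \<phi> (x, y)) has_vector_derivative pdx \<phi> (x, y)) (at x within S)"
    unfolding has_vector_derivative_def s by (rule has_derivative_at_withinI)
  have "((\<lambda>y. \<phi> (x, y)) has_derivative (\<lambda>h. dir_deriv (0, h) \<phi> (x, y))) (at y)"
    by (rule has_derivative_compose[of "\<lambda>y. (x, y)" "\<lambda>h. (0, h)" y UNIV \<phi>, OF _ d]) (auto intro!: derivative_eq_intros)
  then show "((\<lambda>y. \<phi> (x, y)) has_vector_derivative pdy \<phi> (x, y)) (at y within T)"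
    unfolding has_vector_derivative_def s by (rule has_derivative_at_withinI)
qed

text \<open>An integral without the factor 1/(2 pi). It remains a function of the point, constant in
  x, so that it is subject to the same calculus of \<open>mixed\<close> derivatives.\<close>

definition average_x :: "(real \<times> real \<Rightarrow> complex) \<Rightarrow> real \<times> real \<Rightarrow> complex" where
  "average_x \<phi> p = integral {0..2 * pi} (\<lambda>x'. \<phi> (x', snd p))"

definition average_y :: "(real \<times> real \<Rightarrow> complex) \<Rightarrow> real \<times> real \<Rightarrow> complex" where
  "average_y \<phi> p = integral {0..2 * pi} (\<lambda>y'. \<phi> (fst p, y'))"

lemma average_x_has_derivative:
  assumes d: "\<And>p. \<phi> differentiable at p" and c: "continuous_on UNIV (pdy \<phi>)"
  shows "(average_x \<phi> has_derivative (\<lambda>h. snd h *\<^sub>R average_x (pdy \<phi>) p)) (at p)"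
proof -
  have c\<phi>: "continuous_on UNIV \<phi>"
    using d by (meson continuous_at_imp_continuous_on differentiable_imp_continuous_within)
  have "((\<lambda>y. integral (cbox 0 (2 * pi)) (\<lambda>x'. \<phi> (x', y))) has_vector_derivative
      integral (cbox 0 (2 * pi)) (\<lambda>x'. pdy \<phi> (x', snd p))) (at (snd p) within UNIV)"
  proof (rule leibniz_rule_vector_derivative)
    show "((\<lambda>y. \<phi> (t, y)) has_vector_derivative pdy \<phi> (t, y)) (at y within UNIV)" for t y
      using has_derivative_partial(2)[OF d] .
    show "(\<lambda>x'. \<phi> (x', y)) integrable_on cbox 0 (2 * pi)" for y
      by (intro integrable_continuous continuous_on_compose2[OF c\<phi>] continuous_intros) auto
    show "continuous_on (UNIV \<times> cbox 0 (2 * pi)) (\<lambda>(y, t). pdy \<phi> (t, y))"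
      unfolding case_prod_unfold by (intro continuous_on_compose2[OF c] continuous_intros) auto
  qed auto
  then have "((\<lambda>y. integral {0..2 * pi} (\<lambda>x'. \<phi> (x', y))) has_derivative
      (\<lambda>h. h *\<^sub>R integral {0..2 * pi} (\<lambda>x'. pdy \<phi> (x', snd p)))) (at (snd p))"
    by (simp add: has_vector_derivative_def)
  from has_derivative_compose[OF has_derivative_snd[OF has_derivative_ident] this]
  show ?thesis by (simp add: average_x_def[abs_def])
qed

lemma average_y_has_derivative:
  assumes d: "\<And>p. \<phi> differentiable at p" and c: "continuous_on UNIV (pdx \<phi>)"
  shows "(average_y \<phi> has_derivative (\<lambda>h. fst h *\<^sub>R average_y (pdx \<phi>) p)) (at p)"
proof -
  have c\<phi>: "continuous_on UNIV \<phi>"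
    using d by (meson continuous_at_imp_continuous_on differentiable_imp_continuous_within)
  have "((\<lambda>x. integral (cbox 0 (2 * pi)) (\<lambda>y'. \<phi> (x, y'))) has_vector_derivative
      integral (cbox 0 (2 * pi)) (\<lambda>y'. pdx \<phi> (fst p, y'))) (at (fst p) within UNIV)"
  proof (rule leibniz_rule_vector_derivative)
    show "((\<lambda>x. \<phi> (x, t)) has_vector_derivative pdx \<phi> (x, t)) (at x within UNIV)" for t x
      using has_derivative_partial(1)[OF d] .
    show "(\<lambda>y'. \<phi> (x, y')) integrable_on cbox 0 (2 * pi)" for x
      by (intro integrable_continuous continuous_on_compose2[OF c\<phi>] continuous_intros) auto
    show "continuous_on (UNIV \<times> cbox 0 (2 * pi)) (\<lambda>(x, t). pdx \<phi> (x, t))"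
      unfolding case_prod_unfold by (intro continuous_on_compose2[OF c] continuous_intros) auto
  qed auto
  then have "((\<lambda>x. integral {0..2 * pi} (\<lambda>y'. \<phi> (x, y'))) has_derivative
      (\<lambda>h. h *\<^sub>R integral {0..2 * pi} (\<lambda>y'. pdx \<phi> (fst p, y')))) (at (fst p))"
    by (simp add: has_vector_derivative_def)
  from has_derivative_compose[OF has_derivative_fst[OF has_derivative_ident] this]
  show ?thesis by (simp add: average_y_def[abs_def])
qed

lemma
  assumes \<phi>: "smooth \<phi>"
  shows mixed_average_x: "mixed m n (average_x \<phi>) = (if m = 0 then average_x (mixed 0 n \<phi>) else (\<lambda>_. 0))"
    and smooth_average_x: "smooth (average_x \<phi>)"
proof -
  let ?\<psi> = "\<lambda>m n. if m = 0 then average_x (mixed 0 n \<phi>) else (\<lambda>_. 0)"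
  have d: "(average_x (mixed 0 n \<phi>) has_derivative (\<lambda>h. snd h *\<^sub>R average_x (mixed 0 (Suc n) \<phi>) p)) (at p)" for n p
    unfolding mixed_Suc_y
    by (rule average_x_has_derivative[OF smoothD[OF \<phi>]]) (use continuous_mixed[OF \<phi>, of UNIV 0 "Suc n"] in \<open>simp add: mixed_Suc_y\<close>)
  have 0: "?\<psi> 0 0 = average_x \<phi>" by (simp add: mixed_0)
  have y: "pdy (?\<psi> 0 n) = ?\<psi> 0 (Suc n)" for n
    by (rule ext) (simp add: pdy_dir dir_deriv_eq[OF d])
  have x: "pdx (?\<psi> m n) = ?\<psi> (Suc m) n" for m n
    by (rule ext) (auto simp: pdx_dir dir_deriv_eq[OF d] dir_deriv_eq[OF has_derivative_const])
  show "mixed m n (average_x \<phi>) = ?\<psi> m n"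
    by (rule mixed_unique[OF 0 y x])
  show "smooth (average_x \<phi>)"
    by (rule smoothI[OF 0 y x]) (simp add: differentiableI[OF d])
qed

lemma
  assumes \<phi>: "smooth \<phi>"
  shows mixed_average_y: "mixed m n (average_y \<phi>) = (if n = 0 then average_y (mixed m 0 \<phi>) else (\<lambda>_. 0))"
    and smooth_average_y: "smooth (average_y \<phi>)"
proof -
  let ?\<psi> = "\<lambda>m n. if n = 0 then average_y (mixed m 0 \<phi>) else (\<lambda>_. 0)"
  have d: "(average_y (mixed m 0 \<phi>) has_derivative (\<lambda>h. fst h *\<^sub>R average_y (mixed (Suc m) 0 \<phi>) p)) (at p)" for m p
    unfolding mixed_Suc_x
    by (rule average_y_has_derivative[OF smoothD[OF \<phi>]]) (use continuous_mixed[OF \<phi>, of UNIV "Suc m" 0] in \<open>simp add: mixed_Suc_x\<close>)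
  have 0: "?\<psi> 0 0 = average_y \<phi>" by (simp add: mixed_0)
  have y: "pdy (?\<psi> 0 n) = ?\<psi> 0 (Suc n)" for n
    by (rule ext) (auto simp: pdy_dir dir_deriv_eq[OF d] dir_deriv_eq[OF has_derivative_const])
  have x: "pdx (?\<psi> m n) = ?\<psi> (Suc m) n" for m n
    by (rule ext) (auto simp: pdx_dir dir_deriv_eq[OF d] dir_deriv_eq[OF has_derivative_const])
  show "mixed m n (average_y \<phi>) = ?\<psi> m n"
    by (rule mixed_unique[OF 0 y x])
  show "smooth (average_y \<phi>)"
    by (rule smoothI[OF 0 y x]) (simp add: differentiableI[OF d])
qed

section \<open>Continuous operators on the test functions\<close>

lemma mixed_le_test_seminorm:
  assumes "test_function \<phi>" "m \<le> N" "n \<le> N"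
  shows "norm (mixed m n \<phi> p) \<le> test_seminorm N \<phi>"
proof -
  have bdd: "bdd_above (range (\<lambda>p. norm (mixed m n \<phi> p)))" for m n
    using test_function_pd_bdd[OF assms(1)] by (simp add: mixed_def)
  have nn: "0 \<le> (SUP p. norm (mixed m n \<phi> p))" for m n
    by (rule cSUP_upper2[OF bdd, of 0]) auto
  have "norm (mixed m n \<phi> p) \<le> (SUP p. norm (mixed m n \<phi> p))"
    by (rule cSUP_upper[OF _ bdd]) auto
  also have "\<dots> \<le> (\<Sum>n\<le>N. SUP p. norm (mixed m n \<phi> p))"
    by (rule member_le_sum) (use assms nn in auto)
  also have "\<dots> \<le> (\<Sum>m\<le>N. \<Sum>n\<le>N. SUP p. norm (mixed m n \<phi> p))"
    by (rule member_le_sum[of m _ "\<lambda>m. \<Sum>n\<le>N. SUP p. norm (mixed m n \<phi> p)"]) (use assms nn in \<open>auto intro!: sum_nonneg\<close>)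
  finally show ?thesis by (simp add: test_seminorm_def mixed_def)
qed

lemma test_seminorm_le:
  assumes "\<And>m n p. m \<le> N \<Longrightarrow> n \<le> N \<Longrightarrow> norm (mixed m n \<phi> p) \<le> B m n"
  shows "test_seminorm N \<phi> \<le> (\<Sum>m\<le>N. \<Sum>n\<le>N. B m n)"
  unfolding test_seminorm_def using assms by (intro sum_mono cSUP_least) (auto simp: mixed_def)

text \<open>Continuity with no loss of derivatives: the same order \<open>N\<close> stands on both
  sides. The control operator has this property, so composing a distribution with it gives again a
  distribution.\<close>

definition test_operator :: "((real \<times> real \<Rightarrow> complex) \<Rightarrow> real \<times> real \<Rightarrow> complex) \<Rightarrow> bool" where
  "test_operator A \<longleftrightarrow> (\<forall>\<phi>. test_function \<phi> \<longrightarrow> test_function (A \<phi>)) \<and>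
     (\<forall>N. \<exists>C. \<forall>\<phi>. test_function \<phi> \<longrightarrow> test_seminorm N (A \<phi>) \<le> C * test_seminorm N \<phi>)"

text \<open>Reduces the seminorm estimate to one derivative at a time: the supremum of
  \<open>mixed m n\<close> of the image is controlled by those derivatives of \<phi> whose orders do
  not exceed \<open>m\<close> and \<open>n\<close>.\<close>

lemma test_operatorI:
  assumes "\<And>\<phi>. test_function \<phi> \<Longrightarrow> periodic (A \<phi>)" "\<And>\<phi>. smooth \<phi> \<Longrightarrow> smooth (A \<phi>)"
    and "\<And>m n. \<exists>C\<ge>0. \<forall>\<phi> M. test_function \<phi> \<longrightarrow>
      (\<forall>i\<le>m. \<forall>j\<le>n. \<forall>p. norm (mixed i j \<phi> p) \<le> M) \<longrightarrow> (\<forall>p. norm (mixed m n (A \<phi>) p) \<le> C * M)"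
  shows "test_operator A"
  unfolding test_operator_def
proof (intro conjI allI impI)
  show "test_function \<phi> \<Longrightarrow> test_function (A \<phi>)" for \<phi>
    using assms(1,2) by (simp add: test_function_iff)
  fix N
  obtain C where C: "\<And>m n \<phi> M p. test_function \<phi> \<Longrightarrow>
      (\<forall>i\<le>m. \<forall>j\<le>n. \<forall>p. norm (mixed i j \<phi> p) \<le> M) \<Longrightarrow> norm (mixed m n (A \<phi>) p) \<le> C m n * M"
    using assms(3) by metis
  have "test_seminorm N (A \<phi>) \<le> (\<Sum>m\<le>N. \<Sum>n\<le>N. C m n * test_seminorm N \<phi>)" if "test_function \<phi>" for \<phi>
    by (intro test_seminorm_le C that) (meson mixed_le_test_seminorm order_trans that)
  then show "\<exists>C. \<forall>\<phi>. test_function \<phi> \<longrightarrow> test_seminorm N (A \<phi>) \<le> C * test_seminorm N \<phi>"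
    by (intro exI[of _ "\<Sum>m\<le>N. \<Sum>n\<le>N. C m n"]) (simp add: sum_distrib_right)
qed

lemma test_operator_compose:
  assumes "test_operator A" "test_operator B"
  shows "test_operator (\<lambda>\<phi>. A (B \<phi>))"
  unfolding test_operator_def
proof (intro conjI allI impI)
  fix N
  obtain C where C: "\<And>\<phi>. test_function \<phi> \<Longrightarrow> test_seminorm N (A \<phi>) \<le> C * test_seminorm N \<phi>"
    using assms(1) unfolding test_operator_def by blast
  obtain D where D: "\<And>\<phi>. test_function \<phi> \<Longrightarrow> test_seminorm N (B \<phi>) \<le> D * test_seminorm N \<phi>"
    using assms(2) unfolding test_operator_def by blast
  have "test_seminorm N (A (B \<phi>)) \<le> (\<bar>C\<bar> * D) * test_seminorm N \<phi>" if \<phi>: "test_function \<phi>" for \<phi>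
  proof -
    have B\<phi>: "test_function (B \<phi>)" using assms(2) \<phi> by (simp add: test_operator_def)
    have "test_seminorm N (A (B \<phi>)) \<le> \<bar>C\<bar> * test_seminorm N (B \<phi>)"
      using C[OF B\<phi>] test_seminorm_mono(1)[OF B\<phi> order_refl]
      by (meson abs_ge_self mult_right_mono order_trans)
    also have "\<dots> \<le> \<bar>C\<bar> * (D * test_seminorm N \<phi>)"
      using D[OF \<phi>] by (intro mult_left_mono) auto
    finally show ?thesis by (simp add: mult.assoc)
  qed
  then show "\<exists>C. \<forall>\<phi>. test_function \<phi> \<longrightarrow> test_seminorm N (A (B \<phi>)) \<le> C * test_seminorm N \<phi>" by blast
qed (use assms in \<open>simp add: test_operator_def\<close>)

lemma test_operator_add:
  assumes "test_operator A" "test_operator B"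
  shows "test_operator (\<lambda>\<phi> p. A \<phi> p + B \<phi> p)"
  unfolding test_operator_def
proof (intro conjI allI impI)
  fix \<phi> assume "test_function \<phi>"
  then have "test_function (A \<phi>)" "test_function (B \<phi>)" using assms by (simp_all add: test_operator_def)
  then show "test_function (\<lambda>p. A \<phi> p + B \<phi> p)"
    by (simp add: test_function_iff smooth_add periodic_def)
next
  fix N
  obtain C where C: "\<And>\<phi>. test_function \<phi> \<Longrightarrow> test_seminorm N (A \<phi>) \<le> C * test_seminorm N \<phi>"
    using assms(1) unfolding test_operator_def by blast
  obtain D where D: "\<And>\<phi>. test_function \<phi> \<Longrightarrow> test_seminorm N (B \<phi>) \<le> D * test_seminorm N \<phi>"
    using assms(2) unfolding test_operator_def by blast
  have "test_seminorm N (\<lambda>p. A \<phi> p + B \<phi> p) \<le> (\<Sum>m\<le>N. \<Sum>n\<le>N. C + D) * test_seminorm N \<phi>" if \<phi>: "test_function \<phi>" for \<phi>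
  proof -
    have t: "test_function (A \<phi>)" "test_function (B \<phi>)" using assms \<phi> by (simp_all add: test_operator_def)
    have "test_seminorm N (\<lambda>p. A \<phi> p + B \<phi> p) \<le> (\<Sum>m\<le>N. \<Sum>n\<le>N. (C + D) * test_seminorm N \<phi>)"
    proof (rule test_seminorm_le)
      fix m n p assume mn: "m \<le> N" "n \<le> N"
      have "mixed m n (\<lambda>p. A \<phi> p + B \<phi> p) p = mixed m n (A \<phi>) p + mixed m n (B \<phi>) p"
        using t by (simp add: mixed_add test_function_iff)
      moreover have "norm (mixed m n (A \<phi>) p) \<le> C * test_seminorm N \<phi>"
        using mixed_le_test_seminorm[OF t(1) mn] C[OF \<phi>] by (rule order_trans)
      moreover have "norm (mixed m n (B \<phi>) p) \<le> D * test_seminorm N \<phi>"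
        using mixed_le_test_seminorm[OF t(2) mn] D[OF \<phi>] by (rule order_trans)
      ultimately show "norm (mixed m n (\<lambda>p. A \<phi> p + B \<phi> p) p) \<le> (C + D) * test_seminorm N \<phi>"
        by (simp add: distrib_right norm_triangle_mono)
    qed
    then show ?thesis by (simp add: mult.assoc)
  qed
  then show "\<exists>C. \<forall>\<phi>. test_function \<phi> \<longrightarrow> test_seminorm N (\<lambda>p. A \<phi> p + B \<phi> p) \<le> C * test_seminorm N \<phi>" by blast
qed

lemma test_operator_cmult: "test_operator (\<lambda>\<phi> p. c * \<phi> p)"
proof (rule test_operatorI)
  show "\<exists>C\<ge>0. \<forall>\<phi> M. test_function \<phi> \<longrightarrow> (\<forall>i\<le>m. \<forall>j\<le>n. \<forall>p. norm (mixed i j \<phi> p) \<le> M) \<longrightarrow>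
      (\<forall>p. norm (mixed m n (\<lambda>p. c * \<phi> p) p) \<le> C * M)" for m n
    by (intro exI[of _ "norm c"]) (auto simp: test_function_iff mixed_cmult norm_mult intro!: mult_left_mono)
qed (auto simp: smooth_cmult test_function_iff periodic_def)

lemma norm_integral_period_le:
  fixes f :: "real \<Rightarrow> complex"
  assumes "continuous_on {0..2 * pi} f" "\<And>x. norm (f x) \<le> M"
  shows "norm (integral {0..2 * pi} f) \<le> 2 * pi * M"
  using integral_bound[of 0 "2 * pi" f M] assms by (simp add: mult.commute)

lemma test_operator_average_x: "test_operator average_x"
proof (rule test_operatorI)
  fix m n
  have "norm (mixed m n (average_x \<phi>) p) \<le> 2 * pi * M"
    if t: "test_function \<phi>" and M: "\<forall>i\<le>m. \<forall>j\<le>n. \<forall>p. norm (mixed i j \<phi> p) \<le> M" for \<phi> M p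
  proof (cases "m = 0")
    case True
    have "continuous_on {0..2 * pi} (\<lambda>x'. mixed 0 n \<phi> (x', snd p))"
      by (rule continuous_on_compose2[OF continuous_mixed[of \<phi> UNIV 0 n]])
         (use t in \<open>auto simp: test_function_iff intro!: continuous_intros\<close>)
    then show ?thesis using M t True
      by (simp add: mixed_average_x test_function_iff average_x_def norm_integral_period_le)
  next
    case False
    have "0 \<le> M" using M norm_ge_zero order_trans by blast
    then show ?thesis using False t by (simp add: mixed_average_x test_function_iff)
  qed
  then show "\<exists>C\<ge>0. \<forall>\<phi> M. test_function \<phi> \<longrightarrow> (\<forall>i\<le>m. \<forall>j\<le>n. \<forall>p. norm (mixed i j \<phi> p) \<le> M) \<longrightarrow>
      (\<forall>p. norm (mixed m n (average_x \<phi>) p) \<le> C * M)"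
    by (intro exI[of _ "2 * pi"]) auto
qed (auto simp: smooth_average_x test_function_iff periodic_def average_x_def)

lemma test_operator_average_y: "test_operator average_y"
proof (rule test_operatorI)
  fix m n
  have "norm (mixed m n (average_y \<phi>) p) \<le> 2 * pi * M"
    if t: "test_function \<phi>" and M: "\<forall>i\<le>m. \<forall>j\<le>n. \<forall>p. norm (mixed i j \<phi> p) \<le> M" for \<phi> M p
  proof (cases "n = 0")
    case True
    have "continuous_on {0..2 * pi} (\<lambda>y'. mixed m 0 \<phi> (fst p, y'))"
      by (rule continuous_on_compose2[OF continuous_mixed[of \<phi> UNIV m 0]])
         (use t in \<open>auto simp: test_function_iff intro!: continuous_intros\<close>)
    then show ?thesis using M t True
      by (simp add: mixed_average_y test_function_iff average_y_def norm_integral_period_le)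
  next
    case False
    have "0 \<le> M" using M norm_ge_zero order_trans by blast
    then show ?thesis using False t by (simp add: mixed_average_y test_function_iff)
  qed
  then show "\<exists>C\<ge>0. \<forall>\<phi> M. test_function \<phi> \<longrightarrow> (\<forall>i\<le>m. \<forall>j\<le>n. \<forall>p. norm (mixed i j \<phi> p) \<le> M) \<longrightarrow>
      (\<forall>p. norm (mixed m n (average_y \<phi>) p) \<le> C * M)"
    by (intro exI[of _ "2 * pi"]) auto
qed (auto simp: smooth_average_y test_function_iff periodic_def average_y_def)

lemma leibniz_sum_bound:
  fixes a :: "nat \<Rightarrow> complex"
  assumes "\<And>i. i \<le> n \<Longrightarrow> norm (a i) \<le> C i" "\<And>i. i \<le> n \<Longrightarrow> norm (x i) \<le> M"
  shows "norm (\<Sum>i\<le>n. of_nat (n choose i) * (a i * x i)) \<le> (\<Sum>i\<le>n. real (n choose i) * C i) * M"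
proof -
  have "norm (\<Sum>i\<le>n. of_nat (n choose i) * (a i * x i)) \<le> (\<Sum>i\<le>n. real (n choose i) * (C i * M))"
  proof (intro sum_norm_le)
    fix i assume "i \<in> {..n}"
    then have "norm (a i) * norm (x i) \<le> C i * M"
      using assms by (intro mult_mono) (auto intro: order_trans[OF norm_ge_zero])
    then show "norm (of_nat (n choose i) * (a i * x i)) \<le> real (n choose i) * (C i * M)"
      by (simp add: norm_mult mult_left_mono)
  qed
  then show ?thesis by (simp add: sum_distrib_right mult.assoc)
qed

lemma
  assumes g: "smooth_real g"
  shows test_operator_mult_snd: "test_operator (\<lambda>\<phi> p. complex_of_real (g (snd p)) * \<phi> p)"
    and test_operator_mult_fst: "test_operator (\<lambda>\<phi> p. complex_of_real (g (fst p)) * \<phi> p)"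
proof -
  obtain C where C: "\<And>n x. \<bar>(deriv ^^ n) g x\<bar> \<le> C n"
    using deriv_funpow_bounded[OF g] by metis
  have C0: "0 \<le> C n" for n using C[of n 0] by linarith
  show "test_operator (\<lambda>\<phi> p. complex_of_real (g (snd p)) * \<phi> p)"
  proof (rule test_operatorI)
    show "\<exists>C\<ge>0. \<forall>\<phi> M. test_function \<phi> \<longrightarrow> (\<forall>i\<le>m. \<forall>j\<le>n. \<forall>p. norm (mixed i j \<phi> p) \<le> M) \<longrightarrow>
      (\<forall>p. norm (mixed m n (\<lambda>p. complex_of_real (g (snd p)) * \<phi> p) p) \<le> C * M)" for m n
      by (rule exI[of _ "\<Sum>i\<le>n. real (n choose i) * C i"])
         (auto simp: test_function_iff mixed_mult_snd[OF g] C C0 intro!: leibniz_sum_bound sum_nonneg)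
  qed (use g in \<open>auto simp: smooth_mult_snd[OF g] test_function_iff periodic_def smooth_real_def\<close>)
  show "test_operator (\<lambda>\<phi> p. complex_of_real (g (fst p)) * \<phi> p)"
  proof (rule test_operatorI)
    show "\<exists>C\<ge>0. \<forall>\<phi> M. test_function \<phi> \<longrightarrow> (\<forall>i\<le>m. \<forall>j\<le>n. \<forall>p. norm (mixed i j \<phi> p) \<le> M) \<longrightarrow>
      (\<forall>p. norm (mixed m n (\<lambda>p. complex_of_real (g (fst p)) * \<phi> p) p) \<le> C * M)" for m n
      by (rule exI[of _ "\<Sum>i\<le>m. real (m choose i) * C i"])
         (auto simp: test_function_iff mixed_mult_fst[OF g] C C0 intro!: leibniz_sum_bound sum_nonneg)
  qed (use g in \<open>auto simp: smooth_mult_fst[OF g] test_function_iff periodic_def smooth_real_def\<close>)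
qed

lemma test_operator_G_fun:
  assumes "smooth_real g1" "smooth_real g2"
  shows "test_operator (G_fun g1 g2)"
proof -
  have G1: "test_operator G1"
  proof -
    have eq: "G1 = (\<lambda>\<phi> p. of_real (1 / (2 * pi)) * \<phi> p + - of_real (1 / (2 * pi)\<^sup>2) * average_x \<phi> p)"
      by (auto simp: G1_def average_x_def fun_eq_iff)
    show ?thesis
      unfolding eq
      by (intro test_operator_add test_operator_cmult test_operator_average_x
          test_operator_compose[where A = "\<lambda>\<phi> p. - of_real (1 / (2 * pi)\<^sup>2) * \<phi> p"])
  qed
  have G2: "test_operator G2"
  proof -
    have eq: "G2 = (\<lambda>\<phi> p. of_real (1 / (2 * pi)) * \<phi> p + - of_real (1 / (2 * pi)\<^sup>2) * average_y \<phi> p)"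
      by (auto simp: G2_def average_y_def fun_eq_iff)
    show ?thesis
      unfolding eq
      by (intro test_operator_add test_operator_cmult test_operator_average_y
          test_operator_compose[where A = "\<lambda>\<phi> p. - of_real (1 / (2 * pi)\<^sup>2) * \<phi> p"])
  qed
  have eq: "G_fun g1 g2 = (\<lambda>\<phi> p. complex_of_real (g2 (snd p)) * G1 \<phi> p + complex_of_real (g1 (fst p)) * G2 \<phi> p)"
    by (auto simp: G_fun_def fun_eq_iff)
  show ?thesis
    unfolding eq
    by (intro test_operator_add
        test_operator_compose[OF test_operator_mult_snd[OF assms(2)] G1]
        test_operator_compose[OF test_operator_mult_fst[OF assms(1)] G2])
qed

section \<open>Fourier series on the torus\<close>

abbreviation torus :: "(real \<times> real) set" where
  "torus \<equiv> cbox (0, 0) (2 * pi, 2 * pi)"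

definition mode :: "int \<times> int \<Rightarrow> real \<times> real \<Rightarrow> complex" where
  "mode k p = exp (\<i> * complex_of_real (of_int (fst k) * fst p + of_int (snd k) * snd p))"

definition fcoeff :: "(real \<times> real \<Rightarrow> complex) \<Rightarrow> int \<times> int \<Rightarrow> complex" where
  "fcoeff \<phi> k = of_real (1 / (2 * pi)\<^sup>2) * integral torus (\<lambda>p. \<phi> p * mode (- k) p)"

lemma norm_mode [simp]: "norm (mode k p) = 1"
  unfolding mode_def by (rule norm_exp_i_times)

lemma mode_0 [simp]: "mode 0 = (\<lambda>_. 1)"
  by (simp add: mode_def fun_eq_iff)

lemma mode_add: "mode j p * mode k p = mode (j + k) p"
  by (simp add: mode_def exp_add[symmetric] algebra_simps)

lemma cnj_mode: "cnj (mode k p) = mode (- k) p"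
  by (simp add: mode_def exp_cnj algebra_simps)

lemma continuous_mode: "continuous_on S (mode k)"
  unfolding mode_def[abs_def] by (intro continuous_intros)

lemma fourier_coeff_mode: "fourier_coeff u k = of_real (1 / (2 * pi)\<^sup>2) * pairing u (mode (- k))"
proof -
  have "(\<lambda>(x, y). exp (- \<i> * complex_of_real (of_int (fst k) * x + of_int (snd k) * y))) = mode (- k)"
    by (auto simp: mode_def fun_eq_iff algebra_simps)
  then show ?thesis by (simp add: fourier_coeff_def split_beta)
qed

lemma exp_int_period: "exp (\<i> * (of_int n * (2 * complex_of_real pi))) = 1"
  using exp_integer_2pi[of "of_int n"] by (simp add: mult_ac)

lemma periodic_mode: "periodic (mode k)"
proof -
  have "complex_of_real (of_int (fst k) * (x + 2 * pi) + of_int (snd k) * y) =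
      complex_of_real (of_int (fst k) * x + of_int (snd k) * y) + of_int (fst k) * (2 * complex_of_real pi)"
    "complex_of_real (of_int (fst k) * x + of_int (snd k) * (y + 2 * pi)) =
      complex_of_real (of_int (fst k) * x + of_int (snd k) * y) + of_int (snd k) * (2 * complex_of_real pi)" for x y
    by (simp_all add: algebra_simps)
  then show ?thesis
    unfolding periodic_def mode_def fst_conv snd_conv
    by (simp only: distrib_left exp_add exp_int_period mult_1_right) simp
qed

lemma mode_has_derivative:
  "(mode k has_derivative (\<lambda>h. mode k p * (\<i> * complex_of_real (of_int (fst k) * fst h + of_int (snd k) * snd h)))) (at p)"
proof -
  have "((\<lambda>p. \<i> * complex_of_real (of_int (fst k) * fst p + of_int (snd k) * snd p)) has_derivative
      (\<lambda>h. \<i> * complex_of_real (of_int (fst k) * fst h + of_int (snd k) * snd h))) (at p)"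
    by (intro has_derivative_mult_right has_derivative_of_real has_derivative_add has_derivative_fst
        has_derivative_snd has_derivative_ident)
  from has_derivative_compose[OF this DERIV_exp[unfolded has_field_derivative_def]] show ?thesis
    unfolding mode_def[abs_def] .
qed

lemma pd_mode: "pdx (mode k) p = \<i> * of_int (fst k) * mode k p" "pdy (mode k) p = \<i> * of_int (snd k) * mode k p"
  by (simp_all add: pdx_dir pdy_dir dir_deriv_eq[OF mode_has_derivative])

lemma
  shows mixed_mode: "mixed m n (mode k) = (\<lambda>p. (\<i> * of_int (fst k)) ^ m * (\<i> * of_int (snd k)) ^ n * mode k p)"
    and smooth_mode: "smooth (mode k)"
proof -
  let ?\<psi> = "\<lambda>m n p. (\<i> * of_int (fst k)) ^ m * (\<i> * of_int (snd k)) ^ n * mode k p"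
  have d: "mode k differentiable at p" for p using mode_has_derivative differentiableI by blast
  have 1: "?\<psi> 0 0 = mode k" by simp
  have 2: "pdy (?\<psi> 0 n) = ?\<psi> 0 (Suc n)" for n
    by (simp add: fun_eq_iff pdy_dir dir_deriv_cmult[OF d] pd_mode[unfolded pdy_dir])
  have 3: "pdx (?\<psi> m n) = ?\<psi> (Suc m) n" for m n
    by (simp add: fun_eq_iff pdx_dir dir_deriv_cmult[OF d] pd_mode[unfolded pdx_dir])
  show "mixed m n (mode k) = ?\<psi> m n" by (rule mixed_unique[OF 1 2 3])
  show "smooth (mode k)" by (rule smoothI[OF 1 2 3]) (intro differentiable_mult differentiable_const d)
qed

lemma test_function_mode: "test_function (mode k)"
  by (simp add: test_function_iff smooth_mode periodic_mode)

section \<open>Integration by parts and decay of Fourier coefficients\<close>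

lemma periodic_mult: "periodic \<phi> \<Longrightarrow> periodic \<psi> \<Longrightarrow> periodic (\<lambda>p. \<phi> p * \<psi> p)"
  by (simp add: periodic_def)

lemma periodic_mixed:
  assumes "test_function \<phi>"
  shows "periodic (mixed m n \<phi>)"
proof -
  have s: "smooth \<phi>" using assms by (simp add: test_function_iff)
  from s show ?thesis
  proof (induction rule: mixed_induct[where P = "\<lambda>_ _ \<psi>. periodic \<psi>"])
    case zero
    then show ?case using assms by (simp add: test_function_iff)
  next
    case (y n)
    then show ?case using pd_periodic[of "mixed 0 n \<phi>"] smoothD[OF s] by (simp add: periodic_def)
  next
    case (x m n)
    then show ?case using pd_periodic[of "mixed m n \<phi>"] smoothD[OF s] by (simp add: periodic_def)
  qed
qed

text \<open>The boundary terms cancel by periodicity. Applied to the product of a function with a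
  mode this is integration by parts, and applied to a mode it gives orthogonality.\<close>

lemma integral_pd_periodic:
  assumes per: "periodic F" and d: "\<And>p. F differentiable at p"
  shows "continuous_on UNIV (pdx F) \<Longrightarrow> integral torus (pdx F) = 0"
    and "continuous_on UNIV (pdy F) \<Longrightarrow> integral torus (pdy F) = 0"
proof -
  show "integral torus (pdy F) = 0" if c: "continuous_on UNIV (pdy F)"
  proof -
    have "integral (cbox 0 (2 * pi)) (\<lambda>y. pdy F (x, y)) = 0" for x
    proof -
      have "((\<lambda>y. pdy F (x, y)) has_integral F (x, 2 * pi) - F (x, 0)) {0..2 * pi}"
        by (rule fundamental_theorem_of_calculus) (auto intro: has_derivative_partial d)
      moreover have "F (x, 2 * pi) = F (x, 0)" using per unfolding periodic_def by (metis add_0)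
      ultimately show ?thesis by (simp add: integral_unique)
    qed
    then show ?thesis
      using integral_prod_continuous[of 0 0 "2 * pi" "2 * pi" "pdy F"] continuous_on_subset[OF c] by simp
  qed
  show "integral torus (pdx F) = 0" if c: "continuous_on UNIV (pdx F)"
  proof -
    have z: "integral (cbox 0 (2 * pi)) (\<lambda>x. pdx F (x, y)) = 0" for y
    proof -
      have "((\<lambda>x. pdx F (x, y)) has_integral F (2 * pi, y) - F (0, y)) {0..2 * pi}"
        by (rule fundamental_theorem_of_calculus) (auto intro: has_derivative_partial d)
      moreover have "F (2 * pi, y) = F (0, y)" using per unfolding periodic_def by (metis add_0)
      ultimately show ?thesis by (simp add: integral_unique)
    qed
    have "integral torus (pdx F) = integral (cbox 0 (2 * pi)) (\<lambda>x. integral (cbox 0 (2 * pi)) (\<lambda>y. pdx F (x, y)))"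
      using integral_prod_continuous[of 0 0 "2 * pi" "2 * pi" "pdx F"] continuous_on_subset[OF c] by simp
    also have "\<dots> = integral (cbox 0 (2 * pi)) (\<lambda>y. integral (cbox 0 (2 * pi)) (\<lambda>x. pdx F (x, y)))"
      using continuous_on_subset[OF c] by (intro integral_swap_continuous) (simp add: split_beta)
    finally show ?thesis using z by simp
  qed
qed

lemma fcoeff_add:
  assumes "continuous_on UNIV \<phi>" "continuous_on UNIV \<psi>"
  shows "fcoeff (\<lambda>p. \<phi> p + \<psi> p) k = fcoeff \<phi> k + fcoeff \<psi> k"
proof -
  have "(\<lambda>p. \<phi> p * mode (- k) p) integrable_on torus" "(\<lambda>p. \<psi> p * mode (- k) p) integrable_on torus"
    by (intro integrable_continuous continuous_intros continuous_mode continuous_on_subset[OF assms(1)]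
        continuous_on_subset[OF assms(2)] subset_UNIV)+
  then show ?thesis by (simp add: fcoeff_def distrib_right distrib_left integral_add)
qed

lemma fcoeff_cmult: "fcoeff (\<lambda>p. c * \<phi> p) k = c * fcoeff \<phi> k"
  by (simp add: fcoeff_def mult.assoc)

lemma fcoeff_mode_mult: "fcoeff (\<lambda>p. \<phi> p * mode j p) k = fcoeff \<phi> (k - j)"
  by (simp add: fcoeff_def mult.assoc mode_add)

lemma norm_fcoeff_le:
  assumes c: "continuous_on UNIV \<phi>" and M: "\<And>p. norm (\<phi> p) \<le> M"
  shows "norm (fcoeff \<phi> k) \<le> M"
proof -
  have M0: "0 \<le> M" using M[of 0] norm_ge_zero order_trans by blast
  have "(\<lambda>p. \<phi> p * mode (- k) p) integrable_on torus"
    by (intro integrable_continuous continuous_intros continuous_mode continuous_on_subset[OF c] subset_UNIV)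
  then have "norm (integral torus (\<lambda>p. \<phi> p * mode (- k) p)) \<le> M * measure lborel torus"
    by (intro has_integral_bound[OF M0 integrable_integral]) (simp_all add: norm_mult M)
  also have "measure lborel torus = (2 * pi)\<^sup>2"
    by (simp add: content_Pair power2_eq_square)
  finally show ?thesis by (simp add: fcoeff_def norm_mult field_simps norm_divide norm_power)
qed

lemma fcoeff_pd:
  assumes per: "periodic \<phi>" and d: "\<And>p. \<phi> differentiable at p"
  shows "continuous_on UNIV (pdx \<phi>) \<Longrightarrow> fcoeff (pdx \<phi>) k = \<i> * of_int (fst k) * fcoeff \<phi> k"
    and "continuous_on UNIV (pdy \<phi>) \<Longrightarrow> fcoeff (pdy \<phi>) k = \<i> * of_int (snd k) * fcoeff \<phi> k"
proof -
  define F where "F p = \<phi> p * mode (- k) p" for p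
  have c: "continuous_on S \<phi>" for S
    using d by (meson continuous_at_imp_continuous_on differentiable_imp_continuous_within)
  have dc: "mode (- k) differentiable at p" for p using mode_has_derivative differentiableI by blast
  have F: "periodic F" "\<And>p. F differentiable at p"
    unfolding F_def by (intro periodic_mult per periodic_mode differentiable_mult d dc)+
  have int: "(\<lambda>p. \<phi> p * mode (- k) p) integrable_on torus"
    by (intro integrable_continuous continuous_intros continuous_mode c)
  {
    assume x: "continuous_on UNIV (pdx \<phi>)"
    have eq: "pdx F = (\<lambda>p. pdx \<phi> p * mode (- k) p - \<i> * of_int (fst k) * (\<phi> p * mode (- k) p))"
      using dir_deriv_mult[OF d dc] by (simp add: fun_eq_iff F_def[abs_def] pdx_dir pd_mode[unfolded pdx_dir])
    have int': "(\<lambda>p. pdx \<phi> p * mode (- k) p) integrable_on torus"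
      by (intro integrable_continuous continuous_intros continuous_mode continuous_on_subset[OF x] subset_UNIV)
    have "integral torus (pdx F) = 0"
      by (rule integral_pd_periodic[OF F]) (simp add: eq; intro continuous_intros x c continuous_mode)
    then show "fcoeff (pdx \<phi>) k = \<i> * of_int (fst k) * fcoeff \<phi> k"
      using int int' by (simp add: eq integral_diff integrable_on_mult_right fcoeff_def)
  }
  {
    assume x: "continuous_on UNIV (pdy \<phi>)"
    have eq: "pdy F = (\<lambda>p. pdy \<phi> p * mode (- k) p - \<i> * of_int (snd k) * (\<phi> p * mode (- k) p))"
      using dir_deriv_mult[OF d dc] by (simp add: fun_eq_iff F_def[abs_def] pdy_dir pd_mode[unfolded pdy_dir])
    have int': "(\<lambda>p. pdy \<phi> p * mode (- k) p) integrable_on torus"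
      by (intro integrable_continuous continuous_intros continuous_mode continuous_on_subset[OF x] subset_UNIV)
    have "integral torus (pdy F) = 0"
      by (rule integral_pd_periodic[OF F]) (simp add: eq; intro continuous_intros x c continuous_mode)
    then show "fcoeff (pdy \<phi>) k = \<i> * of_int (snd k) * fcoeff \<phi> k"
      using int int' by (simp add: eq integral_diff integrable_on_mult_right fcoeff_def)
  }
qed

lemma fcoeff_mode: "fcoeff (mode j) k = (if j = k then 1 else 0)"
proof -
  \<comment> \<open>A mode of nonzero index is, up to a nonzero factor, one of its own partial
    derivatives.\<close>
  have 0: "integral torus (mode l) = 0" if "l \<noteq> 0" for l
  proof -
    have d: "mode l differentiable at p" for p using mode_has_derivative differentiableI by blast
    have "continuous_on UNIV (pdx (mode l))" "continuous_on UNIV (pdy (mode l))"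
      by (simp_all add: pd_mode[abs_def] continuous_on_mult continuous_mode)
    then have "integral torus (pdx (mode l)) = 0" "integral torus (pdy (mode l)) = 0"
      using integral_pd_periodic[OF periodic_mode d] by auto
    then have "of_int (fst l) * integral torus (mode l) = 0" "of_int (snd l) * integral torus (mode l) = 0"
      by (simp_all add: pd_mode[abs_def])
    then show ?thesis using that by (cases l) (auto simp: zero_prod_def)
  qed
  have "fcoeff (mode j) k = of_real (1 / (2 * pi)\<^sup>2) * integral torus (mode (j - k))"
    by (simp add: fcoeff_def mode_add)
  then show ?thesis
    using 0[of "j - k"] by (auto simp: content_Pair power2_eq_square scaleR_conv_of_real)
qed

lemma fcoeff_mixed:
  assumes t: "test_function \<phi>"
  shows "fcoeff (mixed m n \<phi>) k = (\<i> * of_int (fst k)) ^ m * (\<i> * of_int (snd k)) ^ n * fcoeff \<phi> k"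
proof -
  have s: "smooth \<phi>" using t by (simp add: test_function_iff)
  from s show ?thesis
  proof (induction rule: mixed_induct[where P = "\<lambda>m n \<psi>. fcoeff \<psi> k = (\<i> * of_int (fst k)) ^ m * (\<i> * of_int (snd k)) ^ n * fcoeff \<phi> k"])
    case (y n)
    then show ?case
      using fcoeff_pd(2)[OF periodic_mixed[OF t] smoothD[OF s], of 0 n k] continuous_mixed[OF s, of UNIV 0 "Suc n"]
      by (simp add: mixed_Suc_y)
  next
    case (x m n)
    then show ?case
      using fcoeff_pd(1)[OF periodic_mixed[OF t] smoothD[OF s], of m n k] continuous_mixed[OF s, of UNIV "Suc m" n]
      by (simp add: mixed_Suc_x)
  qed simp
qed

lemma fcoeff_power_le:
  assumes t: "test_function \<phi>" and "m \<le> N" "n \<le> N"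
  shows "\<bar>real_of_int (fst k)\<bar> ^ m * \<bar>real_of_int (snd k)\<bar> ^ n * norm (fcoeff \<phi> k) \<le> test_seminorm N \<phi>"
proof -
  have "norm (fcoeff (mixed m n \<phi>) k) \<le> test_seminorm N \<phi>"
    using assms by (intro norm_fcoeff_le continuous_mixed mixed_le_test_seminorm) (auto simp: test_function_iff)
  then show ?thesis by (simp add: fcoeff_mixed[OF t] norm_mult norm_power)
qed

text \<open>A summable majorant on the lattice, in product form so that its sum reduces to
  one-dimensional series.\<close>

definition decay :: "int \<times> int \<Rightarrow> real" where
  "decay k = 1 / ((1 + (real_of_int (fst k))\<^sup>2) * (1 + (real_of_int (snd k))\<^sup>2))"

lemma decay_nonneg: "0 \<le> decay k"
  unfolding decay_def by (intro divide_nonneg_nonneg mult_nonneg_nonneg add_nonneg_nonneg) auto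

lemma fcoeff_decay:
  assumes t: "test_function \<phi>"
  shows "(1 + \<bar>real_of_int (fst k)\<bar> ^ M) * (1 + \<bar>real_of_int (snd k)\<bar> ^ M) * norm (fcoeff \<phi> k)
    \<le> 16 * test_seminorm (M + 2) \<phi> * decay k"
proof -
  define x y s where "x = \<bar>real_of_int (fst k)\<bar>" and "y = \<bar>real_of_int (snd k)\<bar>" and "s = test_seminorm (M + 2) \<phi>"
  have le: "x ^ m * y ^ n * norm (fcoeff \<phi> k) \<le> s" if "m \<in> {0, 2, M, M + 2}" "n \<in> {0, 2, M, M + 2}" for m n
    unfolding x_def y_def s_def by (rule fcoeff_power_le[OF t]) (use that in auto)
  \<comment> \<open>The product expands into 16 monomials with exponents in {0, 2, M, M + 2}. Each,
    times the coefficient, is the modulus of a coefficient of a derivative of order at most M + 2 in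
    each variable.\<close>
  have "(1 + x ^ M) * (1 + x\<^sup>2) * ((1 + y ^ M) * (1 + y\<^sup>2)) * norm (fcoeff \<phi> k) =
      (\<Sum>m\<leftarrow>[0, 2, M, M + 2]. \<Sum>n\<leftarrow>[0, 2, M, M + 2]. x ^ m * y ^ n * norm (fcoeff \<phi> k))"
    by (simp add: algebra_simps power_add power2_eq_square)
  also have "\<dots> \<le> (\<Sum>m\<leftarrow>[0, 2, M, M + 2]. \<Sum>n\<leftarrow>[0, 2, M, M + 2]. s)"
    by (intro sum_list_mono le) auto
  also have "\<dots> = 16 * s" by simp
  finally have *: "(1 + x ^ M) * (1 + x\<^sup>2) * ((1 + y ^ M) * (1 + y\<^sup>2)) * norm (fcoeff \<phi> k) \<le> 16 * s" .
  have pos: "0 < (1 + x\<^sup>2) * (1 + y\<^sup>2)" by (intro mult_pos_pos add_pos_nonneg) auto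
  have dec: "decay k = 1 / ((1 + x\<^sup>2) * (1 + y\<^sup>2))" by (simp add: decay_def x_def y_def)
  have "(1 + x ^ M) * (1 + y ^ M) * norm (fcoeff \<phi> k) * ((1 + x\<^sup>2) * (1 + y\<^sup>2)) \<le> 16 * s"
    using * by (simp add: mult_ac)
  then have "(1 + x ^ M) * (1 + y ^ M) * norm (fcoeff \<phi> k) \<le> 16 * s / ((1 + x\<^sup>2) * (1 + y\<^sup>2))"
    using pos by (simp add: pos_le_divide_eq)
  then show ?thesis unfolding dec by (simp add: x_def y_def s_def)
qed

lemma summable_decay: "decay summable_on UNIV"
proof -
  have "(\<lambda>n::nat. 1 / (1 + (real n)\<^sup>2)) summable_on UNIV"
  proof (rule norm_summable_imp_summable_on, rule summable_comparison_test')
    have "summable (\<lambda>n. inverse ((real (Suc n))\<^sup>2))"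
      using inverse_power_summable[of 2] by (subst summable_Suc_iff) (auto simp: )
    then show "summable (\<lambda>n. 2 * inverse ((real (Suc n))\<^sup>2))" by (rule summable_mult)
    fix n :: nat
    \<comment> \<open>Equivalent to (n - 1)^2 \<ge> 0.\<close>
    have "(real (Suc n))\<^sup>2 \<le> 2 * (1 + (real n)\<^sup>2)"
      using sum_squares_ge_zero[of "real n - 1" 0] by (simp add: power2_eq_square algebra_simps)
    then show "norm (norm (1 / (1 + (real n)\<^sup>2))) \<le> 2 * inverse ((real (Suc n))\<^sup>2)"
      by (simp add: field_simps add_pos_nonneg)
  qed
  then have nat: "(\<lambda>n::nat. 1 / (1 + (real_of_int (int n))\<^sup>2)) summable_on UNIV" by simp
  have "(\<lambda>n::int. 1 / (1 + (real_of_int n)\<^sup>2)) summable_on (range int \<union> (\<lambda>n. - int n) ` UNIV)"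
    by (intro summable_on_union; subst summable_on_reindex) (use nat in \<open>auto simp: o_def inj_on_def\<close>)
  moreover have "range int \<union> (\<lambda>n. - int n) ` UNIV = UNIV"
    by (auto simp: image_def) (metis int_cases2)
  ultimately have int: "(\<lambda>n::int. 1 / (1 + (real_of_int n)\<^sup>2)) summable_on UNIV" by simp
  have "decay summable_on UNIV \<times> UNIV"
  proof (rule summable_on_SigmaI)
    show "((\<lambda>y. decay (x, y)) has_sum (1 / (1 + (real_of_int x)\<^sup>2) * (\<Sum>\<^sub>\<infinity>n::int. 1 / (1 + (real_of_int n)\<^sup>2)))) UNIV" for x
    proof -
      have "(\<lambda>y. decay (x, y)) = (\<lambda>y. 1 / (1 + (real_of_int x)\<^sup>2) * (1 / (1 + (real_of_int y)\<^sup>2)))"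
        by (simp add: decay_def fun_eq_iff)
      then show ?thesis by (simp only:) (intro has_sum_cmult_right has_sum_infsum int)
    qed
    show "(\<lambda>x::int. 1 / (1 + (real_of_int x)\<^sup>2) * (\<Sum>\<^sub>\<infinity>n::int. 1 / (1 + (real_of_int n)\<^sup>2))) summable_on UNIV"
      by (intro summable_on_cmult_left int)
  qed (simp add: decay_nonneg)
  then show ?thesis by simp
qed

lemma summable_fcoeff_mixed:
  assumes t: "test_function \<phi>"
  shows "(\<lambda>k. norm (fcoeff (mixed m n \<phi>) k)) summable_on UNIV"
proof (rule summable_on_comparison_test)
  let ?M = "max m n"
  show "(\<lambda>k. 16 * test_seminorm (?M + 2) \<phi> * decay k) summable_on UNIV"
    by (intro summable_on_cmult_right summable_decay)
  fix k :: "int \<times> int"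
  have p: "x ^ j \<le> 1 + x ^ ?M" if "j \<le> ?M" "0 \<le> x" for x :: real and j
  proof (cases "x \<le> 1")
    case True
    then have "x ^ j \<le> 1" using that by (simp add: power_le_one)
    then show ?thesis using that by (simp add: add_increasing2)
  next
    case False
    then have "x ^ j \<le> x ^ ?M" using that by (intro power_increasing) auto
    then show ?thesis by simp
  qed
  have "norm (fcoeff (mixed m n \<phi>) k) = \<bar>real_of_int (fst k)\<bar> ^ m * \<bar>real_of_int (snd k)\<bar> ^ n * norm (fcoeff \<phi> k)"
    by (simp add: fcoeff_mixed[OF t] norm_mult norm_power)
  also have "\<dots> \<le> (1 + \<bar>real_of_int (fst k)\<bar> ^ ?M) * (1 + \<bar>real_of_int (snd k)\<bar> ^ ?M) * norm (fcoeff \<phi> k)"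
    by (intro mult_right_mono mult_mono p) auto
  also have "\<dots> \<le> 16 * test_seminorm (?M + 2) \<phi> * decay k" by (rule fcoeff_decay[OF t])
  finally show "norm (fcoeff (mixed m n \<phi>) k) \<le> 16 * test_seminorm (?M + 2) \<phi> * decay k" .
qed simp

section \<open>Density of trigonometric polynomials and Fourier inversion\<close>

lemma periodic_int_shift:
  assumes "periodic f"
  shows "f (x + 2 * pi * of_int m, y + 2 * pi * of_int n) = f (x, y)"
proof -
  have shift: "g (x + 2 * pi * of_int n) = g x" if g: "\<And>x. g (x + 2 * pi) = g x" for g :: "real \<Rightarrow> 'a" and x n
  proof (induction n rule: int_induct[where k = 0])
    case (step1 i)
    have "g (x + 2 * pi * of_int (i + 1)) = g ((x + 2 * pi * of_int i) + 2 * pi)"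
      by (simp add: algebra_simps)
    with step1 g show ?case by simp
  next
    case (step2 i)
    have "g (x + 2 * pi * of_int i) = g ((x + 2 * pi * of_int (i - 1)) + 2 * pi)"
      by (simp add: algebra_simps)
    with step2 g show ?case by simp
  qed simp
  have "f (x + 2 * pi * of_int m, y + 2 * pi * of_int n) = f (x, y + 2 * pi * of_int n)"
    using assms by (intro shift[of "\<lambda>x. f (x, _)"]) (simp add: periodic_def)
  also have "\<dots> = f (x, y)"
    using assms by (intro shift[of "\<lambda>y. f (x, y)"]) (simp add: periodic_def)
  finally show ?thesis .
qed

lemma Arg2pi_cis: "\<exists>n. x = Arg2pi (cis x) + 2 * pi * of_int n"
proof -
  have "cis (Arg2pi (cis x)) = cis x"
    using Arg2pi_eq[of "cis x"] by (simp add: cis_conv_exp)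
  then obtain n :: int where
    "\<i> * complex_of_real x = \<i> * complex_of_real (Arg2pi (cis x)) + (of_int (2 * n) * pi) * \<i>"
    using exp_eq[of "\<i> * complex_of_real x" "\<i> * complex_of_real (Arg2pi (cis x))"] by (auto simp: cis_conv_exp)
  from arg_cong[OF this, of Im] show ?thesis by (auto simp: mult_ac)
qed

lemma periodic_reduce:
  assumes "periodic f"
  shows "f (x, y) = f (Arg2pi (cis x), Arg2pi (cis y))"
proof -
  obtain m n where m: "x = Arg2pi (cis x) + 2 * pi * of_int m" and n: "y = Arg2pi (cis y) + 2 * pi * of_int n"
    using Arg2pi_cis by blast
  show ?thesis
    using periodic_int_shift[OF assms, of "Arg2pi (cis x)" m "Arg2pi (cis y)" n]
    unfolding m[symmetric] n[symmetric] .
qed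

text \<open>A continuous periodic function descends to the product of two circles because the
  parametrisation of that compact set by the closed square is a closed map.\<close>

lemma periodic_descends:
  fixes F :: "real \<times> real \<Rightarrow> 'a::topological_space"
  assumes per: "periodic F" and c: "continuous_on UNIV F"
  shows "continuous_on (sphere 0 1 \<times> sphere 0 1) (\<lambda>z. F (Arg2pi (fst z), Arg2pi (snd z)))"
proof -
  let ?Z = "sphere 0 1 \<times> sphere 0 1 :: (complex \<times> complex) set"
  let ?\<pi> = "\<lambda>p. (cis (fst p), cis (snd p))"
  have "closed ((\<lambda>z. F (Arg2pi (fst z), Arg2pi (snd z))) -` B \<inter> ?Z)" if B: "closed B" for B
  proof -
    have "(\<lambda>z. F (Arg2pi (fst z), Arg2pi (snd z))) -` B \<inter> ?Z = ?\<pi> ` (torus \<inter> F -` B)"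
    proof (intro equalityI subsetI)
      fix z assume z: "z \<in> (\<lambda>z. F (Arg2pi (fst z), Arg2pi (snd z))) -` B \<inter> ?Z"
      have "cis (Arg2pi w) = w" if "norm w = 1" for w
        using Arg2pi_eq[of w] that by (simp add: cis_conv_exp)
      then have "z = ?\<pi> (Arg2pi (fst z), Arg2pi (snd z))" using z by (cases z) auto
      moreover have "(Arg2pi (fst z), Arg2pi (snd z)) \<in> torus \<inter> F -` B"
        using z Arg2pi[of "fst z"] Arg2pi[of "snd z"] by (auto simp: cbox_Pair_eq less_imp_le)
      ultimately show "z \<in> ?\<pi> ` (torus \<inter> F -` B)" by blast
    next
      fix z assume "z \<in> ?\<pi> ` (torus \<inter> F -` B)"
      then obtain p where p: "z = ?\<pi> p" "F p \<in> B" by auto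
      then show "z \<in> (\<lambda>z. F (Arg2pi (fst z), Arg2pi (snd z))) -` B \<inter> ?Z"
        using periodic_reduce[OF per, of "fst p" "snd p"] by simp
    qed
    moreover have "compact (torus \<inter> F -` B)"
    proof -
      have "closed (F -` B)" by (rule closed_vimage[OF B c])
      then show ?thesis by (intro compact_Int_closed compact_cbox)
    qed
    then have "compact (?\<pi> ` (torus \<inter> F -` B))"
      by (intro compact_continuous_image continuous_intros)
    ultimately show ?thesis by (simp add: compact_imp_closed)
  qed
  moreover have "closed ?Z" by (intro closed_Times closed_sphere)
  ultimately show ?thesis by (subst continuous_on_closed_vimage) auto
qed

text \<open>The linear span of the modes, in inductive form for proofs by induction. It is an
  algebra because products of modes are modes.\<close>

inductive_set trig :: "(real \<times> real \<Rightarrow> complex) set" where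
  mode: "mode k \<in> trig"
| cmult: "h \<in> trig \<Longrightarrow> (\<lambda>p. c * h p) \<in> trig"
| add: "h \<in> trig \<Longrightarrow> h' \<in> trig \<Longrightarrow> (\<lambda>p. h p + h' p) \<in> trig"

lemma trig_mult:
  assumes "h \<in> trig" "h' \<in> trig"
  shows "(\<lambda>p. h p * h' p) \<in> trig"
  using assms(1)
proof induction
  case (mode k)
  show ?case using assms(2)
  proof induction
    case (mode j)
    then show ?case by (simp add: mode_add trig.mode)
  next
    case (cmult h c)
    then show ?case using trig.cmult[OF cmult.IH, of c] by (simp add: mult_ac)
  next
    case (add h1 h2)
    then show ?case using trig.add[OF add.IH] by (simp add: distrib_left)
  qed
next
  case (cmult h c)
  then show ?case using trig.cmult[OF cmult.IH, of c] by (simp add: mult_ac)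
next
  case (add h1 h2)
  then show ?case using trig.add[OF add.IH] by (simp add: distrib_right)
qed

lemma trig_continuous: "h \<in> trig \<Longrightarrow> continuous_on UNIV h"
  by (induction rule: trig.induct) (auto intro!: continuous_intros continuous_mode)

lemma integral_trig_0:
  assumes c: "continuous_on UNIV f" and z: "\<And>k. fcoeff f k = 0" and h: "h \<in> trig"
  shows "integral torus (\<lambda>p. f p * h p) = 0"
  using h
proof induction
  case (mode k)
  then show ?case using z[of "- k"] by (simp add: fcoeff_def)
next
  case (cmult h c)
  have "(\<lambda>p. f p * (c * h p)) = (\<lambda>p. c * (f p * h p))" by (simp add: fun_eq_iff)
  then show ?case using cmult by simp
next
  case (add h h')
  have "(\<lambda>p. f p * h p) integrable_on torus" "(\<lambda>p. f p * h' p) integrable_on torus"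
    by (intro integrable_continuous continuous_intros continuous_on_subset[OF c] subset_UNIV
        continuous_on_subset[OF trig_continuous[OF add.hyps(1)]] continuous_on_subset[OF trig_continuous[OF add.hyps(2)]])+
  then show ?case using add by (simp add: distrib_left integral_add)
qed

text \<open>Euler's formulas. These four functions are the real coordinates of the two circles, and
  they separate the points of the torus.\<close>

lemma trig_coordinates:
  "(\<lambda>p. complex_of_real (Re (cis (fst p)))) \<in> trig" "(\<lambda>p. complex_of_real (Im (cis (fst p)))) \<in> trig"
  "(\<lambda>p. complex_of_real (Re (cis (snd p)))) \<in> trig" "(\<lambda>p. complex_of_real (Im (cis (snd p)))) \<in> trig"
proof -
  have "(\<lambda>p. 1 / 2 * mode k p + 1 / 2 * mode (- k) p) \<in> trig" "(\<lambda>p. - \<i> / 2 * mode k p + \<i> / 2 * mode (- k) p) \<in> trig" for k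
    by (intro trig.intros)+
  moreover have "(\<lambda>p. 1 / 2 * mode k p + 1 / 2 * mode (- k) p) = (\<lambda>p. complex_of_real (Re (mode k p)))"
    "(\<lambda>p. - \<i> / 2 * mode k p + \<i> / 2 * mode (- k) p) = (\<lambda>p. complex_of_real (Im (mode k p)))" for k
    by (simp_all add: cnj_mode[symmetric] complex_eq_iff fun_eq_iff)
  ultimately have *: "(\<lambda>p. complex_of_real (Re (mode k p))) \<in> trig" "(\<lambda>p. complex_of_real (Im (mode k p))) \<in> trig" for k
    by metis+
  have "mode (1, 0) = (\<lambda>p. cis (fst p))" "mode (0, 1) = (\<lambda>p. cis (snd p))"
    by (simp_all add: mode_def cis_conv_exp fun_eq_iff)
  then show "(\<lambda>p. complex_of_real (Re (cis (fst p)))) \<in> trig" "(\<lambda>p. complex_of_real (Im (cis (fst p)))) \<in> trig"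
    "(\<lambda>p. complex_of_real (Re (cis (snd p)))) \<in> trig" "(\<lambda>p. complex_of_real (Im (cis (snd p)))) \<in> trig"
    using *[of "(1, 0)"] *[of "(0, 1)"] by simp_all
qed

lemma trig_dense:
  assumes per: "periodic F" and c: "continuous_on UNIV F" and e: "0 < (e::real)"
  shows "\<exists>g. (\<lambda>p. complex_of_real (g p)) \<in> trig \<and> (\<forall>p. \<bar>F p - g p\<bar> < e)"
proof -
  let ?Z = "sphere 0 1 \<times> sphere 0 1 :: (complex \<times> complex) set"
  let ?\<pi> = "\<lambda>p. (cis (fst p), cis (snd p))"
  \<comment> \<open>The Stone-Weierstrass theorem is applied on the product of two circles, a
    compact set, where the functions of \<open>R\<close> are those whose pull-back to the plane is a
    trigonometric polynomial.\<close>
  define R where "R = {r. continuous_on ?Z r \<and> (\<lambda>p. complex_of_real (r (?\<pi> p))) \<in> trig}"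
  interpret function_ring_on R ?Z
  proof
    show "compact ?Z" by (intro compact_Times compact_sphere)
    show "(\<lambda>_. c) \<in> R" for c
      using trig.cmult[OF trig.mode[of 0], of "of_real c"] by (simp add: R_def)
    show "\<exists>f\<in>R. f x \<noteq> f y" if "x \<in> ?Z" "y \<in> ?Z" "x \<noteq> y" for x y
    proof -
      have R: "(\<lambda>z. Re (fst z)) \<in> R" "(\<lambda>z. Im (fst z)) \<in> R" "(\<lambda>z. Re (snd z)) \<in> R" "(\<lambda>z. Im (snd z)) \<in> R"
        using trig_coordinates by (auto simp: R_def intro!: continuous_intros)
      have "Re (fst x) \<noteq> Re (fst y) \<or> Im (fst x) \<noteq> Im (fst y) \<or> Re (snd x) \<noteq> Re (snd y) \<or> Im (snd x) \<noteq> Im (snd y)"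
        using that(3) by (metis complex_eq_iff prod.collapse)
      then show ?thesis
        by (elim disjE) (rule bexI[OF _ R(1)] bexI[OF _ R(2)] bexI[OF _ R(3)] bexI[OF _ R(4)], assumption)+
    qed
  qed (auto simp: R_def intro!: continuous_intros trig.add trig_mult)
  obtain r where r: "r \<in> R" "\<And>z. z \<in> ?Z \<Longrightarrow> \<bar>F (Arg2pi (fst z), Arg2pi (snd z)) - r z\<bar> < e"
    using Stone_Weierstrass_basic[OF periodic_descends[OF per c] e] by blast
  have "\<bar>F p - r (?\<pi> p)\<bar> < e" for p
    using r(2)[of "?\<pi> p"] periodic_reduce[OF per, of "fst p" "snd p"] by simp
  then show ?thesis using r(1) by (intro exI[of _ "\<lambda>p. r (?\<pi> p)"]) (simp add: R_def)
qed

text \<open>A function orthogonal to all modes is orthogonal to trigonometric polynomials, by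
  density to every real continuous periodic function, and in particular to its own real and
  imaginary parts. So the integral of |f|^2 is zero.\<close>

lemma fcoeff_eq_0_imp_0:
  assumes per: "periodic f" and c: "continuous_on UNIV f" and z: "\<And>k. fcoeff f k = 0"
  shows "f p = 0"
proof -
  obtain M where M: "\<And>p. norm (f p) \<le> M"
    using bdd_above_norm_periodic[OF _ _ c] per by (auto simp: periodic_def bdd_above_def)
  have M0: "0 \<le> M" using M[of 0] norm_ge_zero order_trans by blast
  have orth: "integral torus (\<lambda>p. f p * complex_of_real (F p)) = 0"
    if F: "periodic F" "continuous_on UNIV F" for F
  proof -
    have "norm (integral torus (\<lambda>p. f p * complex_of_real (F p))) \<le> 0 + e" if e: "0 < e" for e
    proof -
      define V where "V = measure lborel torus"
      \<comment> \<open>Chosen so that the approximation error, at most M d V, stays below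
        \<open>e\<close>; the added 1 covers the case M V = 0.\<close>
      define d where "d = e / (M * V + 1)"
      have V: "0 \<le> V" by (simp add: V_def)
      have MV: "0 \<le> M * V" using M0 V by simp
      then have d: "0 < d" using e by (simp add: d_def)
      have "M * V * e \<le> (M * V + 1) * e" using e by simp
      then have d': "M * d * V \<le> e" using MV by (simp add: d_def divide_le_eq mult_ac)
      obtain g where g: "(\<lambda>p. complex_of_real (g p)) \<in> trig" "\<And>p. \<bar>F p - g p\<bar> < d"
        using trig_dense[OF F d] by blast
      have int: "(\<lambda>p. f p * complex_of_real (F p)) integrable_on torus" "(\<lambda>p. f p * complex_of_real (g p)) integrable_on torus"
        by (intro integrable_continuous continuous_intros continuous_on_subset[OF c]
            continuous_on_subset[OF F(2)] continuous_on_subset[OF trig_continuous[OF g(1)]] subset_UNIV)+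
      have "integral torus (\<lambda>p. f p * complex_of_real (F p)) = integral torus (\<lambda>p. f p * complex_of_real (F p) - f p * complex_of_real (g p))"
        using int integral_trig_0[OF c z g(1)] by (simp add: integral_diff)
      also have "norm \<dots> \<le> M * d * V"
        unfolding V_def
      proof (rule has_integral_bound[OF _ integrable_integral])
        show "norm (f p * complex_of_real (F p) - f p * complex_of_real (g p)) \<le> M * d" for p
        proof -
          have "norm (f p * complex_of_real (F p) - f p * complex_of_real (g p)) = norm (f p) * \<bar>F p - g p\<bar>"
            by (metis norm_mult norm_of_real of_real_diff right_diff_distrib)
          also have "\<dots> \<le> M * d" by (rule mult_mono[OF M less_imp_le[OF g(2)] M0]) simp
          finally show ?thesis .
        qed
      qed (use M0 d int in \<open>auto intro: integrable_diff\<close>)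
      finally show ?thesis using d' by simp
    qed
    then have "norm (integral torus (\<lambda>p. f p * complex_of_real (F p))) \<le> 0" by (rule field_le_epsilon)
    then show ?thesis by simp
  qed
  define N where "N p = (norm (f p))\<^sup>2" for p
  have cN: "continuous_on UNIV N" unfolding N_def by (intro continuous_intros c)
  have "integral torus (\<lambda>p. complex_of_real (N p)) = 0"
  proof -
    \<comment> \<open>|f|^2 is f times its conjugate Re f - i Im f, so it is a combination of two
      integrands already known to have integral zero.\<close>
    have e: "complex_of_real (N p) = f p * complex_of_real (Re (f p)) - \<i> * (f p * complex_of_real (Im (f p)))" for p
      by (rule complex_eqI) (simp_all add: N_def cmod_power2 flip: power2_eq_square)
    have "(\<lambda>p. f p * complex_of_real (Re (f p))) integrable_on torus" "(\<lambda>p. f p * complex_of_real (Im (f p))) integrable_on torus"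
      by (rule integrable_continuous,
          intro continuous_on_mult continuous_on_of_real continuous_on_Re continuous_on_Im continuous_on_subset[OF c] subset_UNIV)+
    moreover have "integral torus (\<lambda>p. f p * complex_of_real (Re (f p))) = 0"
      "integral torus (\<lambda>p. f p * complex_of_real (Im (f p))) = 0"
      using per by (auto intro!: orth continuous_on_Re continuous_on_Im c simp: periodic_def)
    ultimately show ?thesis
      unfolding e by (simp add: integral_diff integrable_on_mult_right)
  qed
  moreover have "((\<lambda>p. complex_of_real (N p)) has_integral integral torus (\<lambda>p. complex_of_real (N p))) torus"
    by (intro integrable_integral integrable_continuous continuous_on_of_real continuous_on_subset[OF cN] subset_UNIV)
  ultimately have "((\<lambda>p. Re (complex_of_real (N p))) has_integral Re 0) torus"
    using has_integral_Re[of "\<lambda>p. complex_of_real (N p)" 0 torus] by simp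
  then have N0: "(N has_integral 0) torus" by simp
  have "N q = 0" if "q \<in> torus" for q
    by (rule has_integral_0_cbox_imp_0[OF continuous_on_subset[OF cN subset_UNIV] _ N0 _ that])
       (auto simp: N_def box_ne_empty Basis_prod_def)
  moreover have "(Arg2pi (cis (fst p)), Arg2pi (cis (snd p))) \<in> torus"
    using Arg2pi[of "cis (fst p)"] Arg2pi[of "cis (snd p)"] by (simp add: cbox_Pair_eq less_imp_le)
  ultimately have "N (Arg2pi (cis (fst p)), Arg2pi (cis (snd p))) = 0" by blast
  then have "f (Arg2pi (cis (fst p)), Arg2pi (cis (snd p))) = 0" by (simp add: N_def)
  then show ?thesis using periodic_reduce[OF per, of "fst p" "snd p"] by simp
qed

text \<open>Absolute summability makes the series a continuous periodic function with the same
  coefficients as \<open>f\<close>; the difference has all coefficients zero and hence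
  vanishes.\<close>

lemma fourier_inversion:
  assumes per: "periodic f" and c: "continuous_on UNIV f" and s: "(\<lambda>k. norm (fcoeff f k)) summable_on UNIV"
  shows "((\<lambda>k. fcoeff f k * mode k p) has_sum f p) UNIV"
proof -
  define S where "S p = (\<Sum>\<^sub>\<infinity>k. fcoeff f k * mode k p)" for p
  have cS: "continuous_on UNIV S"
    unfolding S_def by (rule continuous_on_infsum[OF _ s]) (auto simp: norm_mult intro!: continuous_intros continuous_mode)
  have "periodic S" using periodic_mode by (simp add: periodic_def S_def)
  then have per': "periodic (\<lambda>p. f p + (-1) * S p)" using per by (simp add: periodic_def)
  have tS: "fcoeff S j = fcoeff f j" for j
  proof -
    have "((\<lambda>k. integral torus (\<lambda>p. fcoeff f k * mode k p * mode (- j) p)) has_sum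
         integral torus (\<lambda>p. \<Sum>\<^sub>\<infinity>k. fcoeff f k * mode k p * mode (- j) p)) UNIV"
      by (rule has_sum_integral_cbox[OF _ s]) (auto simp: norm_mult intro!: continuous_intros continuous_mode)
    then have "((\<lambda>k. fcoeff (\<lambda>p. fcoeff f k * mode k p) j) has_sum fcoeff S j) UNIV"
      unfolding fcoeff_def[of _ j] S_def infsum_cmult_left' by (rule has_sum_cmult_right)
    moreover have "(\<lambda>k. fcoeff (\<lambda>p. fcoeff f k * mode k p) j) = (\<lambda>k. if k = j then fcoeff f j else 0)"
      by (auto simp: fcoeff_cmult fcoeff_mode)
    moreover have "((\<lambda>k. if k = j then fcoeff f j else 0) has_sum fcoeff f j) UNIV"
      by (rule has_sum_finite_neutralI[of "{j}"]) auto
    ultimately show ?thesis using has_sum_unique[of "\<lambda>k. fcoeff (\<lambda>p. fcoeff f k * mode k p) j" UNIV "fcoeff S j" "fcoeff f j"] by simp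
  qed
  have "f p + (-1) * S p = 0"
  proof (rule fcoeff_eq_0_imp_0[OF per'])
    show c': "continuous_on UNIV (\<lambda>p. f p + (-1) * S p)" by (intro continuous_intros c cS)
    have "continuous_on UNIV (\<lambda>p. (-1) * S p)" by (intro continuous_intros cS)
    from fcoeff_add[OF c this] show "fcoeff (\<lambda>p. f p + (-1) * S p) k = 0" for k
      by (simp only: fcoeff_cmult tS) simp
  qed
  moreover have "(\<lambda>k. fcoeff f k * mode k p) summable_on UNIV"
    using s by (intro abs_summable_summable[where f = "\<lambda>k. fcoeff f k * mode k p"]) (simp add: norm_mult)
  ultimately show ?thesis by (simp add: has_sum_iff S_def)
qed

section \<open>Distributions and their Fourier coefficients\<close>

lemma is_distribution_pairing: "is_distribution (pairing u)"
  using pairing[of u] by simp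

lemma pairing_add: "test_function \<phi> \<Longrightarrow> test_function \<psi> \<Longrightarrow> pairing u (\<lambda>p. \<phi> p + \<psi> p) = pairing u \<phi> + pairing u \<psi>"
  and pairing_cmult: "test_function \<phi> \<Longrightarrow> pairing u (\<lambda>p. c * \<phi> p) = c * pairing u \<phi>"
  and pairing_not_test: "\<not> test_function \<phi> \<Longrightarrow> pairing u \<phi> = 0"
  and pairing_bound: "\<exists>C N. \<forall>\<phi>. test_function \<phi> \<longrightarrow> norm (pairing u \<phi>) \<le> C * test_seminorm N \<phi>"
  using is_distribution_pairing[of u] unfolding is_distribution_def by blast+

lemma test_function_add: "test_function \<phi> \<Longrightarrow> test_function \<psi> \<Longrightarrow> test_function (\<lambda>p. \<phi> p + \<psi> p)"
  by (simp add: test_function_iff smooth_add periodic_def)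

lemma test_function_cmult: "test_function \<phi> \<Longrightarrow> test_function (\<lambda>p. c * \<phi> p)"
  by (simp add: test_function_iff smooth_cmult periodic_def)

lemma trig_sum:
  assumes "finite S"
  shows test_function_trig_sum: "test_function (\<lambda>p. \<Sum>k\<in>S. c k * mode k p)"
    and mixed_trig_sum: "mixed m n (\<lambda>p. \<Sum>k\<in>S. c k * mode k p) =
      (\<lambda>p. \<Sum>k\<in>S. (\<i> * of_int (fst k)) ^ m * (\<i> * of_int (snd k)) ^ n * c k * mode k p)"
    and pairing_trig_sum: "pairing u (\<lambda>p. \<Sum>k\<in>S. c k * mode k p) = (\<Sum>k\<in>S. c k * pairing u (mode k))"
proof -
  have z: "test_function (\<lambda>_. 0)" using test_function_cmult[OF test_function_mode, of 0] by simp
  have "test_function (\<lambda>p. \<Sum>k\<in>S. c k * mode k p) \<and>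
    mixed m n (\<lambda>p. \<Sum>k\<in>S. c k * mode k p) =
      (\<lambda>p. \<Sum>k\<in>S. (\<i> * of_int (fst k)) ^ m * (\<i> * of_int (snd k)) ^ n * c k * mode k p) \<and>
    pairing u (\<lambda>p. \<Sum>k\<in>S. c k * mode k p) = (\<Sum>k\<in>S. c k * pairing u (mode k))" for m n
    using assms
  proof induction
    case empty
    have "mixed m n (\<lambda>_. 0) = (\<lambda>_. 0)" using mixed_cmult[OF smooth_mode, of m n 0] by simp
    moreover have "pairing u (\<lambda>_. 0) = 0" using pairing_cmult[OF test_function_mode, of u 0] by simp
    ultimately show ?case using z by simp
  next
    case (insert k S)
    have t: "test_function (\<lambda>p. c k * mode k p)" "test_function (\<lambda>p. \<Sum>k\<in>S. c k * mode k p)"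
      using insert by (simp_all add: test_function_cmult test_function_mode)
    have "mixed m n (\<lambda>p. c k * mode k p + (\<Sum>k\<in>S. c k * mode k p)) =
        (\<lambda>p. mixed m n (\<lambda>p. c k * mode k p) p + mixed m n (\<lambda>p. \<Sum>k\<in>S. c k * mode k p) p)"
      using t by (simp add: mixed_add test_function_iff)
    then show ?case
      using insert t by (simp add: test_function_add pairing_add pairing_cmult test_function_mode mixed_cmult[OF smooth_mode] mixed_mode mult_ac)
  qed
  then show "test_function (\<lambda>p. \<Sum>k\<in>S. c k * mode k p)"
    "mixed m n (\<lambda>p. \<Sum>k\<in>S. c k * mode k p) =
      (\<lambda>p. \<Sum>k\<in>S. (\<i> * of_int (fst k)) ^ m * (\<i> * of_int (snd k)) ^ n * c k * mode k p)"
    "pairing u (\<lambda>p. \<Sum>k\<in>S. c k * mode k p) = (\<Sum>k\<in>S. c k * pairing u (mode k))"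
    by blast+
qed

text \<open>A distribution is continuous for some seminorm of finite order \<open>N\<close>, so it
  suffices that the Fourier series of \<phi> converges in that seminorm. This is inversion applied
  to each of the finitely many derivatives involved, whose coefficients are all absolutely
  summable.\<close>

theorem pairing_has_sum:
  assumes t: "test_function \<phi>"
  shows "((\<lambda>k. fcoeff \<phi> k * pairing u (mode k)) has_sum pairing u \<phi>) UNIV"
proof -
  obtain C N where CN: "\<And>\<phi>. test_function \<phi> \<Longrightarrow> norm (pairing u \<phi>) \<le> C * test_seminorm N \<phi>"
    using pairing_bound by blast
  have s: "smooth \<phi>" using t by (simp add: test_function_iff)
  \<comment> \<open>The mixed derivative of order (m, n) of the remainder of the series is bounded
    uniformly by this tail, which tends to 0 as \<open>F\<close> exhausts the lattice.\<close>
  define tail where "tail m n F = (\<Sum>\<^sub>\<infinity>k\<in>UNIV - F. norm (fcoeff (mixed m n \<phi>) k))" for m n and F :: "(int \<times> int) set"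
  have tail: "(tail m n \<longlongrightarrow> 0) (finite_subsets_at_top UNIV)" for m n
  proof -
    let ?f = "\<lambda>k. norm (fcoeff (mixed m n \<phi>) k)"
    have "(sum ?f \<longlongrightarrow> infsum ?f UNIV) (finite_subsets_at_top UNIV)"
      using has_sum_infsum[OF summable_fcoeff_mixed[OF t]] by (simp add: has_sum_def)
    then have "((\<lambda>F. infsum ?f UNIV - sum ?f F) \<longlongrightarrow> infsum ?f UNIV - infsum ?f UNIV) (finite_subsets_at_top UNIV)"
      by (intro tendsto_diff tendsto_const)
    moreover have "\<forall>\<^sub>F F in finite_subsets_at_top UNIV. infsum ?f UNIV - sum ?f F = tail m n F"
    proof (rule eventually_finite_subsets_at_top_weakI)
      fix F :: "(int \<times> int) set" assume "finite F"
      then show "infsum ?f UNIV - sum ?f F = tail m n F"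
        unfolding tail_def by (subst infsum_Diff) (auto simp: summable_fcoeff_mixed[OF t])
    qed
    ultimately show ?thesis by (simp add: tendsto_cong)
  qed
  let ?S = "\<lambda>F p. \<Sum>k\<in>F. fcoeff \<phi> k * mode k p"
  have bound: "norm (sum (\<lambda>k. fcoeff \<phi> k * pairing u (mode k)) F - pairing u \<phi>) \<le> \<bar>C\<bar> * (\<Sum>m\<le>N. \<Sum>n\<le>N. tail m n F)"
    if F: "finite F" for F
  proof -
    have t': "test_function (?S F)" "test_function (\<lambda>p. -1 * ?S F p)"
      by (intro test_function_cmult test_function_trig_sum F)+
    have t'': "test_function (\<lambda>p. \<phi> p + -1 * ?S F p)" by (intro test_function_add t t')
    have "test_seminorm N (\<lambda>p. \<phi> p + -1 * ?S F p) \<le> (\<Sum>m\<le>N. \<Sum>n\<le>N. tail m n F)"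
    proof (rule test_seminorm_le)
      fix m n p
      have "mixed m n (\<lambda>p. \<phi> p + -1 * ?S F p) p = mixed m n \<phi> p + -1 * mixed m n (?S F) p"
        using s t' by (simp only: mixed_add mixed_cmult test_function_iff)
      also have "mixed m n (?S F) p = (\<Sum>k\<in>F. fcoeff (mixed m n \<phi>) k * mode k p)"
        by (simp add: mixed_trig_sum[OF F] fcoeff_mixed[OF t])
      also have "mixed m n \<phi> p = (\<Sum>\<^sub>\<infinity>k. fcoeff (mixed m n \<phi>) k * mode k p)"
        using fourier_inversion[OF periodic_mixed[OF t] continuous_mixed[OF s] summable_fcoeff_mixed[OF t], of m n p]
        by (simp add: has_sum_iff)
      also have "\<dots> + -1 * (\<Sum>k\<in>F. fcoeff (mixed m n \<phi>) k * mode k p) = (\<Sum>\<^sub>\<infinity>k\<in>UNIV - F. fcoeff (mixed m n \<phi>) k * mode k p)"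
        using fourier_inversion[OF periodic_mixed[OF t] continuous_mixed[OF s] summable_fcoeff_mixed[OF t], of m n p] F
        by (subst infsum_Diff) (auto simp: has_sum_iff)
      finally have "norm (mixed m n (\<lambda>p. \<phi> p + -1 * ?S F p) p) = norm (\<Sum>\<^sub>\<infinity>k\<in>UNIV - F. fcoeff (mixed m n \<phi>) k * mode k p)"
        by (rule arg_cong)
      also have "\<dots> \<le> (\<Sum>\<^sub>\<infinity>k\<in>UNIV - F. norm (fcoeff (mixed m n \<phi>) k * mode k p))"
        by (rule norm_infsum_bound)
           (simp add: norm_mult summable_on_subset_banach[OF summable_fcoeff_mixed[OF t]])
      finally show "norm (mixed m n (\<lambda>p. \<phi> p + -1 * ?S F p) p) \<le> tail m n F"
        by (simp add: tail_def norm_mult)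
    qed
    then have "\<bar>C\<bar> * test_seminorm N (\<lambda>p. \<phi> p + -1 * ?S F p) \<le> \<bar>C\<bar> * (\<Sum>m\<le>N. \<Sum>n\<le>N. tail m n F)"
      by (intro mult_left_mono) auto
    moreover have "C * test_seminorm N (\<lambda>p. \<phi> p + -1 * ?S F p) \<le> \<bar>C\<bar> * test_seminorm N (\<lambda>p. \<phi> p + -1 * ?S F p)"
      by (intro mult_right_mono test_seminorm_mono(1)[OF t'' order_refl]) auto
    ultimately have "norm (pairing u (\<lambda>p. \<phi> p + -1 * ?S F p)) \<le> \<bar>C\<bar> * (\<Sum>m\<le>N. \<Sum>n\<le>N. tail m n F)"
      using CN[OF t''] by linarith
    moreover have "pairing u (\<lambda>p. \<phi> p + -1 * ?S F p) = pairing u \<phi> - sum (\<lambda>k. fcoeff \<phi> k * pairing u (mode k)) F"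
      by (subst pairing_add[OF t t'(2)], subst pairing_cmult[OF t'(1)]) (simp add: pairing_trig_sum[OF F])
    ultimately show ?thesis by (simp add: norm_minus_commute)
  qed
  have "((\<lambda>F. sum (\<lambda>k. fcoeff \<phi> k * pairing u (mode k)) F - pairing u \<phi>) \<longlongrightarrow> 0) (finite_subsets_at_top UNIV)"
  proof (rule Lim_null_comparison)
    show "\<forall>\<^sub>F F in finite_subsets_at_top UNIV. norm (sum (\<lambda>k. fcoeff \<phi> k * pairing u (mode k)) F - pairing u \<phi>)
        \<le> \<bar>C\<bar> * (\<Sum>m\<le>N. \<Sum>n\<le>N. tail m n F)"
      by (rule eventually_finite_subsets_at_top_weakI) (rule bound)
    have "((\<lambda>F. \<bar>C\<bar> * (\<Sum>m\<le>N. \<Sum>n\<le>N. tail m n F)) \<longlongrightarrow> \<bar>C\<bar> * (\<Sum>m\<le>N. \<Sum>n\<le>N. 0)) (finite_subsets_at_top UNIV)"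
      by (intro tendsto_mult tendsto_const tendsto_sum tail)
    then show "((\<lambda>F. \<bar>C\<bar> * (\<Sum>m\<le>N. \<Sum>n\<le>N. tail m n F)) \<longlongrightarrow> 0) (finite_subsets_at_top UNIV)" by simp
  qed
  then show ?thesis unfolding has_sum_def using LIM_zero_iff by blast
qed

lemma fourier_coeff_inject: "fourier_coeff u = fourier_coeff v \<Longrightarrow> u = v"
proof -
  assume eq: "fourier_coeff u = fourier_coeff v"
  have "pairing u (mode k) = pairing v (mode k)" for k
    using fun_cong[OF eq, of "- k"] by (simp add: fourier_coeff_mode)
  then have "pairing u \<phi> = pairing v \<phi>" if "test_function \<phi>" for \<phi>
  proof -
    have "((\<lambda>k. fcoeff \<phi> k * pairing v (mode k)) has_sum pairing u \<phi>) UNIV"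
      using pairing_has_sum[OF that, of u] by (simp add: \<open>\<And>k. pairing u (mode k) = pairing v (mode k)\<close>)
    then show ?thesis using pairing_has_sum[OF that, of v] by (rule has_sum_unique)
  qed
  then have "pairing u = pairing v" using pairing_not_test[of _ u] pairing_not_test[of _ v] by (intro ext) metis
  then show ?thesis by (simp add: pairing_inject)
qed

text \<open>The functional pairs the sequence with the coefficients of \<phi> at reflected indices,
  by Parseval. Two derivatives of \<phi> in each variable already make this series converge, so the
  result is continuous for the seminorm of order 2.\<close>

lemma bounded_fourier_coeffs_exist:
  assumes c: "\<And>k. norm (c k) \<le> B"
  shows "\<exists>u. fourier_coeff u = c"
proof -
  have B: "0 \<le> B" using c[of 0] norm_ge_zero order_trans by blast
  have n: "norm (c k * fcoeff \<phi> (- k)) \<le> B * (4 * test_seminorm 2 \<phi>) * decay k" if "test_function \<phi>" for \<phi> k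
  proof -
    \<comment> \<open>The decay estimate with exponent 0, where each of the two factors 1 + x^0
      equals 2.\<close>
    have "4 * norm (fcoeff \<phi> (- k)) \<le> 16 * test_seminorm 2 \<phi> * decay (- k)"
      using fcoeff_decay[OF that, of "- k" 0] by (simp add: numeral_2_eq_2)
    moreover have "decay (- k) = decay k" by (simp add: decay_def)
    ultimately have "norm (fcoeff \<phi> (- k)) \<le> 4 * test_seminorm 2 \<phi> * decay k" by (simp add: mult_ac)
    then have "norm (c k) * norm (fcoeff \<phi> (- k)) \<le> B * (4 * test_seminorm 2 \<phi> * decay k)"
      using c B by (intro mult_mono) auto
    then show ?thesis by (simp add: norm_mult mult.assoc)
  qed
  have ns: "(\<lambda>k. norm (c k * fcoeff \<phi> (- k))) summable_on UNIV" if "test_function \<phi>" for \<phi>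
    by (rule summable_on_comparison_test[OF summable_on_cmult_right[OF summable_decay] n[OF that]]) auto
  have s: "(\<lambda>k. c k * fcoeff \<phi> (- k)) summable_on UNIV" if "test_function \<phi>" for \<phi>
    by (rule abs_summable_summable[OF ns[OF that]])
  define w where "w \<phi> = (if test_function \<phi> then of_real ((2 * pi)\<^sup>2) * (\<Sum>\<^sub>\<infinity>k. c k * fcoeff \<phi> (- k)) else 0)" for \<phi>
  have "is_distribution w"
    unfolding is_distribution_def
  proof (intro conjI allI impI)
    fix \<phi> \<psi> assume t: "test_function \<phi>" "test_function \<psi>"
    have "(\<Sum>\<^sub>\<infinity>k. c k * fcoeff (\<lambda>p. \<phi> p + \<psi> p) (- k)) = (\<Sum>\<^sub>\<infinity>k. c k * fcoeff \<phi> (- k) + c k * fcoeff \<psi> (- k))"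
      using t by (simp add: fcoeff_add continuous_test_function distrib_left)
    also have "\<dots> = (\<Sum>\<^sub>\<infinity>k. c k * fcoeff \<phi> (- k)) + (\<Sum>\<^sub>\<infinity>k. c k * fcoeff \<psi> (- k))"
      by (intro infsum_add s t)
    finally show "w (\<lambda>p. \<phi> p + \<psi> p) = w \<phi> + w \<psi>"
      using t by (simp add: w_def test_function_add distrib_left)
  next
    fix a \<phi> assume t: "test_function \<phi>"
    have "(\<Sum>\<^sub>\<infinity>k. c k * fcoeff (\<lambda>p. a * \<phi> p) (- k)) = (\<Sum>\<^sub>\<infinity>k. a * (c k * fcoeff \<phi> (- k)))"
      by (simp add: fcoeff_cmult mult_ac)
    then show "w (\<lambda>p. a * \<phi> p) = a * w \<phi>"
      using t by (simp add: w_def test_function_cmult infsum_cmult_right')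
  next
    have "norm (w \<phi>) \<le> ((2 * pi)\<^sup>2 * (B * 4 * (\<Sum>\<^sub>\<infinity>k. decay k))) * test_seminorm 2 \<phi>" if t: "test_function \<phi>" for \<phi>
    proof -
      have "norm (\<Sum>\<^sub>\<infinity>k. c k * fcoeff \<phi> (- k)) \<le> (\<Sum>\<^sub>\<infinity>k. norm (c k * fcoeff \<phi> (- k)))"
        by (rule norm_infsum_bound[OF ns[OF t]])
      also have "\<dots> \<le> (\<Sum>\<^sub>\<infinity>k. B * (4 * test_seminorm 2 \<phi>) * decay k)"
        by (rule infsum_mono[OF ns[OF t] summable_on_cmult_right[OF summable_decay] n[OF t]])
      also have "\<dots> = B * 4 * (\<Sum>\<^sub>\<infinity>k. decay k) * test_seminorm 2 \<phi>"
        by (simp add: infsum_cmult_right')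
      finally have "(2 * pi)\<^sup>2 * norm (\<Sum>\<^sub>\<infinity>k. c k * fcoeff \<phi> (- k)) \<le> (2 * pi)\<^sup>2 * (B * 4 * (\<Sum>\<^sub>\<infinity>k. decay k) * test_seminorm 2 \<phi>)"
        by (intro mult_left_mono) auto
      then show ?thesis using t unfolding w_def by (simp only: if_True norm_mult norm_of_real) (simp add: mult_ac)
    qed
    then show "\<exists>C N. \<forall>\<phi>. test_function \<phi> \<longrightarrow> norm (w \<phi>) \<le> C * test_seminorm N \<phi>" by blast
  qed (simp add: w_def)
  then have p: "pairing (Abs_distribution w) = w" by (simp add: Abs_distribution_inverse)
  have "fourier_coeff (Abs_distribution w) k = c k" for k
  proof -
    have "((\<lambda>j. c j * fcoeff (mode (- k)) (- j)) has_sum c k) UNIV"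
      by (rule has_sum_finite_neutralI[of "{k}"]) (auto simp: fcoeff_mode)
    then show ?thesis
      by (simp add: fourier_coeff_mode p w_def test_function_mode infsumI)
  qed
  then show ?thesis by blast
qed

section \<open>The control operator as an infinite matrix\<close>

lemma average_mode:
  "average_x (mode k) p = (if fst k = 0 then 2 * pi * mode k p else 0)"
  "average_y (mode k) p = (if snd k = 0 then 2 * pi * mode k p else 0)"
proof -
  have d: "mode k differentiable at p" for p using mode_has_derivative differentiableI by blast
  show "average_x (mode k) p = (if fst k = 0 then 2 * pi * mode k p else 0)"
  proof (cases "fst k = 0")
    case True
    then have "(\<lambda>x'. mode k (x', snd p)) = (\<lambda>_. mode k p)" by (simp add: mode_def)
    then show ?thesis using True by (simp add: average_x_def scaleR_conv_of_real)
  next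
    case False
    have "((\<lambda>x'. pdx (mode k) (x', snd p)) has_integral mode k (2 * pi, snd p) - mode k (0, snd p)) {0..2 * pi}"
      by (rule fundamental_theorem_of_calculus) (auto intro: has_derivative_partial d)
    moreover have "mode k (2 * pi, snd p) = mode k (0, snd p)"
      using periodic_mode[of k] unfolding periodic_def by (metis add_0)
    ultimately have "((\<lambda>x'. \<i> * of_int (fst k) * mode k (x', snd p)) has_integral 0) {0..2 * pi}" by (simp add: pd_mode)
    from integral_unique[OF this] show ?thesis using False by (simp add: average_x_def)
  qed
  show "average_y (mode k) p = (if snd k = 0 then 2 * pi * mode k p else 0)"
  proof (cases "snd k = 0")
    case True
    then have "(\<lambda>y'. mode k (fst p, y')) = (\<lambda>_. mode k p)" by (simp add: mode_def)
    then show ?thesis using True by (simp add: average_y_def scaleR_conv_of_real)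
  next
    case False
    have "((\<lambda>y'. pdy (mode k) (fst p, y')) has_integral mode k (fst p, 2 * pi) - mode k (fst p, 0)) {0..2 * pi}"
      by (rule fundamental_theorem_of_calculus) (auto intro: has_derivative_partial d)
    moreover have "mode k (fst p, 2 * pi) = mode k (fst p, 0)"
      using periodic_mode[of k] unfolding periodic_def by (metis add_0)
    ultimately have "((\<lambda>y'. \<i> * of_int (snd k) * mode k (fst p, y')) has_integral 0) {0..2 * pi}" by (simp add: pd_mode)
    from integral_unique[OF this] show ?thesis using False by (simp add: average_y_def)
  qed
qed

lemma G_fun_eq: "G_fun g1 g2 \<phi> p =
    complex_of_real (g2 (snd p)) * (of_real (1 / (2 * pi)) * \<phi> p - of_real (1 / (2 * pi)\<^sup>2) * average_x \<phi> p) +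
    complex_of_real (g1 (fst p)) * (of_real (1 / (2 * pi)) * \<phi> p - of_real (1 / (2 * pi)\<^sup>2) * average_y \<phi> p)"
  by (cases p) (simp add: G_fun_def G1_def G2_def average_x_def average_y_def)

text \<open>\<open>G1\<close> is 1/(2 pi) times the projection away from the modes that are constant
  in x, and \<open>G2\<close> likewise for y; on a single mode each acts as 0 or as the factor 1/(2
  pi).\<close>

lemma G_fun_mode: "G_fun g1 g2 (mode k) p = of_real (1 / (2 * pi)) *
    ((if fst k = 0 then 0 else complex_of_real (g2 (snd p)) * mode k p) +
     (if snd k = 0 then 0 else complex_of_real (g1 (fst p)) * mode k p))"
  by (simp add: G_fun_eq average_mode power2_eq_square algebra_simps)

lemma average_add:
  assumes "continuous_on UNIV \<phi>" "continuous_on UNIV \<psi>"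
  shows "average_x (\<lambda>p. \<phi> p + \<psi> p) p = average_x \<phi> p + average_x \<psi> p"
    and "average_y (\<lambda>p. \<phi> p + \<psi> p) p = average_y \<phi> p + average_y \<psi> p"
proof -
  have c: "(\<lambda>x. f (x, b)) integrable_on {0..2 * pi}" "(\<lambda>y. f (b, y)) integrable_on {0..2 * pi}"
    if "continuous_on UNIV f" for f :: "real \<times> real \<Rightarrow> complex" and b
    by (rule integrable_continuous_real, rule continuous_on_compose2[OF that, of _ "\<lambda>x. (x, b)"],
        auto intro!: continuous_intros)
      (rule integrable_continuous_real, rule continuous_on_compose2[OF that, of _ "\<lambda>y. (b, y)"],
        auto intro!: continuous_intros)
  show "average_x (\<lambda>p. \<phi> p + \<psi> p) p = average_x \<phi> p + average_x \<psi> p"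
    "average_y (\<lambda>p. \<phi> p + \<psi> p) p = average_y \<phi> p + average_y \<psi> p"
    unfolding average_x_def average_y_def by (intro integral_add c assms)+
qed

text \<open>The functional in the definition of \<open>G\<close> really is a distribution, so that
  the abstraction can be undone: linearity is that of the integral formula, continuity that of
  \<open>G_fun\<close> on test functions.\<close>

lemma pairing_G:
  assumes g: "smooth_real g1" "smooth_real g2"
  shows "pairing (G g1 g2 u) \<phi> = (if test_function \<phi> then pairing u (G_fun g1 g2 \<phi>) else 0)"
proof -
  have op: "test_operator (G_fun g1 g2)" by (rule test_operator_G_fun[OF g])
  then have t: "test_function \<phi> \<Longrightarrow> test_function (G_fun g1 g2 \<phi>)" for \<phi> by (simp add: test_operator_def)
  let ?w = "\<lambda>\<phi>. if test_function \<phi> then pairing u (G_fun g1 g2 \<phi>) else 0"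
  have "is_distribution ?w"
    unfolding is_distribution_def
  proof (intro conjI allI impI)
    fix \<phi> \<psi> assume a: "test_function \<phi>" "test_function \<psi>"
    have "G_fun g1 g2 (\<lambda>p. \<phi> p + \<psi> p) = (\<lambda>p. G_fun g1 g2 \<phi> p + G_fun g1 g2 \<psi> p)"
      using a by (simp add: fun_eq_iff G_fun_eq average_add continuous_test_function algebra_simps add_divide_distrib)
    then show "?w (\<lambda>p. \<phi> p + \<psi> p) = ?w \<phi> + ?w \<psi>"
      using a by (simp add: test_function_add pairing_add t)
  next
    fix c \<phi> assume a: "test_function \<phi>"
    have "G_fun g1 g2 (\<lambda>p. c * \<phi> p) = (\<lambda>p. c * G_fun g1 g2 \<phi> p)"
      by (simp add: fun_eq_iff G_fun_eq average_x_def average_y_def algebra_simps)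
    then show "?w (\<lambda>p. c * \<phi> p) = c * ?w \<phi>"
      using a by (simp add: test_function_cmult pairing_cmult t)
  next
    obtain C N where C: "\<And>\<phi>. test_function \<phi> \<Longrightarrow> norm (pairing u \<phi>) \<le> C * test_seminorm N \<phi>"
      using pairing_bound by blast
    obtain D where D: "\<And>\<phi>. test_function \<phi> \<Longrightarrow> test_seminorm N (G_fun g1 g2 \<phi>) \<le> D * test_seminorm N \<phi>"
      using op unfolding test_operator_def by blast
    have "norm (?w \<phi>) \<le> (\<bar>C\<bar> * D) * test_seminorm N \<phi>" if a: "test_function \<phi>" for \<phi>
    proof -
      have "norm (?w \<phi>) \<le> C * test_seminorm N (G_fun g1 g2 \<phi>)" using C[OF t[OF a]] a by simp
      also have "\<dots> \<le> \<bar>C\<bar> * test_seminorm N (G_fun g1 g2 \<phi>)"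
        by (intro mult_right_mono test_seminorm_mono(1)[OF t[OF a] order_refl]) auto
      also have "\<dots> \<le> \<bar>C\<bar> * (D * test_seminorm N \<phi>)"
        using D[OF a] by (intro mult_left_mono) auto
      finally show ?thesis by (simp add: mult.assoc)
    qed
    then show "\<exists>C N. \<forall>\<phi>. test_function \<phi> \<longrightarrow> norm (?w \<phi>) \<le> C * test_seminorm N \<phi>" by blast
  qed simp
  then show ?thesis unfolding G_def by (simp add: Abs_distribution_inverse)
qed

text \<open>Coefficients over the plane lattice of a profile that depends on x alone; for smooth
  profiles they live on the axis k2 = 0. The companion \<open>gy\<close> lives on the other
  axis.\<close>

definition gx :: "(real \<Rightarrow> real) \<Rightarrow> int \<times> int \<Rightarrow> complex" where
  "gx g = fcoeff (\<lambda>p. complex_of_real (g (fst p)))"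

definition gy :: "(real \<Rightarrow> real) \<Rightarrow> int \<times> int \<Rightarrow> complex" where
  "gy g = fcoeff (\<lambda>p. complex_of_real (g (snd p)))"

text \<open>Row \<open>k\<close> is the output and column \<open>j\<close> the input. Placing the
  conditions on \<open>k\<close> agrees with projecting the input first, because for smooth profiles
  the g2 entry vanishes unless \<open>fst k = fst j\<close>, and the g1 entry unless
  \<open>snd k = snd j\<close>.\<close>

definition G_matrix :: "(real \<Rightarrow> real) \<Rightarrow> (real \<Rightarrow> real) \<Rightarrow> int \<times> int \<Rightarrow> int \<times> int \<Rightarrow> complex" where
  "G_matrix g1 g2 k j = of_real (1 / (2 * pi)) *
     ((if fst k = 0 then 0 else gy g2 (k - j)) + (if snd k = 0 then 0 else gx g1 (k - j)))"

lemma test_function_profile: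
  assumes "smooth_real g"
  shows "test_function (\<lambda>p. complex_of_real (g (fst p)))" "test_function (\<lambda>p. complex_of_real (g (snd p)))"
proof -
  have "test_function (\<lambda>p. complex_of_real (g (fst p)) * mode 0 p)" "test_function (\<lambda>p. complex_of_real (g (snd p)) * mode 0 p)"
    using test_operator_mult_fst[OF assms] test_operator_mult_snd[OF assms] test_function_mode[of 0]
    unfolding test_operator_def by blast+
  then show "test_function (\<lambda>p. complex_of_real (g (fst p)))" "test_function (\<lambda>p. complex_of_real (g (snd p)))"
    by simp_all
qed

text \<open>By duality the k-th coefficient is the pairing of \<open>u\<close> with the operator
  applied to the mode of index -k. Expanding that test function in its Fourier series produces row
  \<open>k\<close> of the matrix.\<close>

lemma fourier_coeff_G:
  assumes g: "smooth_real g1" "smooth_real g2"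
  shows "((\<lambda>j. G_matrix g1 g2 k j * fourier_coeff u j) has_sum fourier_coeff (G g1 g2 u) k) UNIV"
proof -
  let ?c = "complex_of_real (1 / (2 * pi)\<^sup>2)"
  define \<psi> where "\<psi> = G_fun g1 g2 (mode (- k))"
  have t: "test_function \<psi>"
    using test_operator_G_fun[OF g] test_function_mode unfolding test_operator_def \<psi>_def by blast
  have c1: "continuous_on UNIV (\<lambda>p. complex_of_real (g2 (snd p)) * mode (- k) p)"
    "continuous_on UNIV (\<lambda>p. complex_of_real (g1 (fst p)) * mode (- k) p)"
    by (intro continuous_on_mult continuous_mode continuous_test_function test_function_profile g)+
  have fcoeff\<psi>: "fcoeff \<psi> (- j) = G_matrix g1 g2 k j" for j
  proof -
    have 1: "\<psi> = (\<lambda>p. of_real (1 / (2 * pi)) *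
      ((if fst k = 0 then 0 else 1) * (complex_of_real (g2 (snd p)) * mode (- k) p) +
       (if snd k = 0 then 0 else 1) * (complex_of_real (g1 (fst p)) * mode (- k) p)))"
      by (auto simp: \<psi>_def G_fun_mode fun_eq_iff)
    have 2: "fcoeff \<psi> (- j) = of_real (1 / (2 * pi)) *
      ((if fst k = 0 then 0 else 1) * fcoeff (\<lambda>p. complex_of_real (g2 (snd p)) * mode (- k) p) (- j) +
       (if snd k = 0 then 0 else 1) * fcoeff (\<lambda>p. complex_of_real (g1 (fst p)) * mode (- k) p) (- j))"
      unfolding 1
      by (subst fcoeff_cmult, subst fcoeff_add) (simp_all only: fcoeff_cmult continuous_on_mult[OF continuous_on_const c1(1)] continuous_on_mult[OF continuous_on_const c1(2)])
    have "- j - - k = k - j" by simp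
    then show ?thesis unfolding 2 G_matrix_def gx_def gy_def fcoeff_mode_mult by simp
  qed
  have "((\<lambda>l. fcoeff \<psi> l * pairing u (mode l)) has_sum pairing u \<psi>) UNIV"
    by (rule pairing_has_sum[OF t])
  then have "((\<lambda>j. fcoeff \<psi> (- j) * pairing u (mode (- j))) has_sum pairing u \<psi>) UNIV"
    by (subst has_sum_reindex_bij_betw[of uminus UNIV UNIV "\<lambda>l. fcoeff \<psi> l * pairing u (mode l)"]) (auto intro: bij_uminus)
  from has_sum_cmult_right[OF this, of ?c]
  have "((\<lambda>j. G_matrix g1 g2 k j * fourier_coeff u j) has_sum (?c * pairing u \<psi>)) UNIV"
    by (simp add: fourier_coeff_mode fcoeff\<psi> mult_ac)
  moreover have "fourier_coeff (G g1 g2 u) k = ?c * pairing u \<psi>"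
    by (simp add: fourier_coeff_mode pairing_G[OF g] test_function_mode \<psi>_def)
  ultimately show ?thesis by simp
qed

text \<open>The derivative in the missing variable is zero, and on the Fourier side it is
  multiplication by i times the corresponding frequency.\<close>

lemma profile_off_axis:
  assumes "smooth_real g"
  shows "snd n \<noteq> 0 \<Longrightarrow> gx g n = 0" "fst n \<noteq> 0 \<Longrightarrow> gy g n = 0"
proof -
  have z: "pdy (\<lambda>p. complex_of_real (g (fst p))) = (\<lambda>_. 0)" "pdx (\<lambda>p. complex_of_real (g (snd p))) = (\<lambda>_. 0)"
    using coordinate_dir_deriv[OF assms, of _ 0] by (simp_all add: pdx_dir pdy_dir fun_eq_iff)
  have t0: "fcoeff (\<lambda>_. 0) n = 0" by (simp add: fcoeff_def)
  show "gx g n = 0" if "snd n \<noteq> 0"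
    using fcoeff_pd(2)[of "\<lambda>p. complex_of_real (g (fst p))" n] test_function_profile(1)[OF assms]
      coordinate_differentiable(1)[OF assms, of 0] that
    by (simp add: gx_def z test_function_iff t0)
  show "gy g n = 0" if "fst n \<noteq> 0"
    using fcoeff_pd(1)[of "\<lambda>p. complex_of_real (g (snd p))" n] test_function_profile(2)[OF assms]
      coordinate_differentiable(2)[OF assms, of 0] that
    by (simp add: gy_def z test_function_iff t0)
qed

text \<open>Since the profile is non-negative, no coefficient exceeds the one at 0 in modulus, and
  the normalisation of the integral makes that one 1/(2 pi). The last claim holds because the
  profile is real.\<close>

lemma control_profile_coeffs:
  assumes "control_profile g"
  shows "gx g 0 = of_real (1 / (2 * pi))" "gy g 0 = of_real (1 / (2 * pi))"
    and "norm (gx g n) \<le> 1 / (2 * pi)" "norm (gy g n) \<le> 1 / (2 * pi)"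
    and "gy g (- n) = cnj (gy g n)"
proof -
  have g: "smooth_real g" "\<And>x. 0 \<le> g x" "integral {0..2 * pi} g = 1"
    using assms by (auto simp: control_profile_smooth_real) (auto simp: control_profile_def)
  have cg: "continuous_on S (\<lambda>p. complex_of_real (g (fst p)))" "continuous_on S (\<lambda>p. complex_of_real (g (snd p)))" for S
    by (intro continuous_test_function test_function_profile g)+
  have cr: "continuous_on S (\<lambda>p :: real \<times> real. g (fst p))" "continuous_on S (\<lambda>p :: real \<times> real. g (snd p))" for S
    using continuous_on_Re[OF cg(1)] continuous_on_Re[OF cg(2)] by simp_all
  have I: "integral torus (\<lambda>p. g (fst p)) = 2 * pi" "integral torus (\<lambda>p. g (snd p)) = 2 * pi"
    using integral_prod_continuous[of 0 0 "2 * pi" "2 * pi" "\<lambda>p. g (fst p)"]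
      integral_prod_continuous[of 0 0 "2 * pi" "2 * pi" "\<lambda>p. g (snd p)"] cr g(3) by simp_all
  have Ic: "integral torus (\<lambda>p. complex_of_real (f p)) = of_real (integral torus f)" if "continuous_on torus f" for f
    using integral_linear[OF integrable_continuous[OF that] bounded_linear_of_real] by (simp add: o_def)
  show "gx g 0 = of_real (1 / (2 * pi))" "gy g 0 = of_real (1 / (2 * pi))"
    by (simp_all add: gx_def gy_def fcoeff_def Ic cr I power2_eq_square)
  have le: "norm (integral torus (\<lambda>p. complex_of_real (f p) * mode (- n) p)) \<le> integral torus f"
    if f: "continuous_on torus f" "\<And>p. 0 \<le> f p" for f
    by (rule integral_norm_bound_integral)
       (use f in \<open>auto simp: norm_mult intro!: integrable_continuous continuous_intros continuous_mode\<close>)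
  show "norm (gx g n) \<le> 1 / (2 * pi)" "norm (gy g n) \<le> 1 / (2 * pi)"
  proof -
    have "norm (complex_of_real (1 / (2 * pi)\<^sup>2) * z) \<le> 1 / (2 * pi)" if "norm z \<le> 2 * pi" for z
    proof -
      have "1 / (2 * pi)\<^sup>2 * norm z \<le> 1 / (2 * pi)\<^sup>2 * (2 * pi)"
        by (rule mult_left_mono[OF that]) simp
      then show ?thesis unfolding norm_mult norm_of_real by (simp add: power2_eq_square)
    qed
    then show "norm (gx g n) \<le> 1 / (2 * pi)" "norm (gy g n) \<le> 1 / (2 * pi)"
      using le[OF cr(1) g(2)] le[OF cr(2) g(2)] unfolding gx_def gy_def fcoeff_def I by blast+
  qed
  show "gy g (- n) = cnj (gy g n)"
    by (simp add: gy_def fcoeff_def integral_cnj cnj_mode)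
qed

section \<open>Weighted sequence spaces\<close>

definition hs_weight :: "real \<Rightarrow> int \<times> int \<Rightarrow> real" where
  "hs_weight s k = (1 + freq_norm k) powr (2 * s)"

text \<open>Real sequences are used so that the same notion applies to the moduli of Fourier
  coefficients and to the sequences that dominate them.\<close>

definition hs_seq :: "real \<Rightarrow> (int \<times> int \<Rightarrow> real) \<Rightarrow> bool" where
  "hs_seq s x \<longleftrightarrow> (\<lambda>k. hs_weight s k * (x k)\<^sup>2) summable_on UNIV"

definition hs_seq_norm :: "real \<Rightarrow> (int \<times> int \<Rightarrow> real) \<Rightarrow> real" where
  "hs_seq_norm s x = sqrt ((2 * pi)\<^sup>2 * (\<Sum>\<^sub>\<infinity>k. hs_weight s k * (x k)\<^sup>2))"

lemma Hs_iff: "u \<in> Hs s \<longleftrightarrow> hs_seq s (\<lambda>k. norm (fourier_coeff u k))"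
  by (simp add: Hs_def hs_seq_def hs_weight_def)

lemma Hs_norm_eq: "Hs_norm s u = hs_seq_norm s (\<lambda>k. norm (fourier_coeff u k))"
  by (simp add: Hs_norm_def hs_seq_norm_def hs_weight_def)

lemma freq_norm_eq: "freq_norm k = norm (real_of_int (fst k), real_of_int (snd k))"
  by (simp add: freq_norm_def norm_prod_def split_beta)

lemma freq_norm_nonneg [simp]: "0 \<le> freq_norm k"
  by (simp add: freq_norm_eq)

lemma freq_norm_add: "freq_norm (j + k) \<le> freq_norm j + freq_norm k"
  unfolding freq_norm_eq
  using norm_triangle_ineq[of "(real_of_int (fst j), real_of_int (snd j))" "(real_of_int (fst k), real_of_int (snd k))"]
  by simp

lemma hs_weight_nonneg [simp]: "0 \<le> hs_weight s k"
  by (simp add: hs_weight_def)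

lemma hs_weight_ge_1: "0 \<le> s \<Longrightarrow> 1 \<le> hs_weight s k"
  by (simp add: hs_weight_def ge_one_powr_ge_zero)

lemma hs_weight_sqrt: "hs_weight s k = ((1 + freq_norm k) powr s)\<^sup>2"
proof -
  have "0 < 1 + freq_norm k" by (rule add_pos_nonneg) auto
  then show ?thesis by (simp add: hs_weight_def powr_power mult.commute)
qed

lemma hs_seq_norm_nonneg: "0 \<le> hs_seq_norm s x"
  by (simp add: hs_seq_norm_def infsum_nonneg)

lemma
  assumes A: "hs_seq s A" and le: "\<And>k. \<bar>x k\<bar> \<le> A k"
  shows hs_seq_mono: "hs_seq s x" and hs_seq_norm_mono: "hs_seq_norm s x \<le> hs_seq_norm s A"
proof -
  have *: "hs_weight s k * (x k)\<^sup>2 \<le> hs_weight s k * (A k)\<^sup>2" for k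
    using power_mono[OF le[of k], of 2] by (intro mult_left_mono) auto
  show "hs_seq s x"
    unfolding hs_seq_def by (rule summable_on_comparison_test[OF A[unfolded hs_seq_def] *]) auto
  then show "hs_seq_norm s x \<le> hs_seq_norm s A"
    unfolding hs_seq_norm_def
    by (intro real_sqrt_le_mono mult_left_mono infsum_mono *) (use A in \<open>auto simp: hs_seq_def\<close>)
qed

lemma hs_seq_cmult: "hs_seq s x \<Longrightarrow> hs_seq s (\<lambda>k. c * x k)"
  using summable_on_cmult_right[of "\<lambda>k. hs_weight s k * (x k)\<^sup>2" UNIV "c\<^sup>2"]
  by (simp add: hs_seq_def power_mult_distrib mult_ac)

lemma hs_seq_norm_cmult: "hs_seq_norm s (\<lambda>k. c * x k) = \<bar>c\<bar> * hs_seq_norm s x"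
proof -
  have "(\<Sum>\<^sub>\<infinity>k. hs_weight s k * (c * x k)\<^sup>2) = c\<^sup>2 * (\<Sum>\<^sub>\<infinity>k. hs_weight s k * (x k)\<^sup>2)"
    by (simp add: infsum_cmult_right'[symmetric] power_mult_distrib mult_ac)
  then show ?thesis by (simp add: hs_seq_norm_def real_sqrt_mult)
qed

text \<open>Minkowski's inequality on finite sets of indices, followed by passage to the
  limit.\<close>

lemma
  assumes "hs_seq s x" "hs_seq s y"
  shows hs_seq_add: "hs_seq s (\<lambda>k. x k + y k)"
    and hs_seq_norm_add: "hs_seq_norm s (\<lambda>k. x k + y k) \<le> hs_seq_norm s x + hs_seq_norm s y"
proof -
  let ?X = "\<Sum>\<^sub>\<infinity>k. hs_weight s k * (x k)\<^sup>2" and ?Y = "\<Sum>\<^sub>\<infinity>k. hs_weight s k * (y k)\<^sup>2"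
  have fin: "(\<Sum>k\<in>F. hs_weight s k * (x k + y k)\<^sup>2) \<le> (sqrt ?X + sqrt ?Y)\<^sup>2" if F: "finite F" for F
  proof -
    define w where "w k = (1 + freq_norm k) powr s" for k
    have eq: "hs_weight s k * z\<^sup>2 = (w k * z)\<^sup>2" for k z
      by (simp add: hs_weight_sqrt w_def power_mult_distrib)
    have "(\<Sum>k\<in>F. hs_weight s k * (x k + y k)\<^sup>2) = (L2_set (\<lambda>k. w k * x k + w k * y k) F)\<^sup>2"
      unfolding L2_set_def eq by (simp add: sum_nonneg algebra_simps)
    also have "\<dots> \<le> (L2_set (\<lambda>k. w k * x k) F + L2_set (\<lambda>k. w k * y k) F)\<^sup>2"
      by (intro power_mono L2_set_triangle_ineq L2_set_nonneg)
    also have "\<dots> \<le> (sqrt ?X + sqrt ?Y)\<^sup>2"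
    proof (intro power_mono add_mono add_nonneg_nonneg L2_set_nonneg)
      show "L2_set (\<lambda>k. w k * x k) F \<le> sqrt ?X" "L2_set (\<lambda>k. w k * y k) F \<le> sqrt ?Y"
        unfolding L2_set_def eq[symmetric] using assms F
        by (auto intro!: finite_sum_le_infsum simp: hs_seq_def)
    qed
    finally show ?thesis .
  qed
  have s: "(\<lambda>k. hs_weight s k * (x k + y k)\<^sup>2) summable_on UNIV"
    by (rule nonneg_bdd_above_summable_on) (auto intro!: bdd_aboveI2[OF fin])
  then show "hs_seq s (\<lambda>k. x k + y k)" by (simp add: hs_seq_def)
  have "(\<Sum>\<^sub>\<infinity>k. hs_weight s k * (x k + y k)\<^sup>2) \<le> (sqrt ?X + sqrt ?Y)\<^sup>2"
    by (rule infsum_le_finite_sums[OF s fin])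
  then have "sqrt (\<Sum>\<^sub>\<infinity>k. hs_weight s k * (x k + y k)\<^sup>2) \<le> sqrt ?X + sqrt ?Y"
    by (intro real_le_lsqrt add_nonneg_nonneg) (auto intro: infsum_nonneg)
  then have "2 * pi * sqrt (\<Sum>\<^sub>\<infinity>k. hs_weight s k * (x k + y k)\<^sup>2) \<le> 2 * pi * (sqrt ?X + sqrt ?Y)"
    by (intro mult_left_mono) auto
  then show "hs_seq_norm s (\<lambda>k. x k + y k) \<le> hs_seq_norm s x + hs_seq_norm s y"
    by (simp add: hs_seq_norm_def real_sqrt_mult distrib_left)
qed

lemma hs_seq_norm_ge:
  assumes "0 \<le> s" "hs_seq s x"
  shows "\<bar>x k\<bar> \<le> hs_seq_norm s x"
proof -
  have "(x k)\<^sup>2 \<le> hs_weight s k * (x k)\<^sup>2"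
    using mult_right_mono[OF hs_weight_ge_1[OF assms(1)], of "(x k)\<^sup>2" k] by simp
  also have "\<dots> = (\<Sum>k\<in>{k}. hs_weight s k * (x k)\<^sup>2)" by simp
  also have "\<dots> \<le> (\<Sum>\<^sub>\<infinity>k. hs_weight s k * (x k)\<^sup>2)"
    by (rule finite_sum_le_infsum) (use assms in \<open>auto simp: hs_seq_def\<close>)
  also have "\<dots> \<le> (2 * pi)\<^sup>2 * (\<Sum>\<^sub>\<infinity>k. hs_weight s k * (x k)\<^sup>2)"
  proof -
    have "1\<^sup>2 \<le> (2 * pi)\<^sup>2" using pi_gt3 by (intro power_mono) auto
    then show ?thesis
      using mult_right_mono[of 1 "(2 * pi)\<^sup>2" "\<Sum>\<^sub>\<infinity>k. hs_weight s k * (x k)\<^sup>2"]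
      by (simp add: infsum_nonneg)
  qed
  finally show ?thesis unfolding hs_seq_norm_def by (simp add: real_le_rsqrt)
qed

text \<open>The weight depends only on the length of the index. The reflection of k2 arises because
  a mode and its mirror image have the same eigenvalue and are mixed when the resonant blocks are
  inverted.\<close>

lemma hs_seq_mirror:
  assumes "hs_seq s x"
  shows "hs_seq s (\<lambda>k. x (fst k, - snd k))"
    and "hs_seq_norm s (\<lambda>k. x (fst k, - snd k)) = hs_seq_norm s x"
proof -
  have b: "bij_betw (\<lambda>k :: int \<times> int. (fst k, - snd k)) UNIV UNIV"
    by (rule bij_betw_byWitness[where f' = "\<lambda>k. (fst k, - snd k)"]) auto
  have w: "hs_weight s (fst k, - snd k) = hs_weight s k" for k
    by (simp add: hs_weight_def freq_norm_def split_beta)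
  show "hs_seq s (\<lambda>k. x (fst k, - snd k))"
    using summable_on_reindex_bij_betw[OF b, of "\<lambda>k. hs_weight s k * (x k)\<^sup>2"] assms
    by (simp add: hs_seq_def w)
  show "hs_seq_norm s (\<lambda>k. x (fst k, - snd k)) = hs_seq_norm s x"
    using infsum_reindex_bij_betw[OF b, of "\<lambda>k. hs_weight s k * (x k)\<^sup>2"]
    by (simp add: hs_seq_norm_def w)
qed

text \<open>Stated for an arbitrary filter, to serve both sequences of approximations and limits in
  time.\<close>

lemma hs_dominated_convergence:
  assumes A: "hs_seq s A"
    and dom: "\<forall>\<^sub>F i in F. \<forall>k. \<bar>x i k\<bar> \<le> A k"
    and lim: "\<And>k. ((\<lambda>i. x i k) \<longlongrightarrow> 0) F"
  shows "((\<lambda>i. hs_seq_norm s (x i)) \<longlongrightarrow> 0) F"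
proof -
  let ?a = "\<lambda>k. hs_weight s k * (A k)\<^sup>2"
  let ?f = "\<lambda>i. \<Sum>\<^sub>\<infinity>k. hs_weight s k * (x i k)\<^sup>2"
  have sa: "?a summable_on UNIV" using A by (simp add: hs_seq_def)
  have "(?f \<longlongrightarrow> 0) F"
  proof (rule tendstoI)
    fix e :: real assume e: "0 < e"
    from has_sum_infsum[OF sa] have "(sum ?a \<longlongrightarrow> infsum ?a UNIV) (finite_subsets_at_top UNIV)"
      by (simp add: has_sum_def)
    then have "\<forall>\<^sub>F S in finite_subsets_at_top UNIV. dist (sum ?a S) (infsum ?a UNIV) < e / 2"
      using e by (intro tendstoD) auto
    \<comment> \<open>Outside the finite set \<open>S\<close> the majorant contributes less than e/2
      for all indices at once; inside, finitely many terms tend to 0.\<close>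
    then obtain S where S: "finite S" "dist (sum ?a S) (infsum ?a UNIV) < e / 2"
      unfolding eventually_finite_subsets_at_top by blast
    have "((\<lambda>i. \<Sum>k\<in>S. hs_weight s k * (x i k)\<^sup>2) \<longlongrightarrow> (\<Sum>k\<in>S. hs_weight s k * 0\<^sup>2)) F"
      by (intro tendsto_intros lim)
    then have "\<forall>\<^sub>F i in F. (\<Sum>k\<in>S. hs_weight s k * (x i k)\<^sup>2) < e / 2"
      using e by (intro order_tendstoD) auto
    with dom show "\<forall>\<^sub>F i in F. dist (?f i) 0 < e"
    proof eventually_elim
      case (elim i)
      have sx: "(\<lambda>k. hs_weight s k * (x i k)\<^sup>2) summable_on UNIV"
        using hs_seq_mono[OF A, of "x i"] elim by (simp add: hs_seq_def)
      have le: "hs_weight s k * (x i k)\<^sup>2 \<le> ?a k" for k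
        using power_mono[OF elim(1)[rule_format, of k], of 2] by (intro mult_left_mono) auto
      have "?f i - (\<Sum>k\<in>S. hs_weight s k * (x i k)\<^sup>2) = (\<Sum>\<^sub>\<infinity>k\<in>UNIV - S. hs_weight s k * (x i k)\<^sup>2)"
        using infsum_Diff[OF sx, of S] S(1) by simp
      also have "\<dots> \<le> (\<Sum>\<^sub>\<infinity>k\<in>UNIV - S. ?a k)"
        by (intro infsum_mono summable_on_subset_banach[OF sx] summable_on_subset_banach[OF sa] le) auto
      also have "\<dots> = infsum ?a UNIV - sum ?a S"
        using infsum_Diff[OF sa, of S] S(1) by simp
      also have "\<dots> < e / 2" using S(2) unfolding dist_real_def by linarith
      finally have "?f i < e" using elim by linarith
      moreover have "0 \<le> ?f i" by (intro infsum_nonneg) auto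
      ultimately show ?case by (simp add: dist_real_def)
    qed
  qed
  then have "((\<lambda>i. sqrt ((2 * pi)\<^sup>2 * ?f i)) \<longlongrightarrow> sqrt ((2 * pi)\<^sup>2 * 0)) F"
    by (intro tendsto_real_sqrt tendsto_mult tendsto_const)
  then show ?thesis by (simp add: hs_seq_norm_def)
qed

section \<open>Young's inequality and convolution in the weighted spaces\<close>

lemma young_l2:
  fixes D a :: "int \<times> int \<Rightarrow> real"
  assumes D: "D summable_on UNIV" "\<And>n. 0 \<le> D n" and a: "(\<lambda>k. (a k)\<^sup>2) summable_on UNIV" "\<And>k. 0 \<le> a k"
  shows "(\<lambda>j. D (k - j) * a j) summable_on UNIV"
    and "(\<lambda>k. (\<Sum>\<^sub>\<infinity>j. D (k - j) * a j)\<^sup>2) summable_on UNIV"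
proof -
  let ?G = "infsum D UNIV"
  have b1: "bij_betw (\<lambda>k. k - j) UNIV UNIV" for j :: "int \<times> int"
    by (rule bij_betw_byWitness[where f' = "\<lambda>k. k + j"]) auto
  have b2: "bij_betw (\<lambda>j. k - j) UNIV UNIV" for k :: "int \<times> int"
    by (rule bij_betw_byWitness[where f' = "\<lambda>j. k - j"]) auto
  have hs1: "((\<lambda>k. D (k - j)) has_sum ?G) UNIV" for j
    using has_sum_reindex_bij_betw[OF b1, of D] has_sum_infsum[OF D(1)] by simp
  have hs2: "((\<lambda>j. D (k - j)) has_sum ?G) UNIV" for k
    using has_sum_reindex_bij_betw[OF b2, of D] has_sum_infsum[OF D(1)] by simp
  have "(\<lambda>(j, k). D (k - j) * (a j)\<^sup>2) summable_on UNIV \<times> UNIV"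
    by (rule summable_on_SigmaI[where g = "\<lambda>j. ?G * (a j)\<^sup>2"])
       (auto intro!: has_sum_cmult_left hs1 summable_on_cmult_right a mult_nonneg_nonneg D(2))
  then have sw: "(\<lambda>(k, j). D (k - j) * (a j)\<^sup>2) summable_on UNIV \<times> UNIV"
    by (subst summable_on_swap) (simp add: case_prod_unfold)
  have row: "(\<lambda>j. D (k - j) * (a j)\<^sup>2) summable_on UNIV" for k
    using summable_on_SigmaD1[OF sw, of k] by simp
  have rows: "(\<lambda>k. \<Sum>\<^sub>\<infinity>j. D (k - j) * (a j)\<^sup>2) summable_on UNIV"
    using summable_on_Sigma_banach[OF sw] by simp
  have s: "(\<lambda>j. D (k - j) * a j) summable_on UNIV" for k
  proof (rule summable_on_comparison_test)
    show "(\<lambda>j. D (k - j) + D (k - j) * (a j)\<^sup>2) summable_on UNIV"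
      by (intro summable_on_add row has_sum_imp_summable[OF hs2])
    show "D (k - j) * a j \<le> D (k - j) + D (k - j) * (a j)\<^sup>2" for j
    proof -
      have "a j \<le> 1 + (a j)\<^sup>2" using sum_squares_ge_zero[of "a j - 1" "a j"] a(2)[of j]
        by (simp add: power2_eq_square algebra_simps)
      from mult_left_mono[OF this D(2)[of "k - j"]] show ?thesis by (simp add: distrib_left)
    qed
  qed (simp add: D a)
  then show "(\<lambda>j. D (k - j) * a j) summable_on UNIV" .
  have le: "(\<Sum>\<^sub>\<infinity>j. D (k - j) * a j)\<^sup>2 \<le> ?G * (\<Sum>\<^sub>\<infinity>j. D (k - j) * (a j)\<^sup>2)" for k
  proof -
    let ?W = "\<Sum>\<^sub>\<infinity>j. D (k - j) * (a j)\<^sup>2"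
    have nn: "0 \<le> ?G" "0 \<le> ?W" by (intro infsum_nonneg; simp add: D a)+
    have "(\<Sum>j\<in>F. D (k - j) * a j) \<le> sqrt (?G * ?W)" if F: "finite F" for F
    proof (rule real_le_rsqrt)
      \<comment> \<open>Half of the kernel goes to each factor in the Cauchy-Schwarz inequality; one
        factor is then the l1 norm of \<open>D\<close>, the other a convolution of \<open>D\<close>
        with the squares.\<close>
      have e: "D (k - j) * a j = sqrt (D (k - j)) * (sqrt (D (k - j)) * a j)" for j
        using D(2) by (simp add: mult.assoc[symmetric])
      have "(\<Sum>j\<in>F. D (k - j) * a j)\<^sup>2 \<le> (\<Sum>j\<in>F. (sqrt (D (k - j)))\<^sup>2) * (\<Sum>j\<in>F. (sqrt (D (k - j)) * a j)\<^sup>2)"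
        unfolding e by (rule Cauchy_Schwarz_ineq_sum)
      also have "\<dots> = (\<Sum>j\<in>F. D (k - j)) * (\<Sum>j\<in>F. D (k - j) * (a j)\<^sup>2)"
        by (simp add: D power_mult_distrib)
      also have "\<dots> \<le> ?G * ?W"
      proof (intro mult_mono)
        have "(\<Sum>j\<in>F. D (k - j)) \<le> (\<Sum>\<^sub>\<infinity>j. D (k - j))"
          by (rule finite_sum_le_infsum[OF has_sum_imp_summable[OF hs2] F]) (auto simp: D)
        then show "(\<Sum>j\<in>F. D (k - j)) \<le> ?G" using infsumI[OF hs2] by simp
        show "(\<Sum>j\<in>F. D (k - j) * (a j)\<^sup>2) \<le> ?W"
          by (rule finite_sum_le_infsum[OF row F]) (auto simp: D)
      qed (auto intro!: sum_nonneg nn simp: D)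
      finally show "(\<Sum>j\<in>F. D (k - j) * a j)\<^sup>2 \<le> ?G * ?W" .
    qed
    then have "(\<Sum>\<^sub>\<infinity>j. D (k - j) * a j) \<le> sqrt (?G * ?W)"
      by (intro infsum_le_finite_sums[OF s]) auto
    moreover have "0 \<le> (\<Sum>\<^sub>\<infinity>j. D (k - j) * a j)" by (intro infsum_nonneg) (simp add: D a)
    ultimately have "(\<Sum>\<^sub>\<infinity>j. D (k - j) * a j)\<^sup>2 \<le> (sqrt (?G * ?W))\<^sup>2" by (rule power_mono)
    then show ?thesis using nn by simp
  qed
  show "(\<lambda>k. (\<Sum>\<^sub>\<infinity>j. D (k - j) * a j)\<^sup>2) summable_on UNIV"
    by (rule summable_on_comparison_test[OF summable_on_cmult_right[OF rows] le]) auto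
qed

text \<open>For s \<ge> 0 the weight is submultiplicative, w(k) \<le> w(k - j) w(j), so it can be
  distributed over kernel and sequence; what remains is the unweighted inequality.\<close>

lemma hs_convolution:
  assumes s: "0 \<le> s" and D: "(\<lambda>n. D n * (1 + freq_norm n) powr s) summable_on UNIV" "\<And>n. 0 \<le> D n"
    and a: "hs_seq s a" "\<And>k. 0 \<le> a k"
  shows "(\<lambda>j. D (k - j) * a j) summable_on UNIV"
    and "hs_seq s (\<lambda>k. \<Sum>\<^sub>\<infinity>j. D (k - j) * a j)"
proof -
  define w where "w k = (1 + freq_norm k) powr s" for k
  have w1: "1 \<le> w k" for k using s by (simp add: w_def ge_one_powr_ge_zero)
  then have w0: "0 \<le> w k" for k using order_trans zero_le_one by blast
  have ww: "w k \<le> w (k - j) * w j" for k j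
  proof -
    have "freq_norm k \<le> freq_norm (k - j) + freq_norm j" using freq_norm_add[of "k - j" j] by simp
    moreover have "0 \<le> freq_norm (k - j) * freq_norm j" by simp
    moreover have "(1 + freq_norm (k - j)) * (1 + freq_norm j) =
        1 + freq_norm (k - j) + freq_norm j + freq_norm (k - j) * freq_norm j"
      by (simp add: algebra_simps)
    ultimately have "1 + freq_norm k \<le> (1 + freq_norm (k - j)) * (1 + freq_norm j)"
      by linarith
    then have "w k \<le> ((1 + freq_norm (k - j)) * (1 + freq_norm j)) powr s"
      unfolding w_def using s by (intro powr_mono2) auto
    then show ?thesis by (simp add: w_def powr_mult)
  qed
  define D' where "D' n = D n * w n" for n
  define a' where "a' k = w k * a k" for k
  have D': "D' summable_on UNIV" "\<And>n. 0 \<le> D' n" using D w0 by (auto simp: D'_def[abs_def] w_def)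
  have a': "(\<lambda>k. (a' k)\<^sup>2) summable_on UNIV" "\<And>k. 0 \<le> a' k"
    using a w0 by (auto simp: a'_def hs_seq_def hs_weight_sqrt w_def power_mult_distrib)
  note Y = young_l2[OF D' a']
  have le: "w k * (D (k - j) * a j) \<le> D' (k - j) * a' j" for k j
    using mult_right_mono[OF ww[of k j], of "D (k - j) * a j"] D(2) a(2) by (simp add: D'_def a'_def mult_ac)
  have sk: "(\<lambda>j. D (k - j) * a j) summable_on UNIV" for k
  proof (rule summable_on_comparison_test[OF Y(1)[of k]])
    show "D (k - j) * a j \<le> D' (k - j) * a' j" for j
      using le[of k j] mult_right_mono[OF w1[of k], of "D (k - j) * a j"] D(2) a(2) by simp
  qed (simp add: D a)
  then show "(\<lambda>j. D (k - j) * a j) summable_on UNIV" .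
  show "hs_seq s (\<lambda>k. \<Sum>\<^sub>\<infinity>j. D (k - j) * a j)"
    unfolding hs_seq_def
  proof (rule summable_on_comparison_test[OF Y(2)])
    fix k
    have nn: "0 \<le> (\<Sum>\<^sub>\<infinity>j. D (k - j) * a j)" by (intro infsum_nonneg) (simp add: D a)
    have "w k * (\<Sum>\<^sub>\<infinity>j. D (k - j) * a j) = (\<Sum>\<^sub>\<infinity>j. w k * (D (k - j) * a j))"
      by (simp add: infsum_cmult_right')
    also have "\<dots> \<le> (\<Sum>\<^sub>\<infinity>j. D' (k - j) * a' j)"
      by (rule infsum_mono[OF summable_on_cmult_right[OF sk] Y(1) le])
    finally have "(w k * (\<Sum>\<^sub>\<infinity>j. D (k - j) * a j))\<^sup>2 \<le> (\<Sum>\<^sub>\<infinity>j. D' (k - j) * a' j)\<^sup>2"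
      using w0 nn by (intro power_mono) auto
    then show "hs_weight s k * (\<Sum>\<^sub>\<infinity>j. D (k - j) * a j)\<^sup>2 \<le> (\<Sum>\<^sub>\<infinity>j. D' (k - j) * a' j)\<^sup>2"
      by (simp add: hs_weight_sqrt w_def power_mult_distrib)
  qed auto
qed

text \<open>The weight is at most a polynomial of some degree \<open>M\<close>, and coefficients of
  test functions absorb every such degree and still leave the factor \<open>decay\<close>.\<close>

lemma fcoeff_weight_summable:
  assumes t: "test_function \<phi>"
  shows "(\<lambda>k. norm (fcoeff \<phi> k) * (1 + freq_norm k) powr s) summable_on UNIV"
proof -
  obtain M :: nat where M: "s \<le> real M" using real_arch_simple by blast
  have q: "(1 + x) ^ M \<le> 2 ^ M * (1 + x ^ M)" if x: "0 \<le> x" for x :: real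
  proof -
    have "(1 + x) ^ M \<le> (2 * max 1 x) ^ M" using x by (intro power_mono) auto
    also have "\<dots> = 2 ^ M * max 1 x ^ M" by (simp add: power_mult_distrib)
    also have "max 1 x ^ M \<le> 1 + x ^ M" using x by (auto simp: max_def)
    finally show ?thesis by simp
  qed
  show ?thesis
  proof (rule summable_on_comparison_test[OF summable_on_cmult_right[OF summable_decay, of "4 ^ M * (16 * test_seminorm (M + 2) \<phi>)"]])
    fix k :: "int \<times> int"
    define x y where "x = \<bar>real_of_int (fst k)\<bar>" and "y = \<bar>real_of_int (snd k)\<bar>"
    have xy: "0 \<le> x" "0 \<le> y" by (simp_all add: x_def y_def)
    have "freq_norm k \<le> x + y"
      using norm_Pair_le[of "real_of_int (fst k)" "real_of_int (snd k)"] by (simp add: freq_norm_eq x_def y_def)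
    then have "1 + freq_norm k \<le> (1 + x) * (1 + y)"
      using mult_nonneg_nonneg[OF xy] by (simp add: algebra_simps)
    then have "(1 + freq_norm k) ^ M \<le> ((1 + x) * (1 + y)) ^ M"
      by (intro power_mono) auto
    also have "\<dots> = (1 + x) ^ M * (1 + y) ^ M" by (simp add: power_mult_distrib)
    also have "\<dots> \<le> (2 ^ M * (1 + x ^ M)) * (2 ^ M * (1 + y ^ M))"
      using xy by (intro mult_mono q) auto
    also have "\<dots> = 4 ^ M * ((1 + x ^ M) * (1 + y ^ M))"
      by (simp add: power_mult_distrib[symmetric] mult_ac)
    finally have "(1 + freq_norm k) ^ M \<le> 4 ^ M * ((1 + x ^ M) * (1 + y ^ M))" .
    moreover have "(1 + freq_norm k) powr s \<le> (1 + freq_norm k) ^ M"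
    proof -
      have "(1 + freq_norm k) powr s \<le> (1 + freq_norm k) powr real M"
        using M by (intro powr_mono) auto
      also have "\<dots> = (1 + freq_norm k) ^ M" by (rule powr_realpow) (simp add: add_pos_nonneg)
      finally show ?thesis .
    qed
    ultimately have "(1 + freq_norm k) powr s \<le> 4 ^ M * ((1 + x ^ M) * (1 + y ^ M))" by linarith
    then have "norm (fcoeff \<phi> k) * (1 + freq_norm k) powr s \<le> norm (fcoeff \<phi> k) * (4 ^ M * ((1 + x ^ M) * (1 + y ^ M)))"
      by (intro mult_left_mono) auto
    also have "\<dots> = 4 ^ M * ((1 + x ^ M) * (1 + y ^ M) * norm (fcoeff \<phi> k))" by (simp add: mult_ac)
    also have "\<dots> \<le> 4 ^ M * (16 * test_seminorm (M + 2) \<phi> * decay k)"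
      unfolding x_def y_def by (intro mult_left_mono fcoeff_decay[OF t]) auto
    finally show "norm (fcoeff \<phi> k) * (1 + freq_norm k) powr s \<le> 4 ^ M * (16 * test_seminorm (M + 2) \<phi>) * decay k"
      by (simp add: mult.assoc)
  qed auto
qed

lemma G_matrix_convolution_bound:
  assumes g: "smooth_real g1" "smooth_real g2"
  obtains D where "\<And>k j. norm (G_matrix g1 g2 k j) \<le> D (k - j)" "\<And>n. 0 \<le> D n"
    "\<And>s. (\<lambda>n. D n * (1 + freq_norm n) powr s) summable_on UNIV"
proof
  let ?D = "\<lambda>n. norm (gy g2 n) + norm (gx g1 n)"
  show "norm (G_matrix g1 g2 k j) \<le> ?D (k - j)" for k j
  proof -
    define z where "z = (if fst k = 0 then 0 else gy g2 (k - j)) + (if snd k = 0 then 0 else gx g1 (k - j))"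
    have "norm z \<le> ?D (k - j)" by (auto simp: z_def norm_triangle_ineq)
    moreover have "norm (G_matrix g1 g2 k j) = 1 / (2 * pi) * norm z"
      by (simp add: G_matrix_def z_def norm_mult norm_divide)
    moreover have "1 / (2 * pi) * norm z \<le> 1 * norm z"
      using pi_gt3 by (intro mult_right_mono) auto
    ultimately show ?thesis by simp
  qed
  show "(\<lambda>n. ?D n * (1 + freq_norm n) powr s) summable_on UNIV" for s
    unfolding distrib_right gx_def gy_def
    by (intro summable_on_add fcoeff_weight_summable test_function_profile g)
qed auto

section \<open>Bochner integrals in Sobolev spaces\<close>

lemma fourier_coeff_linear: "linear (\<lambda>u. fourier_coeff u k)"
  by (rule linearI) (simp_all add: fourier_coeff_mode plus_distribution.rep_eq scaleR_distribution.rep_eq distrib_left)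

lemma fourier_coeff_diff: "fourier_coeff (u - v) k = fourier_coeff u k - fourier_coeff v k"
  using linear_diff[OF fourier_coeff_linear] .

text \<open>The distribution with the given coefficients: there is never more than one, and there is
  one when the coefficients are bounded, as are all sequences of the weighted space for s \<ge>
  0.\<close>

definition of_coeffs :: "(int \<times> int \<Rightarrow> complex) \<Rightarrow> distribution" where
  "of_coeffs c = (SOME u. fourier_coeff u = c)"

lemma fourier_coeff_of_coeffs_bounded:
  assumes "\<And>k. norm (c k) \<le> B"
  shows "fourier_coeff (of_coeffs c) = c"
  unfolding of_coeffs_def using bounded_fourier_coeffs_exist[of c, OF assms] by (rule someI_ex)

lemma fourier_coeff_of_coeffs:
  assumes "0 \<le> s" "hs_seq s (\<lambda>k. norm (c k))"
  shows "fourier_coeff (of_coeffs c) = c"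
  using hs_seq_norm_ge[OF assms] by (intro fourier_coeff_of_coeffs_bounded) auto

lemma norm_fourier_coeff_le:
  assumes "0 \<le> s" "u \<in> Hs s"
  shows "norm (fourier_coeff u k) \<le> Hs_norm s u"
  using hs_seq_norm_ge[OF assms(1), of "\<lambda>k. norm (fourier_coeff u k)" k] assms(2) by (simp add: Hs_iff Hs_norm_eq)

lemma Hs_diff: "u \<in> Hs s \<Longrightarrow> v \<in> Hs s \<Longrightarrow> u - v \<in> Hs s"
  unfolding Hs_iff
  by (rule hs_seq_mono[OF hs_seq_add[of s "\<lambda>k. norm (fourier_coeff u k)" "\<lambda>k. norm (fourier_coeff v k)"]])
     (auto simp: fourier_coeff_diff norm_triangle_ineq4)

text \<open>Shows that the description in \<open>fourier_multiplier\<close> denotes: the product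
  sequence has a distribution by the boundedness criterion, and uniqueness is injectivity of the
  Fourier coefficients.\<close>

lemma fourier_coeff_multiplier:
  assumes u: "0 \<le> s" "u \<in> Hs s" and m: "\<And>k. norm (m k) \<le> 1"
  shows "fourier_coeff (fourier_multiplier m u) k = m k * fourier_coeff u k"
proof -
  have "hs_seq s (\<lambda>k. norm (m k * fourier_coeff u k))"
    using u(2) m unfolding Hs_iff by (elim hs_seq_mono) (simp add: norm_mult mult_left_le_one_le)
  from fourier_coeff_of_coeffs[OF u(1) this]
  have "\<exists>!v. \<forall>k. fourier_coeff v k = m k * fourier_coeff u k"
    by (intro ex1I[of _ "of_coeffs (\<lambda>k. m k * fourier_coeff u k)"]) (auto intro!: fourier_coeff_inject)
  from theI'[OF this] show ?thesis unfolding fourier_multiplier_def by blast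
qed

lemma fourier_coeff_propagator:
  assumes "0 \<le> s" "u \<in> Hs s"
  shows "fourier_coeff (propagator b t u) k = exp (\<i> * complex_of_real (eigen_freq b k * t)) * fourier_coeff u k"
  unfolding propagator_def by (rule fourier_coeff_multiplier[OF assms]) (simp only: norm_exp_i_times)

text \<open>Each coefficient is continuous in time and one time-independent sequence of the weighted
  space bounds them all. The control, its image under \<open>G\<close> and the evolved forcing have
  this form, and it reduces statements about functions with values in Sobolev spaces to scalar
  ones.\<close>

definition dominated_family :: "real \<Rightarrow> real \<Rightarrow> (int \<times> int \<Rightarrow> real) \<Rightarrow> (real \<Rightarrow> int \<times> int \<Rightarrow> complex) \<Rightarrow> bool" where
  "dominated_family s T A c \<longleftrightarrow> hs_seq s A \<and> (\<forall>t\<in>{0..T}. \<forall>k. norm (c t k) \<le> A k) \<and>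
     (\<forall>k. continuous_on {0..T} (\<lambda>t. c t k))"

lemma dominated_familyD:
  assumes "dominated_family s T A c"
  shows "hs_seq s A" "t \<in> {0..T} \<Longrightarrow> norm (c t k) \<le> A k" "continuous_on {0..T} (\<lambda>t. c t k)"
  using assms unfolding dominated_family_def by blast+

lemma dominated_Hs:
  assumes d: "dominated_family s T A c" and t: "t \<in> {0..T}" "fourier_coeff u = c t"
  shows "u \<in> Hs s" "Hs_norm s u \<le> hs_seq_norm s A"
proof -
  have A: "hs_seq s A" and le: "\<bar>norm (fourier_coeff u k)\<bar> \<le> A k" for k
    using dominated_familyD[OF d] t by simp_all
  show "u \<in> Hs s" "Hs_norm s u \<le> hs_seq_norm s A"
    unfolding Hs_iff Hs_norm_eq using hs_seq_mono[OF A le] hs_seq_norm_mono[OF A le] by auto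
qed

lemma dominated_C_Hs:
  assumes d: "dominated_family s T A c" and f: "\<And>t. t \<in> {0..T} \<Longrightarrow> fourier_coeff (f t) = c t"
  shows "f \<in> C_Hs T s"
  unfolding C_Hs_def
proof (intro CollectI ballI conjI)
  fix t assume t: "t \<in> {0..T}"
  show "f t \<in> Hs s" by (rule dominated_Hs[OF d t f[OF t]])
  have A: "hs_seq s A" and le: "\<And>t k. t \<in> {0..T} \<Longrightarrow> norm (c t k) \<le> A k"
    and cont: "\<And>k. continuous_on {0..T} (\<lambda>t. c t k)"
    using dominated_familyD[OF d] by blast+
  have "((\<lambda>\<tau>. hs_seq_norm s (\<lambda>k. norm (fourier_coeff (f \<tau> - f t) k))) \<longlongrightarrow> 0) (at t within {0..T})"
  proof (rule hs_dominated_convergence[OF hs_seq_cmult[OF A, of 2]])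
    have *: "\<bar>norm (fourier_coeff (f \<tau> - f t) k)\<bar> \<le> 2 * A k" if "\<tau> \<in> {0..T}" for \<tau> k
      using norm_triangle_ineq4[of "c \<tau> k" "c t k"] le[OF that, of k] le[OF t, of k] f[OF that] f[OF t]
      by (simp add: fourier_coeff_diff)
    show "\<forall>\<^sub>F \<tau> in at t within {0..T}. \<forall>k. \<bar>norm (fourier_coeff (f \<tau> - f t) k)\<bar> \<le> 2 * A k"
      unfolding eventually_at_filter by (rule always_eventually) (use * in blast)
    fix k
    have "((\<lambda>\<tau>. norm (c \<tau> k - c t k)) \<longlongrightarrow> 0) (at t within {0..T})"
      using cont[of k] t by (simp add: continuous_on tendsto_norm_zero LIM_zero)
    moreover have "\<forall>\<^sub>F \<tau> in at t within {0..T}. norm (c \<tau> k - c t k) = norm (fourier_coeff (f \<tau> - f t) k)"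
      unfolding eventually_at_filter by (rule always_eventually) (use f f[OF t] in \<open>auto simp: fourier_coeff_diff\<close>)
    ultimately show "((\<lambda>\<tau>. norm (fourier_coeff (f \<tau> - f t) k)) \<longlongrightarrow> 0) (at t within {0..T})"
      using tendsto_cong by force
  qed
  then show "((\<lambda>\<tau>. Hs_norm s (f \<tau> - f t)) \<longlongrightarrow> 0) (at t within {0..T})"
    by (simp add: Hs_norm_eq)
qed

text \<open>The squared norm is a series of continuous functions of time that the majorant makes
  uniformly convergent.\<close>

lemma dominated_Hs_norm_continuous:
  assumes d: "dominated_family s T A c" and f: "\<And>t. t \<in> {0..T} \<Longrightarrow> fourier_coeff (f t) = c t"
  shows "continuous_on {0..T} (\<lambda>t. (Hs_norm s (f t))\<^sup>2)"
proof -
  have A: "(\<lambda>k. hs_weight s k * (A k)\<^sup>2) summable_on UNIV" and le: "\<And>t k. t \<in> {0..T} \<Longrightarrow> norm (c t k) \<le> A k"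
    and cont: "\<And>k. continuous_on {0..T} (\<lambda>t. c t k)"
    using dominated_familyD[OF d] by (simp_all only: hs_seq_def)
  have "continuous_on {0..T} (\<lambda>t. (2 * pi)\<^sup>2 * (\<Sum>\<^sub>\<infinity>k. hs_weight s k * (norm (c t k))\<^sup>2))"
  proof (intro continuous_on_mult_left continuous_on_infsum[OF _ A])
    fix t k assume "t \<in> {0..T}"
    from power_mono[OF le[OF this], of k 2]
    show "norm (hs_weight s k * (norm (c t k))\<^sup>2) \<le> hs_weight s k * (A k)\<^sup>2"
      by (simp add: mult_left_mono)
  qed (intro continuous_intros cont)
  moreover have "(2 * pi)\<^sup>2 * (\<Sum>\<^sub>\<infinity>k. hs_weight s k * (norm (c t k))\<^sup>2) = (Hs_norm s (f t))\<^sup>2" if "t \<in> {0..T}" for t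
    using f[OF that] by (simp add: Hs_norm_eq hs_seq_norm_def infsum_nonneg)
  ultimately show ?thesis by (simp cong: continuous_on_cong_simp)
qed

section \<open>Step functions in time and the Bochner integral\<close>

definition grid :: "nat \<Rightarrow> real \<Rightarrow> real" where
  "grid n t = real_of_int \<lfloor>t * real (Suc n)\<rfloor> / real (Suc n)"

lemma grid_bounds: "0 \<le> t \<Longrightarrow> 0 \<le> grid n t" "grid n t \<le> t" "\<bar>t - grid n t\<bar> \<le> 1 / real (Suc n)"
proof -
  have "real_of_int \<lfloor>t * real (Suc n)\<rfloor> \<le> t * real (Suc n)" "t * real (Suc n) \<le> real_of_int \<lfloor>t * real (Suc n)\<rfloor> + 1"
    by linarith+
  then have "grid n t \<le> t" "t \<le> grid n t + 1 / real (Suc n)"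
    unfolding grid_def by (simp_all add: divide_le_eq add_divide_distrib[symmetric] le_divide_eq del: of_nat_Suc)
  then show "grid n t \<le> t" "\<bar>t - grid n t\<bar> \<le> 1 / real (Suc n)" by auto
  show "0 \<le> t \<Longrightarrow> 0 \<le> grid n t" by (simp add: grid_def)
qed

lemma grid_simple_function: "simple_function (lebesgue_on {0..T}) (grid n)"
proof (rule simple_function_borel_measurable)
  have "grid n \<in> borel_measurable borel" unfolding grid_def[abs_def] by measurable
  then show "grid n \<in> borel_measurable (lebesgue_on {0..T})"
    by (simp add: measurable_completion measurable_restrict_space1)
  have "grid n ` {0..T} \<subseteq> (\<lambda>i. real_of_int i / real (Suc n)) ` {0..\<lfloor>T * real (Suc n)\<rfloor>}"
    by (auto simp: grid_def intro!: imageI floor_mono mult_right_mono)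
  then show "finite (grid n ` space (lebesgue_on {0..T}))"
    by (simp add: finite_subset)
qed

text \<open>The approximating simple functions are values of \<open>f\<close> on finer and finer
  grids. Dominated convergence for the oscillations makes them converge uniformly in time in the
  Sobolev norm, which gives measurability and the integral together.\<close>

theorem dominated_has_Hs_integral:
  assumes s: "0 \<le> s" and T: "0 \<le> T"
    and d: "dominated_family s T A c" and f: "\<And>t. t \<in> {0..T} \<Longrightarrow> fourier_coeff (f t) = c t"
    and v: "\<And>k. fourier_coeff v k = integral {0..T} (\<lambda>t. c t k)"
  shows "Hs_measurable s (lebesgue_on {0..T}) f" "has_Hs_integral s (lebesgue_on {0..T}) f v"
proof -
  let ?M = "lebesgue_on {0..T}"
  interpret finite_measure ?M by (rule finite_measure_lebesgue_on) simp
  have A: "hs_seq s A" and le: "\<And>t k. t \<in> {0..T} \<Longrightarrow> norm (c t k) \<le> A k"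
    and cont: "\<And>k. continuous_on {0..T} (\<lambda>t. c t k)"
    using dominated_familyD[OF d] by blast+
  have A0: "0 \<le> A k" for k using le[of 0 k] T norm_ge_zero order_trans by (metis atLeastAtMost_iff order_refl)
  have g: "grid n t \<in> {0..T}" if "t \<in> {0..T}" for n t
    using that grid_bounds(1)[of t n] grid_bounds(2)[of n t] by auto
  \<comment> \<open>Taking the supremum over time before the norm over frequencies gives a bound
    independent of t. For each frequency it tends to 0 by uniform continuity, and it stays below
    twice the majorant.\<close>
  define osc where "osc n k = (SUP t\<in>{0..T}. norm (c t k - c (grid n t) k))" for n k
  have osc_le: "norm (c t k - c (grid n t) k) \<le> 2 * A k" if "t \<in> {0..T}" for n t k
    using norm_triangle_ineq4[of "c t k" "c (grid n t) k"] le[OF that, of k] le[OF g[OF that], of n k] by linarith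
  have osc: "norm (c t k - c (grid n t) k) \<le> osc n k" if "t \<in> {0..T}" for n t k
    unfolding osc_def by (rule cSUP_upper[OF that]) (auto intro!: bdd_aboveI2 osc_le)
  have osc0: "0 \<le> osc n k" for n k
    using osc[of 0 k n] T norm_ge_zero order_trans by (metis atLeastAtMost_iff order_refl)
  have osc2: "osc n k \<le> 2 * A k" for n k
    unfolding osc_def using T by (intro cSUP_least osc_le) auto
  have osc_lim: "(\<lambda>n. osc n k) \<longlonglongrightarrow> 0" for k
  proof (rule LIMSEQ_I)
    fix e :: real assume e: "0 < e"
    have "uniformly_continuous_on {0..T} (\<lambda>t. c t k)"
      by (rule compact_uniformly_continuous[OF cont]) simp
    then obtain \<delta> where \<delta>: "0 < \<delta>" "\<And>t t'. t \<in> {0..T} \<Longrightarrow> t' \<in> {0..T} \<Longrightarrow> dist t' t < \<delta> \<Longrightarrow> dist (c t' k) (c t k) < e / 2"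
      unfolding uniformly_continuous_on_def using e by (metis half_gt_zero)
    obtain N where N: "1 / real (Suc N) < \<delta>" using \<delta>(1) nat_approx_posE by blast
    have "osc n k \<le> e / 2" if n: "N \<le> n" for n
      unfolding osc_def
    proof (rule cSUP_least)
      fix t assume t: "t \<in> {0..T}"
      have "1 / real (Suc n) \<le> 1 / real (Suc N)" using n by (intro divide_left_mono) auto
      then have "dist t (grid n t) < \<delta>" using grid_bounds(3)[where t = t and n = n] N by (simp add: dist_real_def)
      then show "norm (c t k - c (grid n t) k) \<le> e / 2"
        using \<delta>(2)[OF g[OF t] t] by (simp add: dist_norm less_imp_le)
    qed (use T in auto)
    then have "norm (osc n k - 0) < e" if "N \<le> n" for n
      using that e osc0[of n k] by force
    then show "\<exists>N. \<forall>n\<ge>N. norm (osc n k - 0) < e" by blast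
  qed
  have osc_seq: "hs_seq s (osc n)" for n
    by (rule hs_seq_mono[OF hs_seq_cmult[OF A, of 2]]) (simp add: osc0 osc2)
  have norm_lim: "(\<lambda>n. hs_seq_norm s (osc n)) \<longlonglongrightarrow> 0"
    by (rule hs_dominated_convergence[OF hs_seq_cmult[OF A, of 2] _ osc_lim]) (simp add: osc0 osc2)
  define F where "F n t = f (grid n t)" for n t
  have close: "Hs_norm s (f t - F n t) \<le> hs_seq_norm s (osc n)" "Hs_norm s (F n t - f t) \<le> hs_seq_norm s (osc n)"
    if t: "t \<in> {0..T}" for t n
    unfolding Hs_norm_eq
    by (rule hs_seq_norm_mono[OF osc_seq], use osc[OF t, of _ n] in \<open>simp add: F_def fourier_coeff_diff f[OF t] f[OF g[OF t]] norm_minus_commute\<close>)+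
  have fH: "f t \<in> Hs s" if "t \<in> {0..T}" for t by (rule dominated_Hs[OF d that f[OF that]])
  have FH: "F n ` space ?M \<subseteq> Hs s" for n using fH g by (auto simp: F_def)
  have simple: "simple_function ?M (F n)" for n
    unfolding F_def[abs_def] by (rule simple_function_compose1[OF grid_simple_function])
  have lim: "(\<lambda>n. Hs_norm s (F n t - f t)) \<longlonglongrightarrow> 0" if "t \<in> {0..T}" for t
  proof (rule tendsto_sandwich[OF _ _ tendsto_const norm_lim])
    show "\<forall>\<^sub>F n in sequentially. 0 \<le> Hs_norm s (F n t - f t)"
      by (simp add: Hs_norm_eq hs_seq_norm_nonneg)
  qed (use close[OF that] in auto)
  show meas: "Hs_measurable s ?M f"
    unfolding Hs_measurable_def
    using fH FH simple lim by (intro conjI exI[of _ F]) (auto intro!: AE_I2)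
  have vH: "v \<in> Hs s"
    unfolding Hs_iff
  proof (rule hs_seq_mono[OF hs_seq_cmult[OF A, of T]])
    fix k
    have "norm (integral {0..T} (\<lambda>t. c t k)) \<le> A k * (T - 0)"
      by (rule integral_bound[OF T cont le])
    then show "\<bar>norm (fourier_coeff v k)\<bar> \<le> T * A k" by (simp add: v mult.commute)
  qed
  have sbi: "Bochner_Integration.simple_bochner_integrable ?M (F n)" for n
    by (rule simple_bochner_integrable.intros[OF simple]) simp
  have coeff: "norm (fourier_coeff (Bochner_Integration.simple_bochner_integral ?M (F n) - v) k) \<le> T * osc n k" for n k
  proof -
    let ?g = "\<lambda>t. fourier_coeff (F n t) k"
    have sg: "Bochner_Integration.simple_bochner_integrable ?M ?g"
      by (rule simple_bochner_integrable.intros[OF simple_function_compose1[OF simple]]) simp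
    then have ig: "integrable ?M ?g"
      using has_bochner_integral_simple_bochner_integrable integrable.intros by blast
    have ic: "integrable ?M (\<lambda>t. c t k)" by (rule continuous_imp_integrable_real[OF cont])
    \<comment> \<open>A coefficient is a linear functional, hence commutes with the integral of a
      simple function, and the vector-valued integral is compared with \<open>v\<close> one
      coefficient at a time.\<close>
    have "fourier_coeff (Bochner_Integration.simple_bochner_integral ?M (F n)) k = integral\<^sup>L ?M ?g"
      using simple_bochner_integral_linear[OF fourier_coeff_linear sbi] simple_bochner_integrable_eq_integral[OF sg] by simp
    moreover have "fourier_coeff v k = integral\<^sup>L ?M (\<lambda>t. c t k)"
      using lebesgue_integral_eq_integral[OF ic] by (simp add: v)
    ultimately have "fourier_coeff (Bochner_Integration.simple_bochner_integral ?M (F n) - v) k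
        = integral\<^sup>L ?M (\<lambda>t. ?g t - c t k)"
      by (simp add: fourier_coeff_diff Bochner_Integration.integral_diff[OF ig ic])
    also have "norm \<dots> \<le> integral\<^sup>L ?M (\<lambda>t. osc n k)"
    proof (rule Bochner_Integration.integral_norm_bound_integral)
      fix t assume "t \<in> space ?M"
      then have t: "t \<in> {0..T}" by simp
      show "norm (?g t - c t k) \<le> osc n k"
        using osc[OF t, of k n] by (simp add: F_def f[OF g[OF t]] norm_minus_commute)
    qed (use ig ic in auto)
    also have "\<dots> = T * osc n k" using T by (simp add: measure_restrict_space)
    finally show ?thesis .
  qed
  show "has_Hs_integral s ?M f v"
    unfolding has_Hs_integral_def
  proof (intro conjI exI[of _ F] allI meas vH sbi FH)
    show "(\<lambda>n. \<integral>\<^sup>+ t. ennreal (Hs_norm s (f t - F n t)) \<partial>?M) \<longlonglongrightarrow> 0"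
    proof (rule tendsto_sandwich[OF _ _ tendsto_const])
      show "\<forall>\<^sub>F n in sequentially. (\<integral>\<^sup>+ t. ennreal (Hs_norm s (f t - F n t)) \<partial>?M) \<le> ennreal (hs_seq_norm s (osc n) * T)"
      proof (rule always_eventually, rule allI)
        fix n
        have "(\<integral>\<^sup>+ t. ennreal (Hs_norm s (f t - F n t)) \<partial>?M) \<le> (\<integral>\<^sup>+ t. ennreal (hs_seq_norm s (osc n)) \<partial>?M)"
          by (intro nn_integral_mono ennreal_leI close) simp
        also have "\<dots> = ennreal (hs_seq_norm s (osc n) * T)"
          using T by (simp add: emeasure_restrict_space ennreal_mult hs_seq_norm_nonneg)
        finally show "(\<integral>\<^sup>+ t. ennreal (Hs_norm s (f t - F n t)) \<partial>?M) \<le> ennreal (hs_seq_norm s (osc n) * T)" .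
      qed
      have "(\<lambda>n. hs_seq_norm s (osc n) * T) \<longlonglongrightarrow> 0 * T" by (intro tendsto_mult norm_lim tendsto_const)
      then show "(\<lambda>n. ennreal (hs_seq_norm s (osc n) * T)) \<longlonglongrightarrow> 0"
        using tendsto_ennrealI by fastforce
    qed simp
    show "(\<lambda>n. Hs_norm s (Bochner_Integration.simple_bochner_integral ?M (F n) - v)) \<longlonglongrightarrow> 0"
    proof (rule tendsto_sandwich[OF _ _ tendsto_const])
      show "\<forall>\<^sub>F n in sequentially. 0 \<le> Hs_norm s (Bochner_Integration.simple_bochner_integral ?M (F n) - v)"
        by (simp add: Hs_norm_eq hs_seq_norm_nonneg)
      have "Hs_norm s (Bochner_Integration.simple_bochner_integral ?M (F n) - v) \<le> T * hs_seq_norm s (osc n)" for n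
      proof -
        have "Hs_norm s (Bochner_Integration.simple_bochner_integral ?M (F n) - v) \<le> hs_seq_norm s (\<lambda>k. T * osc n k)"
          unfolding Hs_norm_eq by (rule hs_seq_norm_mono[OF hs_seq_cmult[OF osc_seq]]) (simp add: coeff)
        then show ?thesis using T by (simp add: hs_seq_norm_cmult)
      qed
      then show "\<forall>\<^sub>F n in sequentially. Hs_norm s (Bochner_Integration.simple_bochner_integral ?M (F n) - v) \<le> T * hs_seq_norm s (osc n)"
        by simp
      have "(\<lambda>n. T * hs_seq_norm s (osc n)) \<longlonglongrightarrow> T * 0" by (intro tendsto_mult norm_lim tendsto_const)
      then show "(\<lambda>n. T * hs_seq_norm s (osc n)) \<longlonglongrightarrow> 0" by simp
    qed
  qed
qed

text \<open>For s \<ge> 0 each coefficient is bounded by the Sobolev norm, so convergence of the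
  simple approximations passes to scalars. As the scalar integral is unique and coefficients
  determine a distribution, uniqueness of the vector-valued integral follows.\<close>

lemma has_Hs_integral_coeff:
  assumes s: "0 \<le> s" and v: "has_Hs_integral s M f v"
    and meas: "(\<lambda>t. fourier_coeff (f t) k) \<in> borel_measurable M"
  shows "has_bochner_integral M (\<lambda>t. fourier_coeff (f t) k) (fourier_coeff v k)"
proof -
  have fH: "f ` space M \<subseteq> Hs s" and vH: "v \<in> Hs s"
    using v by (simp_all add: has_Hs_integral_def Hs_measurable_def)
  obtain F where F': "\<forall>i. Bochner_Integration.simple_bochner_integrable M (F i) \<and> F i ` space M \<subseteq> Hs s"
    and F: "(\<lambda>i. \<integral>\<^sup>+ t. ennreal (Hs_norm s (f t - F i t)) \<partial>M) \<longlonglongrightarrow> 0"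
    "(\<lambda>i. Hs_norm s (Bochner_Integration.simple_bochner_integral M (F i) - v)) \<longlonglongrightarrow> 0"
    using v unfolding has_Hs_integral_def by (elim conjE exE) (rule that)
  have F1: "Bochner_Integration.simple_bochner_integrable M (F i)" and F2: "F i ` space M \<subseteq> Hs s" for i
    using F' by blast+
  \<comment> \<open>The integral of a simple function is a finite linear combination of its values;
    membership in the space is needed for the coefficient bound applied to the difference with
    \<open>v\<close>.\<close>
  have sH: "Bochner_Integration.simple_bochner_integral M (F i) \<in> Hs s" for i
  proof -
    have "sum (\<lambda>y. measure M {x\<in>space M. F i x = y} *\<^sub>R y) S \<in> Hs s" if "finite S" "S \<subseteq> Hs s" for S
      using that
    proof induction
      case empty
      have "fourier_coeff 0 k = 0" for k using linear_0[OF fourier_coeff_linear] .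
      then show ?case by (simp add: Hs_iff hs_seq_def)
    next
      case (insert y S)
      let ?m = "measure M {x\<in>space M. F i x = y}"
      let ?S = "sum (\<lambda>y. measure M {x\<in>space M. F i x = y} *\<^sub>R y) S"
      have y: "hs_seq s (\<lambda>k. norm (fourier_coeff y k))" and S: "hs_seq s (\<lambda>k. norm (fourier_coeff ?S k))"
        using insert by (auto simp: Hs_iff)
      have "hs_seq s (\<lambda>k. norm (fourier_coeff (?m *\<^sub>R y + ?S) k))"
      proof (rule hs_seq_mono[OF hs_seq_add[OF hs_seq_cmult[OF y, of ?m] S]])
        fix k
        have "fourier_coeff (?m *\<^sub>R y + ?S) k = ?m *\<^sub>R fourier_coeff y k + fourier_coeff ?S k"
          using linear_add[OF fourier_coeff_linear] linear_scale[OF fourier_coeff_linear] by simp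
        then show "\<bar>norm (fourier_coeff (?m *\<^sub>R y + ?S) k)\<bar> \<le> ?m * norm (fourier_coeff y k) + norm (fourier_coeff ?S k)"
          using norm_triangle_ineq[of "?m *\<^sub>R fourier_coeff y k" "fourier_coeff ?S k"] by simp
      qed
      then show ?case using insert by (simp add: Hs_iff)
    qed
    moreover have "finite (F i ` space M)"
      using F1[of i] by (auto elim!: simple_bochner_integrable.cases intro: simple_functionD)
    ultimately show ?thesis using F2[of i] unfolding simple_bochner_integral_def by blast
  qed
  show ?thesis
  proof (rule has_bochner_integral.intros[OF meas])
    show sg: "Bochner_Integration.simple_bochner_integrable M (\<lambda>t. fourier_coeff (F i t) k)" for i
      using simple_bochner_integrable_compose2[where p = "\<lambda>u _. fourier_coeff u k", OF _ F1[of i] F1[of i]]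
        linear_0[OF fourier_coeff_linear] by simp
    show "(\<lambda>i. \<integral>\<^sup>+ t. ennreal (norm (fourier_coeff (f t) k - fourier_coeff (F i t) k)) \<partial>M) \<longlonglongrightarrow> 0"
    proof (rule tendsto_sandwich[OF _ _ tendsto_const F(1)])
      have "(\<integral>\<^sup>+ t. ennreal (norm (fourier_coeff (f t) k - fourier_coeff (F i t) k)) \<partial>M)
          \<le> (\<integral>\<^sup>+ t. ennreal (Hs_norm s (f t - F i t)) \<partial>M)" for i
      proof (intro nn_integral_mono ennreal_leI)
        fix t assume "t \<in> space M"
        then have "f t - F i t \<in> Hs s" using fH F2[of i] by (auto intro!: Hs_diff)
        from norm_fourier_coeff_le[OF s this, of k]
        show "norm (fourier_coeff (f t) k - fourier_coeff (F i t) k) \<le> Hs_norm s (f t - F i t)"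
          by (simp add: fourier_coeff_diff)
      qed
      then show "\<forall>\<^sub>F i in sequentially. (\<integral>\<^sup>+ t. ennreal (norm (fourier_coeff (f t) k - fourier_coeff (F i t) k)) \<partial>M)
          \<le> (\<integral>\<^sup>+ t. ennreal (Hs_norm s (f t - F i t)) \<partial>M)" by simp
    qed simp
    have "(\<lambda>i. fourier_coeff (Bochner_Integration.simple_bochner_integral M (F i)) k) \<longlonglongrightarrow> fourier_coeff v k"
    proof (rule Lim_null[THEN iffD2, OF Lim_null_comparison[OF _ F(2)]], rule always_eventually, rule allI)
      fix i
      show "norm (fourier_coeff (Bochner_Integration.simple_bochner_integral M (F i)) k - fourier_coeff v k)
          \<le> Hs_norm s (Bochner_Integration.simple_bochner_integral M (F i) - v)"
        using norm_fourier_coeff_le[OF s Hs_diff[OF sH[of i] vH], of k] by (simp add: fourier_coeff_diff)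
    qed
    then show "(\<lambda>i. Bochner_Integration.simple_bochner_integral M (\<lambda>t. fourier_coeff (F i t) k)) \<longlonglongrightarrow> fourier_coeff v k"
      using simple_bochner_integral_linear[OF fourier_coeff_linear F1] by simp
  qed
qed

lemma has_Hs_integral_unique:
  assumes "0 \<le> s" "has_Hs_integral s M f v" "has_Hs_integral s M f v'"
    and "\<And>k. (\<lambda>t. fourier_coeff (f t) k) \<in> borel_measurable M"
  shows "v = v'"
  by (rule fourier_coeff_inject, rule ext)
     (rule has_bochner_integral_eq[OF has_Hs_integral_coeff[OF assms(1,2,4)] has_Hs_integral_coeff[OF assms(1,3,4)]])

lemma dominated_L2_Hs:
  assumes s: "0 \<le> s" and T: "0 \<le> T"
    and d: "dominated_family s T A c" and f: "\<And>t. t \<in> {0..T} \<Longrightarrow> fourier_coeff (f t) = c t"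
  shows "f \<in> L2_Hs T s" "L2_Hs_norm T s f \<le> sqrt T * hs_seq_norm s A"
proof -
  have A: "hs_seq s A" and le: "\<And>t k. t \<in> {0..T} \<Longrightarrow> norm (c t k) \<le> A k"
    and cont: "\<And>k. continuous_on {0..T} (\<lambda>t. c t k)"
    using dominated_familyD[OF d] by blast+
  \<comment> \<open>Measurability was obtained together with the integral, so a distribution with
    the integrated coefficients has to be supplied.\<close>
  define v where "v = of_coeffs (\<lambda>k. integral {0..T} (\<lambda>t. c t k))"
  have "hs_seq s (\<lambda>k. norm (integral {0..T} (\<lambda>t. c t k)))"
  proof (rule hs_seq_mono[OF hs_seq_cmult[OF A, of T]])
    show "\<bar>norm (integral {0..T} (\<lambda>t. c t k))\<bar> \<le> T * A k" for k
      using integral_bound[OF T cont le, of k] by (simp add: mult.commute)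
  qed
  from fourier_coeff_of_coeffs[OF s this] have "fourier_coeff v k = integral {0..T} (\<lambda>t. c t k)" for k
    by (simp add: v_def)
  note meas = dominated_has_Hs_integral(1)[OF s T d f this]
  have int: "integrable (lebesgue_on {0..T}) (\<lambda>t. (Hs_norm s (f t))\<^sup>2)"
    by (rule continuous_imp_integrable_real[OF dominated_Hs_norm_continuous[OF d f]])
  show "f \<in> L2_Hs T s" using meas int by (simp add: L2_Hs_def)
  have "(\<integral>t. (Hs_norm s (f t))\<^sup>2 \<partial>lebesgue_on {0..T}) \<le> (\<integral>t. (hs_seq_norm s A)\<^sup>2 \<partial>lebesgue_on {0..T})"
  proof (rule integral_mono[OF int])
    fix t assume "t \<in> space (lebesgue_on {0..T})"
    then have "Hs_norm s (f t) \<le> hs_seq_norm s A" using dominated_Hs(2)[OF d _ f] by simp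
    then show "(Hs_norm s (f t))\<^sup>2 \<le> (hs_seq_norm s A)\<^sup>2"
      by (intro power_mono) (auto simp: Hs_norm_eq hs_seq_norm_nonneg)
  qed simp
  also have "\<dots> = T * (hs_seq_norm s A)\<^sup>2" using T by (simp add: measure_restrict_space)
  finally have "L2_Hs_norm T s f \<le> sqrt (T * (hs_seq_norm s A)\<^sup>2)"
    unfolding L2_Hs_norm_def by (rule real_sqrt_le_mono)
  then show "L2_Hs_norm T s f \<le> sqrt T * hs_seq_norm s A"
    by (simp add: real_sqrt_mult hs_seq_norm_nonneg)
qed

section \<open>The control\<close>

text \<open>Given two modes of equal frequency, hypotheses (ii) and (iii) leave only \<open>k\<close> and its mirror image
  in the row and column of \<open>k\<close>. The resonant part of the control operator thus splits into blocks of
  size at most two, in which \<open>g1\<close> enters only through its mean value. The blocks are diagonally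
  dominant because no Fourier coefficient of \<open>g2\<close> exceeds the mean.\<close>

lemma resonant_inverse:
  fixes lam :: "int \<times> int \<Rightarrow> real"
  assumes sym: "\<And>k1 k2. lam (k1, - k2) = lam (k1, k2)"
    and col: "\<And>k1 k2 j2. k1 \<noteq> 0 \<Longrightarrow> lam (k1, j2) = lam (k1, k2) \<Longrightarrow> j2 = k2 \<or> j2 = - k2"
    and row: "\<And>k1 k2 j1. k2 \<noteq> 0 \<Longrightarrow> lam (j1, k2) = lam (k1, k2) \<Longrightarrow> j1 = k1"
    and g: "control_profile g1" "control_profile g2"
    and c: "c (0, 0) = 0"
  obtains a where "\<And>k. norm (a k) \<le> (2 * pi)\<^sup>2 * (norm (c k) + norm (c (fst k, - snd k)))"
    "\<And>k. ((\<lambda>j. G_matrix g1 g2 k j * (if lam j = lam k then a j else 0)) has_sum c k) UNIV"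
proof -
  \<comment> \<open>\<open>\<alpha>\<close> is the common zeroth coefficient of both profiles.
    \<open>\<beta> n\<close> is the coefficient of \<open>g2\<close> at twice the frequency, which
    couples a mode to its mirror image, since their indices differ by (0, 2 k2).\<close>
  define \<alpha> where "\<alpha> = 1 / (2 * pi)"
  define \<beta> where "\<beta> n = gy g2 (0, 2 * n)" for n
  define \<Delta> where "\<Delta> n = 4 * \<alpha>\<^sup>2 - (norm (\<beta> n))\<^sup>2" for n
  \<comment> \<open>Cramer's rule. Off the axes the block of \<open>k\<close> and its mirror is
    \<alpha> times the Hermitian matrix with diagonal 2\<alpha> and off-diagonal entry \<beta>, and
    \<Delta> is the determinant of that matrix. On an axis only one profile acts and the block is
    the scalar \<alpha>^2.\<close>
  define a where "a k = (if k = (0, 0) then 0 else if fst k = 0 \<or> snd k = 0 then c k / of_real (\<alpha>\<^sup>2)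
    else (2 * of_real \<alpha> * c k - \<beta> (snd k) * c (fst k, - snd k)) / of_real (\<alpha> * \<Delta> (snd k)))" for k
  note co = control_profile_coeffs[OF g(1)] control_profile_coeffs[OF g(2)]
  note off = profile_off_axis[OF control_profile_smooth_real[OF g(1)]] profile_off_axis[OF control_profile_smooth_real[OF g(2)]]
  have \<alpha>: "0 < \<alpha>" by (simp add: \<alpha>_def)
  have \<beta>: "norm (\<beta> n) \<le> \<alpha>" for n using co by (simp add: \<beta>_def \<alpha>_def)
  have \<beta>m: "\<beta> (- n) = cnj (\<beta> n)" for n
    using control_profile_coeffs(5)[OF g(2), of "(0, 2 * n)"] by (simp add: \<beta>_def)
  have \<Delta>: "3 * \<alpha>\<^sup>2 \<le> \<Delta> n" for n
    using power_mono[OF \<beta>[of n], of 2] by (simp add: \<Delta>_def)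
  then have \<Delta>0: "0 < \<Delta> n" for n using \<alpha> by (smt (verit) zero_less_power)
  have \<Delta>m: "\<Delta> (- n) = \<Delta> n" for n by (simp add: \<Delta>_def \<beta>m)
  have \<alpha>2: "1 / \<alpha>\<^sup>2 = (2 * pi)\<^sup>2" by (simp add: \<alpha>_def power_divide)
  have main: "norm (a k) \<le> (2 * pi)\<^sup>2 * (norm (c k) + norm (c (fst k, - snd k))) \<and>
    ((\<lambda>j. G_matrix g1 g2 k j * (if lam j = lam k then a j else 0)) has_sum c k) UNIV" for k
  proof
  let ?k' = "(fst k, - snd k)"
  show "norm (a k) \<le> (2 * pi)\<^sup>2 * (norm (c k) + norm (c ?k'))"
  proof -
    consider "k = (0, 0)" | "k \<noteq> (0, 0)" "fst k = 0 \<or> snd k = 0" | "fst k \<noteq> 0" "snd k \<noteq> 0" by fastforce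
    then show ?thesis
    proof cases
      case 1
      then show ?thesis by (simp add: a_def)
    next
      case 2
      then have "norm (a k) = norm (c k) * (1 / \<alpha>\<^sup>2)" using \<alpha> by (simp add: a_def norm_divide norm_power)
      also have "\<dots> \<le> (norm (c k) + norm (c ?k')) * (1 / \<alpha>\<^sup>2)" by (intro mult_right_mono) auto
      finally show ?thesis by (simp only: \<alpha>2 mult.commute)
    next
      case 3
      have "norm (2 * of_real \<alpha> * c k - \<beta> (snd k) * c ?k') \<le> 2 * \<alpha> * norm (c k) + norm (\<beta> (snd k)) * norm (c ?k')"
        using norm_triangle_ineq4[of "2 * of_real \<alpha> * c k" "\<beta> (snd k) * c ?k'"] \<alpha> by (simp add: norm_mult)
      also have "\<dots> \<le> 2 * \<alpha> * norm (c k) + 2 * \<alpha> * norm (c ?k')"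
        using \<beta>[of "snd k"] \<alpha> by (intro add_left_mono mult_right_mono) auto
      finally have num: "norm (2 * of_real \<alpha> * c k - \<beta> (snd k) * c ?k') \<le> 2 * \<alpha> * (norm (c k) + norm (c ?k'))"
        by (simp add: distrib_left)
      have "norm (a k) = norm (2 * of_real \<alpha> * c k - \<beta> (snd k) * c ?k') / (\<alpha> * \<Delta> (snd k))"
        using 3 \<alpha> \<Delta>0[of "snd k"] by (auto simp: a_def norm_divide norm_mult)
      \<comment> \<open>The available bound \<Delta> \<ge> 3\<alpha>^2 is relaxed to 2\<alpha>^2, so
        that the constant is the 1/\<alpha>^2 of the axis case.\<close>
      also have "\<dots> \<le> 2 * \<alpha> * (norm (c k) + norm (c ?k')) / (\<alpha> * (2 * \<alpha>\<^sup>2))"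
        using num \<alpha> \<Delta>[of "snd k"] by (intro frac_le mult_left_mono) (auto simp: add_nonneg_nonneg intro: order_trans[rotated])
      also have "\<dots> = (norm (c k) + norm (c ?k')) * (1 / \<alpha>\<^sup>2)"
        using \<alpha> by (simp add: field_simps)
      finally show ?thesis by (simp only: \<alpha>2 mult.commute)
    qed
  qed
  \<comment> \<open>The g2 part of row \<open>k\<close> is present only if \<open>fst k\<close> is
    nonzero and it preserves the first index, which is the situation of \<open>col\<close>; the g1
    part is likewise matched with \<open>row\<close>. Rows with \<open>fst k = 0\<close> thus never
    meet the g2 part, however many modes share their eigenvalue.\<close>
  have only: "j = k \<or> j = ?k'" if "lam j = lam k" "G_matrix g1 g2 k j \<noteq> 0" for j
  proof -
    from that(2) consider "fst k \<noteq> 0" "gy g2 (k - j) \<noteq> 0" | "snd k \<noteq> 0" "gx g1 (k - j) \<noteq> 0"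
      by (cases "gy g2 (k - j) = 0") (auto simp: G_matrix_def split: if_splits)
    then show ?thesis
    proof cases
      case 1
      then have "fst j = fst k" using off(4)[of "k - j"] by force
      then show ?thesis using col[of "fst k" "snd j" "snd k"] 1(1) that(1) by (metis prod.collapse)
    next
      case 2
      then have "snd j = snd k" using off(1)[of "k - j"] by force
      then show ?thesis using row[of "snd k" "fst j" "fst k"] 2(1) that(1) by (metis prod.collapse)
    qed
  qed
  have Gkk: "G_matrix g1 g2 k k = of_real \<alpha> * ((if fst k = 0 then 0 else of_real \<alpha>) + (if snd k = 0 then 0 else of_real \<alpha>))"
    by (simp add: G_matrix_def co \<alpha>_def)
  have Gkk': "G_matrix g1 g2 k ?k' = of_real \<alpha> * (if fst k = 0 then 0 else \<beta> (snd k))" if "snd k \<noteq> 0"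
  proof -
    have d: "k - ?k' = (0, 2 * snd k)" by (cases k) simp
    have "gx g1 (0, 2 * snd k) = 0" using off(1)[of "(0, 2 * snd k)"] that by simp
    then show ?thesis by (simp add: G_matrix_def d \<beta>_def \<alpha>_def)
  qed
  have lam': "lam ?k' = lam k" using sym[of "fst k" "snd k"] by simp
  show "((\<lambda>j. G_matrix g1 g2 k j * (if lam j = lam k then a j else 0)) has_sum c k) UNIV"
  proof (rule has_sum_finite_neutralI[of "{k, ?k'}"])
    show "c k = (\<Sum>j\<in>{k, ?k'}. G_matrix g1 g2 k j * (if lam j = lam k then a j else 0))"
    proof (cases "snd k = 0")
      case True
      then have k': "?k' = k" by (cases k) simp
      have "(\<Sum>j\<in>{k, ?k'}. G_matrix g1 g2 k j * (if lam j = lam k then a j else 0)) = G_matrix g1 g2 k k * a k"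
        by (simp add: k')
      also have "\<dots> = c k"
      proof (cases "fst k = 0")
        \<comment> \<open>The row at the origin is zero: the image of \<open>G\<close> has mean
          zero, and the equation is solvable only because \<open>c (0, 0) = 0\<close>.\<close>
        case fk: True
        with True have "k = (0, 0)" by (simp add: prod_eq_iff)
        then show ?thesis using c by (simp add: a_def)
      next
        case False
        then have "a k = c k / (of_real \<alpha>)\<^sup>2" using True by (auto simp: a_def)
        then show ?thesis using False True \<alpha> by (simp add: Gkk power2_eq_square)
      qed
      finally show ?thesis ..
    next
      case sk: False
      then have ne: "k \<noteq> ?k'" by (cases k) auto
      have "(\<Sum>j\<in>{k, ?k'}. G_matrix g1 g2 k j * (if lam j = lam k then a j else 0)) =
          G_matrix g1 g2 k k * a k + G_matrix g1 g2 k ?k' * a ?k'"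
        using ne lam' by simp
      also have "\<dots> = c k"
      proof (cases "fst k = 0")
        case True
        then have "a k = c k / (of_real \<alpha>)\<^sup>2" using sk by (auto simp: a_def)
        moreover have "G_matrix g1 g2 k ?k' = 0" using Gkk'[OF sk] True by simp
        ultimately show ?thesis using sk True \<alpha> by (simp add: Gkk power2_eq_square)
      next
        case False
        define z where "z = \<beta> (snd k)"
        define e where "e = complex_of_real (\<Delta> (snd k))"
        have e: "e \<noteq> 0" "e = 4 * of_real \<alpha> * of_real \<alpha> - z * cnj z"
        proof -
          show "e \<noteq> 0" using \<Delta>0[of "snd k"] unfolding e_def by simp
          show "e = 4 * of_real \<alpha> * of_real \<alpha> - z * cnj z"
            unfolding e_def \<Delta>_def z_def[symmetric] of_real_diff complex_norm_square by (simp add: power2_eq_square)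
        qed
        have a1: "a k = (2 * of_real \<alpha> * c k - z * c ?k') / (of_real \<alpha> * e)"
          using False sk by (auto simp: a_def z_def e_def)
        have a2: "a ?k' = (2 * of_real \<alpha> * c ?k' - cnj z * c k) / (of_real \<alpha> * e)"
          using False sk by (auto simp: a_def z_def e_def \<beta>m \<Delta>m)
        have "G_matrix g1 g2 k k * a k + G_matrix g1 g2 k ?k' * a ?k' =
            of_real \<alpha> * (2 * of_real \<alpha>) * a k + of_real \<alpha> * z * a ?k'"
          using False sk by (simp add: Gkk Gkk' z_def)
        also have "\<dots> = (2 * of_real \<alpha> * (2 * of_real \<alpha> * c k - z * c ?k') + z * (2 * of_real \<alpha> * c ?k' - cnj z * c k)) / e"
          unfolding a1 a2 using \<alpha> by (simp add: add_divide_distrib)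
        also have "\<dots> = c k * e / e" unfolding e(2) by (simp add: algebra_simps)
        finally show ?thesis using e(1) by simp
      qed
      finally show ?thesis ..
    qed
  qed (use only in auto)
qed
  show thesis by (rule that[of a]) (use main in blast)+
qed

section \<open>Forced evolution and mild solutions\<close>

lemma G_dominated:
  assumes s: "0 \<le> s" and g: "smooth_real g1" "smooth_real g2"
    and d: "dominated_family s T A c" and A: "\<And>k. 0 \<le> A k"
    and h: "\<And>t. t \<in> {0..T} \<Longrightarrow> fourier_coeff (h t) = c t"
  obtains A' where "dominated_family s T A' (\<lambda>t. fourier_coeff (G g1 g2 (h t)))" "\<And>k. 0 \<le> A' k"
    "\<And>k t. t \<in> {0..T} \<Longrightarrow> fourier_coeff (G g1 g2 (h t)) k = (\<Sum>\<^sub>\<infinity>j. G_matrix g1 g2 k j * c t j)"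
    "\<And>k. (\<lambda>j. norm (G_matrix g1 g2 k j) * A j) summable_on UNIV"
proof -
  \<comment> \<open>One convolution kernel dominates the matrix for all Sobolev exponents; it turns
    the majorant of \<open>h\<close> into a majorant of \<open>G h\<close>.\<close>
  obtain D where D: "\<And>k j. norm (G_matrix g1 g2 k j) \<le> D (k - j)" "\<And>n. 0 \<le> D n"
    "\<And>s. (\<lambda>n. D n * (1 + freq_norm n) powr s) summable_on UNIV"
    using G_matrix_convolution_bound[OF g] by blast
  note dd = dominated_familyD[OF d]
  note conv = hs_convolution[OF s D(3,2) dd(1) A]
  have le: "norm (G_matrix g1 g2 k j * c t j) \<le> D (k - j) * A j" if "t \<in> {0..T}" for k j t
    unfolding norm_mult by (rule mult_mono[OF D(1) dd(2)[OF that] D(2)]) simp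
  have eq: "fourier_coeff (G g1 g2 (h t)) k = (\<Sum>\<^sub>\<infinity>j. G_matrix g1 g2 k j * c t j)" if "t \<in> {0..T}" for t k
    using fourier_coeff_G[OF g, of k "h t"] by (simp add: h[OF that] has_sum_iff)
  show thesis
  proof (rule that[of "\<lambda>k. \<Sum>\<^sub>\<infinity>j. D (k - j) * A j"])
    show "dominated_family s T (\<lambda>k. \<Sum>\<^sub>\<infinity>j. D (k - j) * A j) (\<lambda>t. fourier_coeff (G g1 g2 (h t)))"
      unfolding dominated_family_def
    proof (intro conjI ballI allI conv(2))
      fix t k assume t: "t \<in> {0..T}"
      have sn: "(\<lambda>j. norm (G_matrix g1 g2 k j * c t j)) summable_on UNIV"
        by (rule summable_on_comparison_test[OF conv(1) le[OF t]]) auto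
      show "norm (fourier_coeff (G g1 g2 (h t)) k) \<le> (\<Sum>\<^sub>\<infinity>j. D (k - j) * A j)"
        unfolding eq[OF t]
        by (rule order_trans[OF norm_infsum_bound[OF sn] infsum_mono[OF sn conv(1) le[OF t]]])
    next
      fix k
      have "continuous_on {0..T} (\<lambda>t. \<Sum>\<^sub>\<infinity>j. G_matrix g1 g2 k j * c t j)"
        by (rule continuous_on_infsum[OF le conv(1)]) (auto intro!: continuous_on_mult_left dd(3))
      then show "continuous_on {0..T} (\<lambda>t. fourier_coeff (G g1 g2 (h t)) k)"
        by (simp add: eq cong: continuous_on_cong_simp)
    qed
    show "0 \<le> (\<Sum>\<^sub>\<infinity>j. D (k - j) * A j)" for k by (intro infsum_nonneg mult_nonneg_nonneg D(2) A)
    show "(\<lambda>j. norm (G_matrix g1 g2 k j) * A j) summable_on UNIV" for k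
      by (rule summable_on_comparison_test[OF conv(1) mult_right_mono[OF D(1) A]]) (simp add: A)
  qed (use eq in auto)
qed

text \<open>The mild formulation determines the solution explicitly: existence means that the
  variation of constants formula defines a continuous curve, and uniqueness is uniqueness of the
  Bochner integral on each [0, t].\<close>

lemma mild_solution_dominated:
  assumes s: "0 \<le> s" and T: "0 \<le> T" and u0: "u0 \<in> Hs s"
    and d: "dominated_family s T A (\<lambda>t. fourier_coeff (F t))" and A: "\<And>k. 0 \<le> A k"
  obtains u where "mild_solution s b T F u0 u"
    "\<And>v t. mild_solution s b T F u0 v \<Longrightarrow> t \<in> {0..T} \<Longrightarrow> v t = u t"
    "\<And>k. fourier_coeff (u T) k = exp (\<i> * complex_of_real (eigen_freq b k * T)) * fourier_coeff u0 k +
       integral {0..T} (\<lambda>t. exp (\<i> * complex_of_real (eigen_freq b k * (T - t))) * fourier_coeff (F t) k)"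
proof -
  define E where "E k t = exp (\<i> * complex_of_real (eigen_freq b k * t))" for k t
  have nE: "norm (E k t) = 1" for k t unfolding E_def by (rule norm_exp_i_times)
  have Eadd: "E k (t - t') = E k t * E k (- t')" for k t t'
    by (simp add: E_def exp_add[symmetric] algebra_simps)
  have cE: "continuous_on S (\<lambda>t. E k (f t))" if "continuous_on S f" for k and S :: "real set" and f
    unfolding E_def by (intro continuous_intros that)
  note dd = dominated_familyD[OF d]
  have FH: "F t \<in> Hs s" if "t \<in> {0..T}" for t by (rule dominated_Hs(1)[OF d that refl])
  define w where "w t t' k = E k (t - t') * fourier_coeff (F t') k" for t t' k
  have dw: "dominated_family s t A (w t)" if "t \<in> {0..T}" for t
    unfolding dominated_family_def
  proof (intro conjI ballI allI dd(1))
    fix t' k assume "t' \<in> {0..t}"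
    then show "norm (w t t' k) \<le> A k" using dd(2)[of t' k] that by (simp add: w_def norm_mult nE)
  next
    fix k
    show "continuous_on {0..t} (\<lambda>t'. w t t' k)"
      unfolding w_def
      by (intro continuous_on_mult cE continuous_intros continuous_on_subset[OF dd(3)]) (use that in auto)
  qed
  have wc: "fourier_coeff (propagator b (t - t') (F t')) = w t t'" if "t \<in> {0..T}" "t' \<in> {0..t}" for t t'
    using that by (intro ext) (simp add: w_def E_def fourier_coeff_propagator[OF s FH])
  define c where "c t k = E k t * fourier_coeff u0 k + integral {0..t} (\<lambda>t'. w t t' k)" for t k
  \<comment> \<open>Pulling the group factor out removes \<open>t\<close> from the integrand, so
    continuity in time is that of an indefinite integral.\<close>
  have ceq: "c t k = E k t * (fourier_coeff u0 k + integral {0..t} (\<lambda>t'. E k (- t') * fourier_coeff (F t') k))" for t k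
    by (simp add: c_def w_def Eadd[of k t] mult.assoc distrib_left)
  define B where "B k = norm (fourier_coeff u0 k) + T * A k" for k
  have hB: "hs_seq s B"
    unfolding B_def using u0 by (intro hs_seq_add hs_seq_cmult dd(1)) (simp add: Hs_iff)
  have dc: "dominated_family s T B c"
    unfolding dominated_family_def
  proof (intro conjI ballI allI hB)
    fix t k assume t: "t \<in> {0..T}"
    have "norm (integral {0..t} (\<lambda>t'. w t t' k)) \<le> A k * (t - 0)"
      using t dominated_familyD[OF dw[OF t]] by (intro integral_bound) auto
    also have "\<dots> \<le> T * A k" using t mult_right_mono[of t T "A k"] A[of k] by (simp add: mult.commute)
    finally show "norm (c t k) \<le> B k"
      unfolding c_def B_def by (intro order_trans[OF norm_triangle_ineq] add_mono) (simp_all add: norm_mult nE)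
  next
    fix k
    have "continuous_on {0..T} (\<lambda>t. E k (- t) * fourier_coeff (F t) k)"
      by (intro continuous_on_mult cE continuous_intros dd(3))
    then have "continuous_on {0..T} (\<lambda>t. integral {0..t} (\<lambda>t'. E k (- t') * fourier_coeff (F t') k))"
      by (intro indefinite_integral_continuous_1 integrable_continuous_real)
    then show "continuous_on {0..T} (\<lambda>t. c t k)"
      unfolding ceq by (intro continuous_on_mult continuous_on_add cE continuous_intros)
  qed
  define u where "u t = of_coeffs (c t)" for t
  have uc: "fourier_coeff (u t) = c t" if "t \<in> {0..T}" for t
    unfolding u_def
  proof (rule fourier_coeff_of_coeffs[OF s], rule hs_seq_mono[OF hB])
    show "\<bar>norm (c t k)\<bar> \<le> B k" for k using dominated_familyD(2)[OF dc that, of k] by simp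
  qed
  have int: "has_Hs_integral s (lebesgue_on {0..t}) (\<lambda>t'. propagator b (t - t') (F t')) (u t - propagator b t u0)"
    if t: "t \<in> {0..T}" for t
  proof (rule dominated_has_Hs_integral(2)[OF s _ dw[OF t] wc[OF t]])
    show "fourier_coeff (u t - propagator b t u0) k = integral {0..t} (\<lambda>t'. w t t' k)" for k
      by (simp add: fourier_coeff_diff uc[OF t] fourier_coeff_propagator[OF s u0] c_def E_def)
  qed (use t in auto)
  have "u 0 = u0"
  proof (rule fourier_coeff_inject)
    have "c 0 = fourier_coeff u0" by (simp add: fun_eq_iff c_def E_def)
    then show "fourier_coeff (u 0) = fourier_coeff u0" using uc[of 0] T by simp
  qed
  then have mild: "mild_solution s b T F u0 u"
    unfolding mild_solution_def using dominated_C_Hs[OF dc uc] int by blast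
  have uniq: "v t = u t" if v: "mild_solution s b T F u0 v" and t: "t \<in> {0..T}" for v t
  proof -
    have "has_Hs_integral s (lebesgue_on {0..t}) (\<lambda>t'. propagator b (t - t') (F t')) (v t - propagator b t u0)"
      using v t by (simp add: mild_solution_def)
    moreover have "(\<lambda>t'. fourier_coeff (propagator b (t - t') (F t')) k) \<in> borel_measurable (lebesgue_on {0..t})" for k
    proof (rule continuous_imp_measurable_on_sets_lebesgue)
      show "continuous_on {0..t} (\<lambda>t'. fourier_coeff (propagator b (t - t') (F t')) k)"
        using dominated_familyD(3)[OF dw[OF t], of k] wc[OF t] by (simp cong: continuous_on_cong_simp)
    qed simp
    ultimately have "v t - propagator b t u0 = u t - propagator b t u0"
      using has_Hs_integral_unique[OF s _ int[OF t]] by blast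
    then show ?thesis by simp
  qed
  show thesis
  proof (rule that[of u])
    show "mild_solution s b T F u0 u" by (rule mild)
    show "v t = u t" if "mild_solution s b T F u0 v" "t \<in> {0..T}" for v t by (rule uniq[OF that])
  qed (use T in \<open>simp add: uc c_def w_def E_def\<close>)
qed

section \<open>Time reversal, gap conditions and assembly of the control\<close>

lemma integral_time_reversal:
  fixes F :: "real \<Rightarrow> complex"
  shows "integral {0..T} (\<lambda>t. F (T - t)) = integral {0..T} F"
proof -
  have "integral {- T - - T..0 - - T} (\<lambda>t. F (- (t + - T))) = integral {- T..0} (\<lambda>t. F (- t))"
    by (rule integral_shift_real_ivl[of "- T" "- T" 0 "\<lambda>t. F (- t)"])
  also have "\<dots> = integral {0..T} F" using Henstock_Kurzweil_Integration.integral_reflect_real[of T 0 F] by simp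
  finally show ?thesis by simp
qed

text \<open>If a mode had an eigenvalue missing on \<open>K\<close>, it could be added to
  \<open>K\<close>. So moment conditions imposed on the eigenvalues of \<open>K\<close> are
  conditions at all eigenvalues.\<close>

lemma maximal_separating_range:
  assumes inj: "inj_on lam K" and max: "\<And>J. K \<subseteq> J \<Longrightarrow> inj_on lam J \<Longrightarrow> J = K"
  shows "range lam = lam ` K"
proof -
  have "lam k \<in> lam ` K" for k
  proof (rule ccontr)
    assume k: "lam k \<notin> lam ` K"
    then have "inj_on lam (insert k K)" using inj by auto
    with max[of "insert k K"] have "insert k K = K" by blast
    with k show False by blast
  qed
  then show ?thesis by blast
qed

lemma separated_spectral_gap:
  assumes "ereal g \<le> spectral_gap lam K"
  shows "separated g (lam ` K)"
  unfolding separated_def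
proof (intro ballI impI)
  fix x y assume "x \<in> lam ` K" "y \<in> lam ` K" "x \<noteq> y"
  then obtain k k' where k: "k \<in> K" "k' \<in> K" "k \<noteq> k'" "x = lam k" "y = lam k'" by blast
  have "spectral_gap lam K \<le> ereal \<bar>lam k - lam k'\<bar>"
    unfolding spectral_gap_def by (rule INF_lower2[of "(k, k')"]) (use k in auto)
  with assms have "ereal g \<le> ereal \<bar>lam k - lam k'\<bar>" by (rule order_trans)
  then show "g \<le> \<bar>x - y\<bar>" using k by simp
qed

text \<open>The asymptotic gap is a supremum, possibly infinite and possibly not attained. A finite
  exceptional set and a real \<open>g\<close> strictly between 2 pi/T and the remaining gap put the
  condition on \<open>T\<close> into usable form.\<close>

lemma control_time_gap:
  assumes gap: "0 < spectral_gap lam K" and T: "ereal (2 * pi) / asymptotic_gap lam K < ereal T"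
  obtains S g where "0 < T" "S \<subseteq> K" "finite S" "ereal g < spectral_gap lam (K - S)" "2 * pi < g * T"
proof -
  have "spectral_gap lam (K - {}) \<le> asymptotic_gap lam K"
    unfolding asymptotic_gap_def by (rule SUP_upper) simp
  then have ag: "0 < asymptotic_gap lam K" using gap by simp
  have "0 \<le> ereal (2 * pi) / asymptotic_gap lam K" using ag by (cases "asymptotic_gap lam K") auto
  then have T0: "0 < T" using T by (metis ereal_less(2) order_le_less_trans)
  have "ereal (2 * pi / T) < asymptotic_gap lam K"
  proof (cases "asymptotic_gap lam K")
    case (real a)
    then have "0 < a" "2 * pi / a < T" using ag T by auto
    then have "2 * pi / T < a" using T0 by (simp add: divide_less_eq mult.commute)
    then show ?thesis using real by simp
  qed (use ag in auto)
  then obtain S where S: "S \<subseteq> K" "finite S" "ereal (2 * pi / T) < spectral_gap lam (K - S)"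
    unfolding asymptotic_gap_def less_SUP_iff by blast
  obtain g where g: "ereal (2 * pi / T) < ereal g" "ereal g < spectral_gap lam (K - S)"
    using ereal_dense2[OF S(3)] by blast
  then have "2 * pi < g * T" using T0 by (simp add: divide_less_eq)
  then show thesis using that T0 S g by blast
qed

text \<open>The constant can be fixed before \<open>g1\<close> because that profile enters the
  resonant blocks only through its normalised mean, and the block inverses are bounded in terms of
  this mean alone.\<close>

theorem theorem1p2:
  fixes s r C N0 T :: real
    and b :: "int \<times> int \<Rightarrow> real"
    and g2 :: "real \<Rightarrow> real"
    and K :: "(int \<times> int) set"
  assumes "s \<ge> 0" and "r \<ge> 1" and "C > 0" and "N0 \<ge> 0"
    and "\<And>k. freq_norm k \<ge> N0 \<Longrightarrow> \<bar>b k\<bar> \<le> C * freq_norm k powr (r - 1)"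
    and "\<And>k1 k2. eigen_freq b (- k1, k2) = - eigen_freq b (k1, k2)"
    and "\<And>k1 k2. eigen_freq b (k1, - k2) = eigen_freq b (k1, k2)"
    and "\<And>k1 k2 j2. k1 \<noteq> 0 \<Longrightarrow> eigen_freq b (k1, j2) = eigen_freq b (k1, k2) \<Longrightarrow>
            j2 = k2 \<or> j2 = - k2"
    and "\<And>k1 k2 j1. k2 \<noteq> 0 \<Longrightarrow> eigen_freq b (j1, k2) = eigen_freq b (k1, k2) \<Longrightarrow> j1 = k1"
    and "inj_on (eigen_freq b) K"
    and "\<And>J. K \<subseteq> J \<Longrightarrow> inj_on (eigen_freq b) J \<Longrightarrow> J = K"
    and "spectral_gap (eigen_freq b) K > 0"
    and "ereal T > ereal (2 * pi) / asymptotic_gap (eigen_freq b) K"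
    and "control_profile g2"
  shows "\<exists>\<nu>>0. \<forall>g1. control_profile g1 \<longrightarrow>
    (\<forall>u0\<in>Hs s. \<forall>u1\<in>Hs s. fourier_coeff u0 (0, 0) = fourier_coeff u1 (0, 0) \<longrightarrow>
      (\<exists>h\<in>L2_Hs T s.
        (\<exists>u. mild_solution s b T (\<lambda>t. G g1 g2 (h t)) u0 u \<and>
             (\<forall>v. mild_solution s b T (\<lambda>t. G g1 g2 (h t)) u0 v \<longrightarrow> (\<forall>t\<in>{0..T}. v t = u t)) \<and>
             u T = u1) \<and>
        L2_Hs_norm T s h \<le> \<nu> * (Hs_norm s u0 + Hs_norm s u1)))"
proof -
  let ?lam = "eigen_freq b"
  note s = assms(1) and sym = assms(7) and col = assms(8) and row = assms(9) and g2 = assms(14)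
  have range: "range ?lam = ?lam ` K" by (rule maximal_separating_range[OF assms(10,11)])
  obtain S g where T: "0 < T" and S: "S \<subseteq> K" "finite S" "ereal g < spectral_gap ?lam (K - S)" and gT: "2 * pi < g * T"
    using control_time_gap[OF assms(12,13)] by blast
  \<comment> \<open>The gap over \<open>K\<close> may be infinite, so a real number below it is
    taken.\<close>
  obtain \<gamma> where \<gamma>: "0 < \<gamma>" "ereal \<gamma> < spectral_gap ?lam K"
    using ereal_dense2[OF assms(12)] by (auto simp: zero_ereal_def)
  have sep: "separated \<gamma> (?lam ` K)" by (rule separated_spectral_gap[OF less_imp_le[OF \<gamma>(2)]])
  have "separated g (?lam ` (K - S))" by (rule separated_spectral_gap[OF less_imp_le[OF S(3)]])
  then have sep': "separated g (?lam ` K - ?lam ` S)" unfolding separated_def by blast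
  obtain B where B: "0 \<le> B"
    "\<And>l. l \<in> ?lam ` K \<Longrightarrow> \<exists>q. pulse T B q \<and> (\<forall>\<nu>\<in>?lam ` K. moment q \<nu> = (if \<nu> = l then 1 else 0))"
    using biorthogonal_pulses[OF sep \<gamma>(1) _ sep' T gT] S(2) by blast
  have "\<exists>q. pulse T B q \<and> (\<forall>j. moment q (?lam j) = (if ?lam j = ?lam k then 1 else 0))" for k
  proof -
    have r: "?lam j \<in> ?lam ` K" for j using range by blast
    show ?thesis using B(2)[OF r[of k]] r by metis
  qed
  \<comment> \<open>The pulses are chosen mode by mode, so modes with equal eigenvalue may receive
    different ones; only their moments at the eigenvalues matter, and these agree.\<close>
  then obtain q where q: "\<And>k. pulse T B (q k)" "\<And>k j. moment (q k) (?lam j) = (if ?lam j = ?lam k then 1 else 0)"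
    by metis
  \<comment> \<open>\<open>sqrt T\<close> comes from the L2 norm in time, \<open>B\<close> from the
    pulses, \<open>(2 * pi)\<^sup>2\<close> from the block inverses and 2 from a mode and its
    mirror. Adding 1 makes the constant positive even when \<open>B\<close> is 0.\<close>
  define \<nu> where "\<nu> = sqrt T * (B * ((2 * pi)\<^sup>2 * 2)) + 1"
  have \<nu>: "0 < \<nu>" using T B(1) by (simp add: \<nu>_def add_nonneg_pos)
  show ?thesis
  proof (intro exI[of _ \<nu>] conjI \<nu> allI impI ballI)
    fix g1 u0 u1
    assume g1: "control_profile g1" and u0: "u0 \<in> Hs s" and u1: "u1 \<in> Hs s"
      and u01: "fourier_coeff u0 (0, 0) = fourier_coeff u1 (0, 0)"
    note sm = control_profile_smooth_real[OF g1] control_profile_smooth_real[OF g2]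
    \<comment> \<open>The part of the target that the free evolution misses. At the origin the
      frequency is 0, so there it is the difference of the two means, which vanishes by
      assumption.\<close>
    define c where "c k = fourier_coeff u1 k - exp (\<i> * complex_of_real (?lam k * T)) * fourier_coeff u0 k" for k
    define m where "m k = norm (fourier_coeff u0 k) + norm (fourier_coeff u1 k)" for k
    have c0: "c (0, 0) = 0" using u01 by (simp add: c_def eigen_freq_def)
    have cm: "norm (c k) \<le> m k" for k
    proof -
      have "norm (c k) \<le> norm (fourier_coeff u1 k) + norm (exp (\<i> * complex_of_real (?lam k * T)) * fourier_coeff u0 k)"
        unfolding c_def by (rule norm_triangle_ineq4)
      also have "norm (exp (\<i> * complex_of_real (?lam k * T)) * fourier_coeff u0 k) = norm (fourier_coeff u0 k)"
        unfolding norm_mult norm_exp_i_times by simp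
      finally show ?thesis by (simp add: m_def)
    qed
    have hm: "hs_seq s m" "hs_seq_norm s m \<le> Hs_norm s u0 + Hs_norm s u1"
      using hs_seq_add[of s "\<lambda>k. norm (fourier_coeff u0 k)" "\<lambda>k. norm (fourier_coeff u1 k)"]
        hs_seq_norm_add[of s "\<lambda>k. norm (fourier_coeff u0 k)" "\<lambda>k. norm (fourier_coeff u1 k)"] u0 u1
      by (simp_all add: m_def[abs_def] Hs_iff Hs_norm_eq)
    obtain a where a: "\<And>k. norm (a k) \<le> (2 * pi)\<^sup>2 * (norm (c k) + norm (c (fst k, - snd k)))"
      "\<And>k. ((\<lambda>j. G_matrix g1 g2 k j * (if ?lam j = ?lam k then a j else 0)) has_sum c k) UNIV"
      by (rule resonant_inverse[of ?lam g1 g2 c]) (rule sym, erule (1) col, erule (1) row, rule g1, rule g2, rule c0, blast)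
    define A where "A k = B * ((2 * pi)\<^sup>2 * (m k + m (fst k, - snd k)))" for k
    note swap = hs_seq_mirror[OF hm(1)]
    have hA: "hs_seq s A" unfolding A_def by (intro hs_seq_cmult hs_seq_add hm(1) swap(1))
    have nA: "hs_seq_norm s A \<le> B * ((2 * pi)\<^sup>2 * 2) * (Hs_norm s u0 + Hs_norm s u1)"
    proof -
      have "hs_seq_norm s A = B * ((2 * pi)\<^sup>2 * hs_seq_norm s (\<lambda>k. m k + m (fst k, - snd k)))"
        unfolding A_def hs_seq_norm_cmult using B(1) by simp
      also have "\<dots> \<le> B * ((2 * pi)\<^sup>2 * (2 * (Hs_norm s u0 + Hs_norm s u1)))"
        using hs_seq_norm_add[OF hm(1) swap(1)] swap(2) hm(2) B(1) by (intro mult_left_mono) auto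
      finally show ?thesis by (simp only: mult.assoc)
    qed
    have A0: "0 \<le> A k" for k using B(1) by (simp add: A_def m_def)
    \<comment> \<open>Time is reversed because the group acts for the remaining time T - t; after
      the substitution \<tau> = T - t the moments of the pulse appear.\<close>
    define H where "H t k = q k (T - t) * a k" for t k
    have qB: "norm (q k t) \<le> B" and cq: "continuous_on UNIV (q k)" for k t
      using q(1)[of k] by (auto simp: pulse_def)
    have HA: "norm (H t k) \<le> A k" for t k
    proof -
      have "norm (a k) \<le> (2 * pi)\<^sup>2 * (m k + m (fst k, - snd k))"
        by (rule order_trans[OF a(1)]) (intro mult_left_mono add_mono cm, simp)
      from mult_mono[OF qB this B(1)] show ?thesis by (simp add: H_def A_def norm_mult)
    qed
    have dH: "dominated_family s T A H"
      unfolding dominated_family_def H_def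
      by (intro conjI ballI allI hA HA[unfolded H_def] continuous_on_mult continuous_on_const
          continuous_on_compose2[OF cq] continuous_on_diff continuous_on_id subset_UNIV)
    define h where "h t = of_coeffs (H t)" for t
    have hH: "fourier_coeff (h t) = H t" for t
      unfolding h_def by (rule fourier_coeff_of_coeffs[OF s], rule hs_seq_mono[OF hA]) (simp add: HA)
    note L2 = dominated_L2_Hs[OF s less_imp_le[OF T] dH hH]
    obtain A' where A': "dominated_family s T A' (\<lambda>t. fourier_coeff (G g1 g2 (h t)))" "\<And>k. 0 \<le> A' k"
      "\<And>k t. t \<in> {0..T} \<Longrightarrow> fourier_coeff (G g1 g2 (h t)) k = (\<Sum>\<^sub>\<infinity>j. G_matrix g1 g2 k j * H t j)"
      "\<And>k. (\<lambda>j. norm (G_matrix g1 g2 k j) * A j) summable_on UNIV"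
      using G_dominated[OF s sm dH A0 hH] by blast
    obtain u where u: "mild_solution s b T (\<lambda>t. G g1 g2 (h t)) u0 u"
      "\<And>v t. mild_solution s b T (\<lambda>t. G g1 g2 (h t)) u0 v \<Longrightarrow> t \<in> {0..T} \<Longrightarrow> v t = u t"
      "\<And>k. fourier_coeff (u T) k = exp (\<i> * complex_of_real (?lam k * T)) * fourier_coeff u0 k +
         integral {0..T} (\<lambda>t. exp (\<i> * complex_of_real (?lam k * (T - t))) * fourier_coeff (G g1 g2 (h t)) k)"
      using mild_solution_dominated[OF s less_imp_le[OF T] u0 A'(1,2)] by blast
    have "u T = u1"
    proof (rule fourier_coeff_inject, rule ext)
      fix k
      let ?E = "\<lambda>t. exp (\<i> * complex_of_real (?lam k * t))"
      define f where "f j t = ?E (T - t) * (G_matrix g1 g2 k j * H t j)" for j t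
      \<comment> \<open>Exchanging the sum over modes with the time integral lets biorthogonality
        act on each mode separately: every column whose eigenvalue differs from that of row
        \<open>k\<close> drops out, and the resonant equation solved by \<open>a\<close> is
        left.\<close>
      have "((\<lambda>j. integral (cbox 0 T) (f j)) has_sum integral (cbox 0 T) (\<lambda>t. \<Sum>\<^sub>\<infinity>j. f j t)) UNIV"
      proof (rule has_sum_integral_cbox[OF _ A'(4)[of k]])
        fix j t
        have "norm (f j t) = norm (G_matrix g1 g2 k j) * norm (H t j)"
          unfolding f_def norm_mult norm_exp_i_times by simp
        also have "\<dots> \<le> norm (G_matrix g1 g2 k j) * A j" by (intro mult_left_mono HA) auto
        finally show "norm (f j t) \<le> norm (G_matrix g1 g2 k j) * A j" .
      next
        fix j
        show "continuous_on (cbox 0 T) (f j)"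
          unfolding f_def H_def by (intro continuous_intros continuous_on_compose2[OF cq]) auto
      qed
      moreover have "integral (cbox 0 T) (f j) = G_matrix g1 g2 k j * (if ?lam j = ?lam k then a j else 0)" for j
      proof -
        have "integral (cbox 0 T) (f j) = integral {0..T} (\<lambda>t. (\<lambda>\<tau>. G_matrix g1 g2 k j * a j * (q j \<tau> * ?E \<tau>)) (T - t))"
          by (simp add: f_def[abs_def] H_def mult_ac)
        also have "\<dots> = G_matrix g1 g2 k j * a j * integral {0..T} (\<lambda>\<tau>. q j \<tau> * ?E \<tau>)"
          by (subst integral_time_reversal[of T "\<lambda>\<tau>. G_matrix g1 g2 k j * a j * (q j \<tau> * ?E \<tau>)"]) simp
        also have "integral {0..T} (\<lambda>\<tau>. q j \<tau> * ?E \<tau>) = moment (q j) (?lam k)"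
          by (rule moment_eq[OF q(1), symmetric]) auto
        finally show ?thesis by (simp add: q(2))
      qed
      ultimately have "integral (cbox 0 T) (\<lambda>t. \<Sum>\<^sub>\<infinity>j. f j t) = c k"
        using has_sum_unique[OF _ a(2)[of k]] by simp
      moreover have "integral (cbox 0 T) (\<lambda>t. \<Sum>\<^sub>\<infinity>j. f j t) =
          integral {0..T} (\<lambda>t. ?E (T - t) * fourier_coeff (G g1 g2 (h t)) k)"
        unfolding box_real(2) by (intro integral_cong) (simp add: A'(3) f_def infsum_cmult_right')
      ultimately have "integral {0..T} (\<lambda>t. ?E (T - t) * fourier_coeff (G g1 g2 (h t)) k) = c k" by simp
      then show "fourier_coeff (u T) k = fourier_coeff u1 k"
        unfolding u(3) by (simp only: c_def) simp
    qed
    moreover have "L2_Hs_norm T s h \<le> \<nu> * (Hs_norm s u0 + Hs_norm s u1)"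
    proof -
      have "sqrt T * hs_seq_norm s A \<le> sqrt T * (B * ((2 * pi)\<^sup>2 * 2) * (Hs_norm s u0 + Hs_norm s u1))"
        using T by (intro mult_left_mono nA) auto
      also have "\<dots> \<le> \<nu> * (Hs_norm s u0 + Hs_norm s u1)"
        unfolding \<nu>_def by (simp add: distrib_right mult.assoc Hs_norm_eq hs_seq_norm_nonneg)
      finally show ?thesis using L2(2) by linarith
    qed
    ultimately show "\<exists>h\<in>L2_Hs T s.
        (\<exists>u. mild_solution s b T (\<lambda>t. G g1 g2 (h t)) u0 u \<and>
             (\<forall>v. mild_solution s b T (\<lambda>t. G g1 g2 (h t)) u0 v \<longrightarrow> (\<forall>t\<in>{0..T}. v t = u t)) \<and>
             u T = u1) \<and>
        L2_Hs_norm T s h \<le> \<nu> * (Hs_norm s u0 + Hs_norm s u1)"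
      using L2(1) u(1,2) by (intro bexI[of _ h] conjI exI[of _ u]) auto
  qed
qed

end
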